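(* Let $\mathcal C$ be a tensor category and $\mathcal M$ an exact indecomposable left $\mathcal C$-module category, with relative Serre functor $\mathbb S_{\mathcal M}$. There exists an equivalence (natural module isomorphism) of $\mathcal C$-module functors $\mathcal M\to\mathcal M^{bop}$ $$\mathbb S_{\mathcal M}\simeq\oint^{\overline U\in\mathcal M^{op}}\big(\underline{\mathrm{Hom}}_{\mathcal M}(-,U)^*\triangleright U,\gamma\big),$$ where the right-hand side is the functor sending $M\in\mathcal M$ to the module coend $\oint^{\overline U\in\mathcal M^{op}}(T_M,\gamma)$ over the right $\mathcal C$-module category $\mathcal M^{op}$ of the functor $T_M(U,V)=\underline{\mathrm{Hom}}_{\mathcal M}(M,V)^*\triangleright U$ with the pre-balancing $\gamma$ described in the context.
   Context: $k$ is a field; all categories are finite abelian $k$-linear; functors are additive and $k$-linear (in each variable). A tensor category $\mathcal C$ is a rigid monoidal category (with $k$-bilinear tensor product) with simple unit $\mathbf 1$. For $X\in\mathcal C$: $X^*$ is the dual with $\mathrm{ev}_X:X^*\otimes X\to\mathbf 1$, $\mathrm{coev}_X:\mathbf 1\to X\otimes X^*$; ${}^*X$ is the dual with $\mathrm{ev}_X:X\otimes{}^*X\to\mathbf 1$, $\mathrm{coev}_X:\mathbf 1\to{}^*X\otimes X$; $({}^*X)^*$ is identified with $X$. Left/right $\mathcal C$-module categories have actions $\triangleright,\triangleleft$ exact in each variable with usual coherent associativity isomorphisms $m_{X,Y,M}:(X\otimes Y)\triangleright M\to X\triangleright(Y\triangleright M)$, resp. $\widetilde m_{N,X,Y}:N\triangleleft(X\otimes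 Y)\to(N\triangleleft X)\triangleleft Y$, and unit isomorphisms (suppressed). $\mathcal M$ is exact if $P\triangleright M$ is projective for all projective $P\in\mathcal C$ and all $M\in\mathcal M$; indecomposable if not equivalent to a direct sum of two nontrivial module categories. Internal Hom: $\underline{\mathrm{Hom}}_{\mathcal M}(M,N)\in\mathcal C$ represents $\mathrm{Hom}_{\mathcal M}(-\triangleright M,N)$. There are canonical natural isomorphisms $\underline{\mathrm{Hom}}(M,X\triangleright N)\simeq X\otimes\underline{\mathrm{Hom}}(M,N)$ and $\underline{\mathrm{Hom}}(X\triangleright M,N)\simeq\underline{\mathrm{Hom}}(M,N)\otimes X^*$. Relative Serre functor: a functor $\mathbb S_{\mathcal M}:\mathcal M\to\mathcal M$ with natural isomorphisms $\underline{\mathrm{Hom}}(M,N)^*\simeq\underline{\mathrm{Hom}}(N,\mathbb S_{\mathcal M}(M))$; it exists for exact $\mathcal M$, is unique up to isomorphism, and is a $\mathcal C$-module equivalence $\mathcal M\to\mathcal M^{bop}$. Opposites: $\mathcal M^{op}$ is a right $\mathcal C$-module category via $\overline M\blacktriangleleft X=\overline{X^*\triangleright M}$. $\mathcal M^{bop}$ is $\mathcal M$ as a category with left action $(X,M)\mapsto X^{**}\triangleright M$. Module coend over a right $\mathcal C$-module category $\mathcal N$: let $S:\mathcal N^{op}\times\mathcal N\to\mathcal B$ have a pre-balancing, i.e. a natural isomorphism $\gamma^X_{M,N}:S(M\triangleleft X,N)\to S(M,N\triangleleft{}^*X)$. The module coend $\oint^{N\in\mathcal N}(S,\gamma)$ is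 an object $C\in\mathcal B$ with a dinatural $\lambda_N:S(N,N)\to C$ satisfying, for all $X,N$, $$\lambda_N\,S(\mathrm{id}_N\triangleleft\mathrm{coev}_X,\mathrm{id}_N)=\lambda_{N\triangleleft{}^*X}\,\gamma^X_{N\triangleleft{}^*X,N}\,S(\widetilde m^{-1}_{N,{}^*X,X},\mathrm{id}_N)$$ (with $\mathrm{coev}_X:\mathbf 1\to{}^*X\otimes X$), and universal (initial) with this property. Here $T_M:(\mathcal M^{op})^{op}\times\mathcal M^{op}\to\mathcal M$, $T_M(U,V)=\underline{\mathrm{Hom}}_{\mathcal M}(M,V)^*\triangleright U$, and $\gamma^X_{U,V}:T_M(U\blacktriangleleft X,V)\to T_M(U,V\blacktriangleleft{}^*X)$ is the composition $$\underline{\mathrm{Hom}}(M,V)^*\triangleright(X^*\triangleright U)\xrightarrow{m^{-1}}(\underline{\mathrm{Hom}}(M,V)^*\otimes X^* )\triangleright U\to(X\otimes\underline{\mathrm{Hom}}(M,V))^*\triangleright U\to\underline{\mathrm{Hom}}(M,X\triangleright V)^*\triangleright U$$ of canonical isomorphisms. The $\mathcal C$-module structure of $M\mapsto\oint^{\overline U}(T_M,\gamma)$ as a functor $\mathcal M\to\mathcal M^{bop}$ is induced by $\underline{\mathrm{Hom}}(X\triangleright M,V)\simeq\underline{\mathrm{Hom}}(M,V)\otimes X^*$. *)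

theory Defs
  imports Main
begin

section \<open>Categories, functors, natural transformations\<close>

text \<open>Composition is written in the order \<open>g \<cdot> f\<close> (first \<open>f\<close>). Functors and structural data are
  total functions on the underlying types; only their values on objects and arrows matter.\<close>

record ('o, 'a) cat =
  Obj :: "'o set"
  Arr :: "'a set"
  Dom :: "'a \<Rightarrow> 'o"
  Cod :: "'a \<Rightarrow> 'o"
  Idt :: "'o \<Rightarrow> 'a"
  Cmp :: "'a \<Rightarrow> 'a \<Rightarrow> 'a"  (infixr "\<cdot>\<index>" 65)

definition hom :: "('o, 'a, 'z) cat_scheme \<Rightarrow> 'o \<Rightarrow> 'o \<Rightarrow> 'a set" where
  "hom C X Y = {f \<in> Arr C. Dom C f = X \<and> Cod C f = Y}"

locale category =
  fixes C :: "('o, 'a, 'z) cat_scheme" (structure)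
  assumes dom_cod: "f \<in> Arr C \<Longrightarrow> Dom C f \<in> Obj C \<and> Cod C f \<in> Obj C"
    and id_hom: "X \<in> Obj C \<Longrightarrow> Idt C X \<in> hom C X X"
    and cmp_hom: "f \<in> hom C X Y \<Longrightarrow> g \<in> hom C Y Z \<Longrightarrow> g \<cdot> f \<in> hom C X Z"
    and cmp_id_right: "f \<in> hom C X Y \<Longrightarrow> f \<cdot> Idt C X = f"
    and cmp_id_left: "f \<in> hom C X Y \<Longrightarrow> Idt C Y \<cdot> f = f"
    and cmp_assoc: "f \<in> hom C W X \<Longrightarrow> g \<in> hom C X Y \<Longrightarrow> h \<in> hom C Y Z
          \<Longrightarrow> (h \<cdot> g) \<cdot> f = h \<cdot> (g \<cdot> f)"

definition inverse_arrows :: "('o, 'a, 'z) cat_scheme \<Rightarrow> 'a \<Rightarrow> 'a \<Rightarrow> bool" where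
  "inverse_arrows C f g \<longleftrightarrow> f \<in> Arr C \<and> g \<in> hom C (Cod C f) (Dom C f)
     \<and> g \<cdot>\<^bsub>C\<^esub> f = Idt C (Dom C f) \<and> f \<cdot>\<^bsub>C\<^esub> g = Idt C (Cod C f)"

definition iso_arrow :: "('o, 'a, 'z) cat_scheme \<Rightarrow> 'a \<Rightarrow> bool" where
  "iso_arrow C f \<longleftrightarrow> (\<exists>g. inverse_arrows C f g)"

definition cinv :: "('o, 'a, 'z) cat_scheme \<Rightarrow> 'a \<Rightarrow> 'a" where
  "cinv C f = (THE g. inverse_arrows C f g)"

definition isomorphic :: "('o, 'a, 'z) cat_scheme \<Rightarrow> 'o \<Rightarrow> 'o \<Rightarrow> bool" where
  "isomorphic C X Y \<longleftrightarrow> (\<exists>f \<in> hom C X Y. iso_arrow C f)"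

definition monic :: "('o, 'a, 'z) cat_scheme \<Rightarrow> 'a \<Rightarrow> bool" where
  "monic C f \<longleftrightarrow> f \<in> Arr C \<and>
     (\<forall>W. \<forall>g \<in> hom C W (Dom C f). \<forall>h \<in> hom C W (Dom C f). f \<cdot>\<^bsub>C\<^esub> g = f \<cdot>\<^bsub>C\<^esub> h \<longrightarrow> g = h)"

definition epic :: "('o, 'a, 'z) cat_scheme \<Rightarrow> 'a \<Rightarrow> bool" where
  "epic C f \<longleftrightarrow> f \<in> Arr C \<and>
     (\<forall>W. \<forall>g \<in> hom C (Cod C f) W. \<forall>h \<in> hom C (Cod C f) W. g \<cdot>\<^bsub>C\<^esub> f = h \<cdot>\<^bsub>C\<^esub> f \<longrightarrow> g = h)"

definition op_cat :: "('o, 'a, 'z) cat_scheme \<Rightarrow> ('o, 'a) cat" where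
  "op_cat C = \<lparr>Obj = Obj C, Arr = Arr C, Dom = Cod C, Cod = Dom C, Idt = Idt C,
     Cmp = (\<lambda>g f. f \<cdot>\<^bsub>C\<^esub> g)\<rparr>"

definition prod_cat ::
  "('o, 'a, 'z) cat_scheme \<Rightarrow> ('p, 'b, 'y) cat_scheme \<Rightarrow> ('o \<times> 'p, 'a \<times> 'b) cat" where
  "prod_cat C D = \<lparr>Obj = Obj C \<times> Obj D, Arr = Arr C \<times> Arr D,
     Dom = (\<lambda>(f, g). (Dom C f, Dom D g)), Cod = (\<lambda>(f, g). (Cod C f, Cod D g)),
     Idt = (\<lambda>(X, Y). (Idt C X, Idt D Y)),
     Cmp = (\<lambda>(g, g') (f, f'). (g \<cdot>\<^bsub>C\<^esub> f, g' \<cdot>\<^bsub>D\<^esub> f'))\<rparr>"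

record ('o, 'a, 'p, 'b) fctr =
  fob :: "'o \<Rightarrow> 'p"
  far :: "'a \<Rightarrow> 'b"

definition is_functor ::
  "('o, 'a, 'z) cat_scheme \<Rightarrow> ('p, 'b, 'y) cat_scheme \<Rightarrow> ('o, 'a, 'p, 'b) fctr \<Rightarrow> bool" where
  "is_functor C D F \<longleftrightarrow> category C \<and> category D
     \<and> (\<forall>X \<in> Obj C. fob F X \<in> Obj D)
     \<and> (\<forall>f \<in> Arr C. far F f \<in> hom D (fob F (Dom C f)) (fob F (Cod C f)))
     \<and> (\<forall>X \<in> Obj C. far F (Idt C X) = Idt D (fob F X))
     \<and> (\<forall>f \<in> Arr C. \<forall>g \<in> Arr C. Cod C f = Dom C g \<longrightarrow> far F (g \<cdot>\<^bsub>C\<^esub> f) = far F g \<cdot>\<^bsub>D\<^esub> far F f)"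

definition bifctr ::
  "('o \<Rightarrow> 'p \<Rightarrow> 'q) \<Rightarrow> ('a \<Rightarrow> 'b \<Rightarrow> 'c) \<Rightarrow> ('o \<times> 'p, 'a \<times> 'b, 'q, 'c) fctr" where
  "bifctr t u = \<lparr>fob = (\<lambda>(X, Y). t X Y), far = (\<lambda>(f, g). u f g)\<rparr>"

definition id_fctr :: "('o, 'a, 'o, 'a) fctr" where
  "id_fctr = \<lparr>fob = (\<lambda>X. X), far = (\<lambda>f. f)\<rparr>"

definition comp_fctr ::
  "('p, 'b, 'q, 'c) fctr \<Rightarrow> ('o, 'a, 'p, 'b) fctr \<Rightarrow> ('o, 'a, 'q, 'c) fctr" where
  "comp_fctr G F = \<lparr>fob = (\<lambda>X. fob G (fob F X)), far = (\<lambda>f. far G (far F f))\<rparr>"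

definition nat_iso ::
  "('o, 'a, 'z) cat_scheme \<Rightarrow> ('p, 'b, 'y) cat_scheme
     \<Rightarrow> ('o, 'a, 'p, 'b) fctr \<Rightarrow> ('o, 'a, 'p, 'b) fctr \<Rightarrow> ('o \<Rightarrow> 'b) \<Rightarrow> bool" where
  "nat_iso C D F G \<eta> \<longleftrightarrow>
     (\<forall>X \<in> Obj C. \<eta> X \<in> hom D (fob F X) (fob G X) \<and> iso_arrow D (\<eta> X))
     \<and> (\<forall>f \<in> Arr C. \<eta> (Cod C f) \<cdot>\<^bsub>D\<^esub> far F f = far G f \<cdot>\<^bsub>D\<^esub> \<eta> (Dom C f))"

definition is_equivalence ::
  "('o, 'a, 'z) cat_scheme \<Rightarrow> ('p, 'b, 'y) cat_scheme \<Rightarrow> ('o, 'a, 'p, 'b) fctr \<Rightarrow> bool" where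
  "is_equivalence C D F \<longleftrightarrow> is_functor C D F \<and>
     (\<exists>G \<eta> \<epsilon>. is_functor D C G \<and> nat_iso C C id_fctr (comp_fctr G F) \<eta>
        \<and> nat_iso D D (comp_fctr F G) id_fctr \<epsilon>)"


section \<open>Finite abelian linear categories\<close>

text \<open>\<open>Zer C X Y\<close> is the zero arrow from \<open>X\<close> to \<open>Y\<close>.\<close>

record ('o, 'a, 'k) lincat = "('o, 'a) cat" +
  Add :: "'a \<Rightarrow> 'a \<Rightarrow> 'a"
  Zer :: "'o \<Rightarrow> 'o \<Rightarrow> 'a"
  Scl :: "'k \<Rightarrow> 'a \<Rightarrow> 'a"

locale linear_category = category C
  for C :: "('o, 'a, 'k::field, 'z) lincat_scheme" (structure) +
  assumes add_hom: "f \<in> hom C X Y \<Longrightarrow> g \<in> hom C X Y \<Longrightarrow> Add C f g \<in> hom C X Y"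
    and zer_hom: "X \<in> Obj C \<Longrightarrow> Y \<in> Obj C \<Longrightarrow> Zer C X Y \<in> hom C X Y"
    and scl_hom: "f \<in> hom C X Y \<Longrightarrow> Scl C a f \<in> hom C X Y"
    and add_assoc: "f \<in> hom C X Y \<Longrightarrow> g \<in> hom C X Y \<Longrightarrow> h \<in> hom C X Y
          \<Longrightarrow> Add C (Add C f g) h = Add C f (Add C g h)"
    and add_comm: "f \<in> hom C X Y \<Longrightarrow> g \<in> hom C X Y \<Longrightarrow> Add C f g = Add C g f"
    and add_zer: "f \<in> hom C X Y \<Longrightarrow> Add C f (Zer C X Y) = f"
    and add_inv: "f \<in> hom C X Y \<Longrightarrow> \<exists>g \<in> hom C X Y. Add C f g = Zer C X Y"
    and scl_add: "f \<in> hom C X Y \<Longrightarrow> g \<in> hom C X Y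
          \<Longrightarrow> Scl C a (Add C f g) = Add C (Scl C a f) (Scl C a g)"
    and add_scl: "f \<in> hom C X Y \<Longrightarrow> Scl C (a + b) f = Add C (Scl C a f) (Scl C b f)"
    and scl_scl: "f \<in> hom C X Y \<Longrightarrow> Scl C (a * b) f = Scl C a (Scl C b f)"
    and scl_one: "f \<in> hom C X Y \<Longrightarrow> Scl C 1 f = f"
    and cmp_add_right: "f \<in> hom C X Y \<Longrightarrow> g \<in> hom C X Y \<Longrightarrow> h \<in> hom C Y Z
          \<Longrightarrow> h \<cdot> Add C f g = Add C (h \<cdot> f) (h \<cdot> g)"
    and cmp_add_left: "h \<in> hom C X Y \<Longrightarrow> f \<in> hom C Y Z \<Longrightarrow> g \<in> hom C Y Z
          \<Longrightarrow> Add C f g \<cdot> h = Add C (f \<cdot> h) (g \<cdot> h)"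
    and cmp_scl_right: "f \<in> hom C X Y \<Longrightarrow> h \<in> hom C Y Z \<Longrightarrow> h \<cdot> Scl C a f = Scl C a (h \<cdot> f)"
    and cmp_scl_left: "f \<in> hom C X Y \<Longrightarrow> h \<in> hom C Y Z \<Longrightarrow> Scl C a h \<cdot> f = Scl C a (h \<cdot> f)"

definition zero_object :: "('o, 'a, 'z) cat_scheme \<Rightarrow> 'o \<Rightarrow> bool" where
  "zero_object C Z \<longleftrightarrow> Z \<in> Obj C \<and> (\<forall>X \<in> Obj C. (\<exists>!f. f \<in> hom C X Z) \<and> (\<exists>!f. f \<in> hom C Z X))"

definition is_kernel :: "('o, 'a, 'k, 'z) lincat_scheme \<Rightarrow> 'a \<Rightarrow> 'a \<Rightarrow> bool" where
  "is_kernel C f k \<longleftrightarrow> f \<in> Arr C \<and> k \<in> Arr C \<and> Cod C k = Dom C f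
     \<and> f \<cdot>\<^bsub>C\<^esub> k = Zer C (Dom C k) (Cod C f)
     \<and> (\<forall>W. \<forall>h \<in> hom C W (Dom C f). f \<cdot>\<^bsub>C\<^esub> h = Zer C W (Cod C f)
          \<longrightarrow> (\<exists>!u. u \<in> hom C W (Dom C k) \<and> k \<cdot>\<^bsub>C\<^esub> u = h))"

definition is_cokernel :: "('o, 'a, 'k, 'z) lincat_scheme \<Rightarrow> 'a \<Rightarrow> 'a \<Rightarrow> bool" where
  "is_cokernel C f c \<longleftrightarrow> f \<in> Arr C \<and> c \<in> Arr C \<and> Dom C c = Cod C f
     \<and> c \<cdot>\<^bsub>C\<^esub> f = Zer C (Dom C f) (Cod C c)
     \<and> (\<forall>W. \<forall>h \<in> hom C (Cod C f) W. h \<cdot>\<^bsub>C\<^esub> f = Zer C (Dom C f) W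
          \<longrightarrow> (\<exists>!u. u \<in> hom C (Cod C c) W \<and> u \<cdot>\<^bsub>C\<^esub> c = h))"

definition is_biproduct :: "('o, 'a, 'k, 'z) lincat_scheme \<Rightarrow> 'o \<Rightarrow> 'o \<Rightarrow> 'o \<Rightarrow> bool" where
  "is_biproduct C X Y P \<longleftrightarrow> (\<exists>i \<in> hom C X P. \<exists>j \<in> hom C Y P. \<exists>p \<in> hom C P X. \<exists>q \<in> hom C P Y.
     p \<cdot>\<^bsub>C\<^esub> i = Idt C X \<and> q \<cdot>\<^bsub>C\<^esub> j = Idt C Y \<and> q \<cdot>\<^bsub>C\<^esub> i = Zer C X Y \<and> p \<cdot>\<^bsub>C\<^esub> j = Zer C Y X
     \<and> Add C (i \<cdot>\<^bsub>C\<^esub> p) (j \<cdot>\<^bsub>C\<^esub> q) = Idt C P)"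

locale abelian_category = linear_category C
  for C :: "('o, 'a, 'k::field, 'z) lincat_scheme" (structure) +
  assumes has_zero: "\<exists>Z. zero_object C Z"
    and has_biproducts: "X \<in> Obj C \<Longrightarrow> Y \<in> Obj C \<Longrightarrow> \<exists>P \<in> Obj C. is_biproduct C X Y P"
    and has_kernels: "f \<in> Arr C \<Longrightarrow> \<exists>k. is_kernel C f k"
    and has_cokernels: "f \<in> Arr C \<Longrightarrow> \<exists>c. is_cokernel C f c"
    and monic_kernel: "monic C k \<Longrightarrow> \<exists>f. is_kernel C f k"
    and epic_cokernel: "epic C c \<Longrightarrow> \<exists>f. is_cokernel C f c"

definition short_exact :: "('o, 'a, 'k, 'z) lincat_scheme \<Rightarrow> 'a \<Rightarrow> 'a \<Rightarrow> bool" where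
  "short_exact C f g \<longleftrightarrow> is_kernel C g f \<and> is_cokernel C f g"

definition simple_object :: "('o, 'a, 'z) cat_scheme \<Rightarrow> 'o \<Rightarrow> bool" where
  "simple_object C X \<longleftrightarrow> X \<in> Obj C \<and> \<not> zero_object C X
     \<and> (\<forall>i. monic C i \<and> Cod C i = X \<longrightarrow> zero_object C (Dom C i) \<or> iso_arrow C i)"

inductive finite_length :: "('o, 'a, 'k, 'z) lincat_scheme \<Rightarrow> 'o \<Rightarrow> bool" for C where
  zero: "zero_object C Z \<Longrightarrow> finite_length C Z"
| step: "short_exact C f g \<Longrightarrow> finite_length C (Dom C f) \<Longrightarrow> simple_object C (Cod C g)
     \<Longrightarrow> finite_length C (Cod C f)"

definition projective_object :: "('o, 'a, 'z) cat_scheme \<Rightarrow> 'o \<Rightarrow> bool" where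
  "projective_object C P \<longleftrightarrow> P \<in> Obj C
     \<and> (\<forall>e f. epic C e \<and> f \<in> hom C P (Cod C e) \<longrightarrow> (\<exists>g \<in> hom C P (Dom C e). e \<cdot>\<^bsub>C\<^esub> g = f))"

definition finite_dim_hom :: "('o, 'a, 'k, 'z) lincat_scheme \<Rightarrow> 'o \<Rightarrow> 'o \<Rightarrow> bool" where
  "finite_dim_hom C X Y \<longleftrightarrow> (\<exists>bs. set bs \<subseteq> hom C X Y \<and> (\<forall>f \<in> hom C X Y. \<exists>as.
     length as = length bs
     \<and> f = foldr (\<lambda>(a, b) acc. Add C (Scl C a b) acc) (zip as bs) (Zer C X Y)))"

locale finite_abelian_category = abelian_category C
  for C :: "('o, 'a, 'k::field, 'z) lincat_scheme" (structure) +
  assumes finite_dim: "X \<in> Obj C \<Longrightarrow> Y \<in> Obj C \<Longrightarrow> finite_dim_hom C X Y"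
    and all_finite_length: "X \<in> Obj C \<Longrightarrow> finite_length C X"
    and enough_projectives:
      "X \<in> Obj C \<Longrightarrow> \<exists>e. epic C e \<and> Cod C e = X \<and> projective_object C (Dom C e)"
    and finitely_many_simples: "\<exists>E. finite E \<and> E \<subseteq> {X. simple_object C X}
          \<and> (\<forall>X. simple_object C X \<longrightarrow> (\<exists>Y \<in> E. isomorphic C X Y))"

definition linear_functor ::
  "('o, 'a, 'k::field, 'z) lincat_scheme \<Rightarrow> ('p, 'b, 'k, 'y) lincat_scheme
     \<Rightarrow> ('o, 'a, 'p, 'b) fctr \<Rightarrow> bool" where
  "linear_functor C D F \<longleftrightarrow> linear_category C \<and> linear_category D \<and> is_functor C D F
     \<and> (\<forall>X Y. \<forall>f \<in> hom C X Y. \<forall>g \<in> hom C X Y. far F (Add C f g) = Add D (far F f) (far F g))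
     \<and> (\<forall>f \<in> Arr C. \<forall>a. far F (Scl C a f) = Scl D a (far F f))"

definition exact_functor ::
  "('o, 'a, 'k::field, 'z) lincat_scheme \<Rightarrow> ('p, 'b, 'k, 'y) lincat_scheme
     \<Rightarrow> ('o, 'a, 'p, 'b) fctr \<Rightarrow> bool" where
  "exact_functor C D F \<longleftrightarrow> linear_functor C D F
     \<and> (\<forall>f g. short_exact C f g \<longrightarrow> short_exact D (far F f) (far F g))"


section \<open>Tensor categories\<close>

text \<open>\<open>Asc C X Y Z : (X \<otimes> Y) \<otimes> Z \<rightarrow> X \<otimes> (Y \<otimes> Z)\<close>, \<open>Lun C X : 1 \<otimes> X \<rightarrow> X\<close>, \<open>Run C X : X \<otimes> 1 \<rightarrow> X\<close>.
  \<open>Dul C X\<close> is the dual \<open>X\<^sup>*\<close> with \<open>Ev C X : X\<^sup>* \<otimes> X \<rightarrow> 1\<close>, \<open>Cv C X : 1 \<rightarrow> X \<otimes> X\<^sup>*\<close>;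
  \<open>Dur C X\<close> is the other dual \<open>\<^sup>*X\<close> with \<open>Evr C X : X \<otimes> \<^sup>*X \<rightarrow> 1\<close>, \<open>Cvr C X : 1 \<rightarrow> \<^sup>*X \<otimes> X\<close>.
  A choice of both duals for every object is part of the data.\<close>

record ('o, 'a, 'k) tcat = "('o, 'a, 'k) lincat" +
  TenO :: "'o \<Rightarrow> 'o \<Rightarrow> 'o"  (infixr "\<otimes>\<index>" 75)
  TenA :: "'a \<Rightarrow> 'a \<Rightarrow> 'a"  (infixr "\<boxtimes>\<index>" 75)
  Unt :: "'o"
  Asc :: "'o \<Rightarrow> 'o \<Rightarrow> 'o \<Rightarrow> 'a"
  Lun :: "'o \<Rightarrow> 'a"
  Run :: "'o \<Rightarrow> 'a"
  Dul :: "'o \<Rightarrow> 'o"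
  Ev :: "'o \<Rightarrow> 'a"
  Cv :: "'o \<Rightarrow> 'a"
  Dur :: "'o \<Rightarrow> 'o"
  Evr :: "'o \<Rightarrow> 'a"
  Cvr :: "'o \<Rightarrow> 'a"

text \<open>\<open>dual_pair C D X e c\<close>: the arrows \<open>e : D \<otimes> X \<rightarrow> 1\<close> and \<open>c : 1 \<rightarrow> X \<otimes> D\<close> exhibit \<open>D\<close> as \<open>X\<^sup>*\<close>,
  equivalently \<open>X\<close> as \<open>\<^sup>*D\<close>.\<close>

definition dual_pair :: "('o, 'a, 'k, 'z) tcat_scheme \<Rightarrow> 'o \<Rightarrow> 'o \<Rightarrow> 'a \<Rightarrow> 'a \<Rightarrow> bool" where
  "dual_pair C D X e c \<longleftrightarrow> D \<in> Obj C \<and> X \<in> Obj C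
     \<and> e \<in> hom C (D \<otimes>\<^bsub>C\<^esub> X) (Unt C) \<and> c \<in> hom C (Unt C) (X \<otimes>\<^bsub>C\<^esub> D)
     \<and> Run C X \<cdot>\<^bsub>C\<^esub> (Idt C X \<boxtimes>\<^bsub>C\<^esub> e) \<cdot>\<^bsub>C\<^esub> Asc C X D X \<cdot>\<^bsub>C\<^esub> (c \<boxtimes>\<^bsub>C\<^esub> Idt C X) \<cdot>\<^bsub>C\<^esub> cinv C (Lun C X)
         = Idt C X
     \<and> Lun C D \<cdot>\<^bsub>C\<^esub> (e \<boxtimes>\<^bsub>C\<^esub> Idt C D) \<cdot>\<^bsub>C\<^esub> cinv C (Asc C D X D) \<cdot>\<^bsub>C\<^esub> (Idt C D \<boxtimes>\<^bsub>C\<^esub> c)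
         \<cdot>\<^bsub>C\<^esub> cinv C (Run C D) = Idt C D"

locale tensor_category = finite_abelian_category C
  for C :: "('o, 'a, 'k::field, 'z) tcat_scheme" (structure) +
  assumes ten_functor: "is_functor (prod_cat C C) C (bifctr (TenO C) (TenA C))"
    and ten_linear_left: "Y \<in> Obj C \<Longrightarrow>
          linear_functor C C \<lparr>fob = (\<lambda>X. X \<otimes> Y), far = (\<lambda>f. f \<boxtimes> Idt C Y)\<rparr>"
    and ten_linear_right: "X \<in> Obj C \<Longrightarrow>
          linear_functor C C \<lparr>fob = (\<lambda>Y. X \<otimes> Y), far = (\<lambda>g. Idt C X \<boxtimes> g)\<rparr>"
    and unt_obj: "Unt C \<in> Obj C"
    and asc_iso: "X \<in> Obj C \<Longrightarrow> Y \<in> Obj C \<Longrightarrow> Z \<in> Obj C \<Longrightarrow>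
          Asc C X Y Z \<in> hom C ((X \<otimes> Y) \<otimes> Z) (X \<otimes> (Y \<otimes> Z)) \<and> iso_arrow C (Asc C X Y Z)"
    and asc_nat: "f \<in> hom C X X' \<Longrightarrow> g \<in> hom C Y Y' \<Longrightarrow> h \<in> hom C Z Z' \<Longrightarrow>
          Asc C X' Y' Z' \<cdot> ((f \<boxtimes> g) \<boxtimes> h) = (f \<boxtimes> (g \<boxtimes> h)) \<cdot> Asc C X Y Z"
    and lun_iso: "X \<in> Obj C \<Longrightarrow> Lun C X \<in> hom C (Unt C \<otimes> X) X \<and> iso_arrow C (Lun C X)"
    and lun_nat: "f \<in> hom C X Y \<Longrightarrow> Lun C Y \<cdot> (Idt C (Unt C) \<boxtimes> f) = f \<cdot> Lun C X"
    and run_iso: "X \<in> Obj C \<Longrightarrow> Run C X \<in> hom C (X \<otimes> Unt C) X \<and> iso_arrow C (Run C X)"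
    and run_nat: "f \<in> hom C X Y \<Longrightarrow> Run C Y \<cdot> (f \<boxtimes> Idt C (Unt C)) = f \<cdot> Run C X"
    and pentagon: "W \<in> Obj C \<Longrightarrow> X \<in> Obj C \<Longrightarrow> Y \<in> Obj C \<Longrightarrow> Z \<in> Obj C \<Longrightarrow>
          Asc C W X (Y \<otimes> Z) \<cdot> Asc C (W \<otimes> X) Y Z
            = (Idt C W \<boxtimes> Asc C X Y Z) \<cdot> Asc C W (X \<otimes> Y) Z \<cdot> (Asc C W X Y \<boxtimes> Idt C Z)"
    and triangle: "X \<in> Obj C \<Longrightarrow> Y \<in> Obj C \<Longrightarrow>
          (Idt C X \<boxtimes> Lun C Y) \<cdot> Asc C X (Unt C) Y = Run C X \<boxtimes> Idt C Y"
    and left_dual: "X \<in> Obj C \<Longrightarrow> dual_pair C (Dul C X) X (Ev C X) (Cv C X)"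
    and right_dual: "X \<in> Obj C \<Longrightarrow> dual_pair C X (Dur C X) (Evr C X) (Cvr C X)"
    and unt_simple: "simple_object C (Unt C)"

subsection \<open>Canonical morphisms between duals\<close>

text \<open>\<open>lmate C A X f : A \<rightarrow> X\<^sup>*\<close> corresponds to \<open>f : A \<otimes> X \<rightarrow> 1\<close>, and
  \<open>rmate C X A f : A \<rightarrow> \<^sup>*X\<close> corresponds to \<open>f : X \<otimes> A \<rightarrow> 1\<close>.\<close>

definition lmate :: "('o, 'a, 'k, 'z) tcat_scheme \<Rightarrow> 'o \<Rightarrow> 'o \<Rightarrow> 'a \<Rightarrow> 'a" where
  "lmate C A X f = Lun C (Dul C X) \<cdot>\<^bsub>C\<^esub> (f \<boxtimes>\<^bsub>C\<^esub> Idt C (Dul C X)) \<cdot>\<^bsub>C\<^esub> cinv C (Asc C A X (Dul C X))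
     \<cdot>\<^bsub>C\<^esub> (Idt C A \<boxtimes>\<^bsub>C\<^esub> Cv C X) \<cdot>\<^bsub>C\<^esub> cinv C (Run C A)"

definition rmate :: "('o, 'a, 'k, 'z) tcat_scheme \<Rightarrow> 'o \<Rightarrow> 'o \<Rightarrow> 'a \<Rightarrow> 'a" where
  "rmate C X A f = Run C (Dur C X) \<cdot>\<^bsub>C\<^esub> (Idt C (Dur C X) \<boxtimes>\<^bsub>C\<^esub> f) \<cdot>\<^bsub>C\<^esub> Asc C (Dur C X) X A
     \<cdot>\<^bsub>C\<^esub> (Cvr C X \<boxtimes>\<^bsub>C\<^esub> Idt C A) \<cdot>\<^bsub>C\<^esub> cinv C (Lun C A)"

text \<open>For \<open>f : X \<rightarrow> Y\<close>, \<open>dual_map C f : Y\<^sup>* \<rightarrow> X\<^sup>*\<close> and \<open>rdual_map C f : \<^sup>*Y \<rightarrow> \<^sup>*X\<close>.\<close>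

definition dual_map :: "('o, 'a, 'k, 'z) tcat_scheme \<Rightarrow> 'a \<Rightarrow> 'a" where
  "dual_map C f = lmate C (Dul C (Cod C f)) (Dom C f)
     (Ev C (Cod C f) \<cdot>\<^bsub>C\<^esub> (Idt C (Dul C (Cod C f)) \<boxtimes>\<^bsub>C\<^esub> f))"

definition rdual_map :: "('o, 'a, 'k, 'z) tcat_scheme \<Rightarrow> 'a \<Rightarrow> 'a" where
  "rdual_map C f = rmate C (Dom C f) (Dur C (Cod C f))
     (Evr C (Cod C f) \<cdot>\<^bsub>C\<^esub> (f \<boxtimes>\<^bsub>C\<^esub> Idt C (Dur C (Cod C f))))"

text \<open>The canonical isomorphism \<open>Y\<^sup>* \<otimes> X\<^sup>* \<rightarrow> (X \<otimes> Y)\<^sup>*\<close>.\<close>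

definition dual_ten :: "('o, 'a, 'k, 'z) tcat_scheme \<Rightarrow> 'o \<Rightarrow> 'o \<Rightarrow> 'a" where
  "dual_ten C X Y = lmate C (Dul C Y \<otimes>\<^bsub>C\<^esub> Dul C X) (X \<otimes>\<^bsub>C\<^esub> Y)
     (Ev C Y \<cdot>\<^bsub>C\<^esub> (Idt C (Dul C Y) \<boxtimes>\<^bsub>C\<^esub> (Lun C Y \<cdot>\<^bsub>C\<^esub> (Ev C X \<boxtimes>\<^bsub>C\<^esub> Idt C Y) \<cdot>\<^bsub>C\<^esub> cinv C (Asc C (Dul C X) X Y)))
        \<cdot>\<^bsub>C\<^esub> Asc C (Dul C Y) (Dul C X) (X \<otimes>\<^bsub>C\<^esub> Y))"

text \<open>The canonical isomorphisms \<open>1 \<rightarrow> 1\<^sup>*\<close> and \<open>X \<rightarrow> (\<^sup>*X)\<^sup>*\<close>. The latter realises the usual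
  identification of \<open>(\<^sup>*X)\<^sup>*\<close> with \<open>X\<close>, which for arbitrary chosen duals need not be an equality.\<close>

definition dual_unt :: "('o, 'a, 'k, 'z) tcat_scheme \<Rightarrow> 'a" where
  "dual_unt C = lmate C (Unt C) (Unt C) (Lun C (Unt C))"

definition dual_rdual :: "('o, 'a, 'k, 'z) tcat_scheme \<Rightarrow> 'o \<Rightarrow> 'a" where
  "dual_rdual C X = lmate C X (Dur C X) (Evr C X)"

text \<open>Monoidal structure of the double dual functor: \<open>(X \<otimes> Y)\<^sup>*\<^sup>* \<rightarrow> X\<^sup>*\<^sup>* \<otimes> Y\<^sup>*\<^sup>*\<close> and \<open>1\<^sup>*\<^sup>* \<rightarrow> 1\<close>.\<close>

definition ddual_ten :: "('o, 'a, 'k, 'z) tcat_scheme \<Rightarrow> 'o \<Rightarrow> 'o \<Rightarrow> 'a" where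
  "ddual_ten C X Y = cinv C (dual_ten C (Dul C Y) (Dul C X)) \<cdot>\<^bsub>C\<^esub> dual_map C (dual_ten C X Y)"

definition ddual_unt :: "('o, 'a, 'k, 'z) tcat_scheme \<Rightarrow> 'a" where
  "ddual_unt C = cinv C (dual_unt C) \<cdot>\<^bsub>C\<^esub> dual_map C (dual_unt C)"


section \<open>Module categories\<close>

text \<open>\<open>MAs M X Y N : (X \<otimes> Y) \<rhd> N \<rightarrow> X \<rhd> (Y \<rhd> N)\<close> and \<open>MUn M N : 1 \<rhd> N \<rightarrow> N\<close>; \<open>\<unrhd>\<close> is the
  action on arrows.\<close>

record ('p, 'b, 'k, 'o, 'a) lmod = "('p, 'b, 'k) lincat" +
  ActO :: "'o \<Rightarrow> 'p \<Rightarrow> 'p"  (infixr "\<rhd>\<index>" 75)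
  ActA :: "'a \<Rightarrow> 'b \<Rightarrow> 'b"  (infixr "\<unrhd>\<index>" 75)
  MAs :: "'o \<Rightarrow> 'o \<Rightarrow> 'p \<Rightarrow> 'b"
  MUn :: "'p \<Rightarrow> 'b"

locale left_module_category =
  C: tensor_category C + M: finite_abelian_category M
  for C :: "('o, 'a, 'k::field, 'z) tcat_scheme"
    and M :: "('p, 'b, 'k, 'o, 'a, 'y) lmod_scheme" +
  assumes act_functor: "is_functor (prod_cat C M) M (bifctr (ActO M) (ActA M))"
    and act_exact_left: "N \<in> Obj M \<Longrightarrow>
          exact_functor C M \<lparr>fob = (\<lambda>X. X \<rhd>\<^bsub>M\<^esub> N), far = (\<lambda>f. f \<unrhd>\<^bsub>M\<^esub> Idt M N)\<rparr>"
    and act_exact_right: "X \<in> Obj C \<Longrightarrow>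
          exact_functor M M \<lparr>fob = (\<lambda>N. X \<rhd>\<^bsub>M\<^esub> N), far = (\<lambda>g. Idt C X \<unrhd>\<^bsub>M\<^esub> g)\<rparr>"
    and mas_iso: "X \<in> Obj C \<Longrightarrow> Y \<in> Obj C \<Longrightarrow> N \<in> Obj M \<Longrightarrow>
          MAs M X Y N \<in> hom M ((X \<otimes>\<^bsub>C\<^esub> Y) \<rhd>\<^bsub>M\<^esub> N) (X \<rhd>\<^bsub>M\<^esub> (Y \<rhd>\<^bsub>M\<^esub> N)) \<and> iso_arrow M (MAs M X Y N)"
    and mas_nat: "f \<in> hom C X X' \<Longrightarrow> g \<in> hom C Y Y' \<Longrightarrow> h \<in> hom M N N' \<Longrightarrow>
          MAs M X' Y' N' \<cdot>\<^bsub>M\<^esub> ((f \<boxtimes>\<^bsub>C\<^esub> g) \<unrhd>\<^bsub>M\<^esub> h) = (f \<unrhd>\<^bsub>M\<^esub> (g \<unrhd>\<^bsub>M\<^esub> h)) \<cdot>\<^bsub>M\<^esub> MAs M X Y N"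
    and mun_iso: "N \<in> Obj M \<Longrightarrow>
          MUn M N \<in> hom M (Unt C \<rhd>\<^bsub>M\<^esub> N) N \<and> iso_arrow M (MUn M N)"
    and mun_nat: "h \<in> hom M N N' \<Longrightarrow>
          MUn M N' \<cdot>\<^bsub>M\<^esub> (Idt C (Unt C) \<unrhd>\<^bsub>M\<^esub> h) = h \<cdot>\<^bsub>M\<^esub> MUn M N"
    and mod_pentagon: "X \<in> Obj C \<Longrightarrow> Y \<in> Obj C \<Longrightarrow> Z \<in> Obj C \<Longrightarrow> N \<in> Obj M \<Longrightarrow>
          MAs M X Y (Z \<rhd>\<^bsub>M\<^esub> N) \<cdot>\<^bsub>M\<^esub> MAs M (X \<otimes>\<^bsub>C\<^esub> Y) Z N
            = (Idt C X \<unrhd>\<^bsub>M\<^esub> MAs M Y Z N) \<cdot>\<^bsub>M\<^esub> MAs M X (Y \<otimes>\<^bsub>C\<^esub> Z) N \<cdot>\<^bsub>M\<^esub> (Asc C X Y Z \<unrhd>\<^bsub>M\<^esub> Idt M N)"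
    and mod_triangle: "X \<in> Obj C \<Longrightarrow> N \<in> Obj M \<Longrightarrow>
          (Idt C X \<unrhd>\<^bsub>M\<^esub> MUn M N) \<cdot>\<^bsub>M\<^esub> MAs M X (Unt C) N = Run C X \<unrhd>\<^bsub>M\<^esub> Idt M N"

text \<open>A module functor is a pair \<open>(F, s)\<close> with \<open>s X N : F (X \<rhd> N) \<rightarrow> X \<rhd> F N\<close>.\<close>

definition module_functor ::
  "('o, 'a, 'k::field, 'z) tcat_scheme \<Rightarrow> ('p, 'b, 'k, 'o, 'a, 'y) lmod_scheme
     \<Rightarrow> ('q, 'c, 'k, 'o, 'a, 'x) lmod_scheme \<Rightarrow> ('p, 'b, 'q, 'c) fctr \<Rightarrow> ('o \<Rightarrow> 'p \<Rightarrow> 'c) \<Rightarrow> bool" where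
  "module_functor C M N F s \<longleftrightarrow> linear_functor M N F
     \<and> (\<forall>X \<in> Obj C. \<forall>A \<in> Obj M.
          s X A \<in> hom N (fob F (X \<rhd>\<^bsub>M\<^esub> A)) (X \<rhd>\<^bsub>N\<^esub> fob F A) \<and> iso_arrow N (s X A))
     \<and> (\<forall>f \<in> Arr C. \<forall>u \<in> Arr M.
          s (Cod C f) (Cod M u) \<cdot>\<^bsub>N\<^esub> far F (f \<unrhd>\<^bsub>M\<^esub> u) = (f \<unrhd>\<^bsub>N\<^esub> far F u) \<cdot>\<^bsub>N\<^esub> s (Dom C f) (Dom M u))
     \<and> (\<forall>X \<in> Obj C. \<forall>Y \<in> Obj C. \<forall>A \<in> Obj M.
          MAs N X Y (fob F A) \<cdot>\<^bsub>N\<^esub> s (X \<otimes>\<^bsub>C\<^esub> Y) A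
            = (Idt C X \<unrhd>\<^bsub>N\<^esub> s Y A) \<cdot>\<^bsub>N\<^esub> s X (Y \<rhd>\<^bsub>M\<^esub> A) \<cdot>\<^bsub>N\<^esub> far F (MAs M X Y A))
     \<and> (\<forall>A \<in> Obj M. MUn N (fob F A) \<cdot>\<^bsub>N\<^esub> s (Unt C) A = far F (MUn M A))"

definition module_nat_iso ::
  "('o, 'a, 'k::field, 'z) tcat_scheme \<Rightarrow> ('p, 'b, 'k, 'o, 'a, 'y) lmod_scheme
     \<Rightarrow> ('q, 'c, 'k, 'o, 'a, 'x) lmod_scheme
     \<Rightarrow> ('p, 'b, 'q, 'c) fctr \<Rightarrow> ('o \<Rightarrow> 'p \<Rightarrow> 'c)
     \<Rightarrow> ('p, 'b, 'q, 'c) fctr \<Rightarrow> ('o \<Rightarrow> 'p \<Rightarrow> 'c) \<Rightarrow> ('p \<Rightarrow> 'c) \<Rightarrow> bool" where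
  "module_nat_iso C M N F s G t \<eta> \<longleftrightarrow> module_functor C M N F s \<and> module_functor C M N G t
     \<and> nat_iso M N F G \<eta>
     \<and> (\<forall>X \<in> Obj C. \<forall>A \<in> Obj M. t X A \<cdot>\<^bsub>N\<^esub> \<eta> (X \<rhd>\<^bsub>M\<^esub> A) = (Idt C X \<unrhd>\<^bsub>N\<^esub> \<eta> A) \<cdot>\<^bsub>N\<^esub> s X A)"

definition direct_sum ::
  "('p, 'b, 'k, 'o, 'a) lmod \<Rightarrow> ('q, 'c, 'k, 'o, 'a) lmod \<Rightarrow> ('p \<times> 'q, 'b \<times> 'c, 'k, 'o, 'a) lmod" where
  "direct_sum M N = \<lparr>Obj = Obj M \<times> Obj N, Arr = Arr M \<times> Arr N,
     Dom = (\<lambda>(f, g). (Dom M f, Dom N g)), Cod = (\<lambda>(f, g). (Cod M f, Cod N g)),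
     Idt = (\<lambda>(A, B). (Idt M A, Idt N B)),
     Cmp = (\<lambda>(g, g') (f, f'). (g \<cdot>\<^bsub>M\<^esub> f, g' \<cdot>\<^bsub>N\<^esub> f')),
     Add = (\<lambda>(g, g') (f, f'). (Add M g f, Add N g' f')),
     Zer = (\<lambda>(A, A') (B, B'). (Zer M A B, Zer N A' B')),
     Scl = (\<lambda>a (f, f'). (Scl M a f, Scl N a f')),
     ActO = (\<lambda>X (A, B). (X \<rhd>\<^bsub>M\<^esub> A, X \<rhd>\<^bsub>N\<^esub> B)),
     ActA = (\<lambda>f (u, v). (f \<unrhd>\<^bsub>M\<^esub> u, f \<unrhd>\<^bsub>N\<^esub> v)),
     MAs = (\<lambda>X Y (A, B). (MAs M X Y A, MAs N X Y B)),
     MUn = (\<lambda>(A, B). (MUn M A, MUn N B))\<rparr>"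

definition nontrivial_cat :: "('o, 'a, 'z) cat_scheme \<Rightarrow> bool" where
  "nontrivial_cat C \<longleftrightarrow> (\<exists>X \<in> Obj C. \<not> zero_object C X)"

text \<open>Restricting the summands to the object and arrow types of \<open>M\<close> is no loss of generality: a
  direct summand is equivalent to the full subcategory of \<open>M\<close> on the objects isomorphic to an
  object coming from that summand, with the action restricted from \<open>M\<close>.\<close>

definition indecomposable_module_category ::
  "('o, 'a, 'k::field) tcat \<Rightarrow> ('p, 'b, 'k, 'o, 'a) lmod \<Rightarrow> bool" where
  "indecomposable_module_category C M \<longleftrightarrow>
     \<not> (\<exists>(M1 :: ('p, 'b, 'k, 'o, 'a) lmod) (M2 :: ('p, 'b, 'k, 'o, 'a) lmod) F s.
          left_module_category C M1 \<and> left_module_category C M2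
          \<and> nontrivial_cat M1 \<and> nontrivial_cat M2
          \<and> module_functor C M (direct_sum M1 M2) F s \<and> is_equivalence M (direct_sum M1 M2) F)"

definition exact_module_category ::
  "('o, 'a, 'k, 'z) tcat_scheme \<Rightarrow> ('p, 'b, 'k, 'o, 'a, 'y) lmod_scheme \<Rightarrow> bool" where
  "exact_module_category C M \<longleftrightarrow>
     (\<forall>P N. projective_object C P \<and> N \<in> Obj M \<longrightarrow> projective_object M (P \<rhd>\<^bsub>M\<^esub> N))"

definition bop ::
  "('o, 'a, 'k, 'z) tcat_scheme \<Rightarrow> ('p, 'b, 'k, 'o, 'a) lmod \<Rightarrow> ('p, 'b, 'k, 'o, 'a) lmod" where
  "bop C M = M\<lparr>ActO := (\<lambda>X N. Dul C (Dul C X) \<rhd>\<^bsub>M\<^esub> N),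
     ActA := (\<lambda>f u. dual_map C (dual_map C f) \<unrhd>\<^bsub>M\<^esub> u),
     MAs := (\<lambda>X Y N. MAs M (Dul C (Dul C X)) (Dul C (Dul C Y)) N \<cdot>\<^bsub>M\<^esub> (ddual_ten C X Y \<unrhd>\<^bsub>M\<^esub> Idt M N)),
     MUn := (\<lambda>N. MUn M N \<cdot>\<^bsub>M\<^esub> (ddual_unt C \<unrhd>\<^bsub>M\<^esub> Idt M N))\<rparr>"

text \<open>Right module categories: \<open>RMAs N A X Y : A \<lhd> (X \<otimes> Y) \<rightarrow> (A \<lhd> X) \<lhd> Y\<close> and
  \<open>RMUn N A : A \<lhd> 1 \<rightarrow> A\<close>.\<close>

record ('p, 'b, 'k, 'o, 'a) rmod = "('p, 'b, 'k) lincat" +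
  RActO :: "'p \<Rightarrow> 'o \<Rightarrow> 'p"  (infixl "\<lhd>\<index>" 75)
  RActA :: "'b \<Rightarrow> 'a \<Rightarrow> 'b"  (infixl "\<unlhd>\<index>" 75)
  RMAs :: "'p \<Rightarrow> 'o \<Rightarrow> 'o \<Rightarrow> 'b"
  RMUn :: "'p \<Rightarrow> 'b"

text \<open>The opposite of a left module category, with \<open>A \<lhd> X = X\<^sup>* \<rhd> A\<close>. An arrow \<open>A \<rightarrow> B\<close> of the opposite
  is an arrow \<open>B \<rightarrow> A\<close> of \<open>M\<close>; the structure isomorphisms are therefore given by arrows
  \<open>Y\<^sup>* \<rhd> (X\<^sup>* \<rhd> A) \<rightarrow> (X \<otimes> Y)\<^sup>* \<rhd> A\<close> and \<open>A \<rightarrow> 1\<^sup>* \<rhd> A\<close> of \<open>M\<close>.\<close>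

definition op_module ::
  "('o, 'a, 'k, 'z) tcat_scheme \<Rightarrow> ('p, 'b, 'k, 'o, 'a, 'y) lmod_scheme \<Rightarrow> ('p, 'b, 'k, 'o, 'a) rmod" where
  "op_module C M = \<lparr>Obj = Obj M, Arr = Arr M, Dom = Cod M, Cod = Dom M, Idt = Idt M,
     Cmp = (\<lambda>g f. f \<cdot>\<^bsub>M\<^esub> g), Add = Add M, Zer = (\<lambda>A B. Zer M B A), Scl = Scl M,
     RActO = (\<lambda>A X. Dul C X \<rhd>\<^bsub>M\<^esub> A),
     RActA = (\<lambda>u f. dual_map C f \<unrhd>\<^bsub>M\<^esub> u),
     RMAs = (\<lambda>A X Y. (dual_ten C X Y \<unrhd>\<^bsub>M\<^esub> Idt M A) \<cdot>\<^bsub>M\<^esub> cinv M (MAs M (Dul C Y) (Dul C X) A)),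
     RMUn = (\<lambda>A. (dual_unt C \<unrhd>\<^bsub>M\<^esub> Idt M A) \<cdot>\<^bsub>M\<^esub> cinv M (MUn M A))\<rparr>"


section \<open>Module coends\<close>

text \<open>In the following \<open>S\<close> is a functor from \<open>N\<^sup>o\<^sup>p \<times> N\<close> to \<open>B\<close>, so an arrow of its domain is a pair
  \<open>(a, b)\<close> in which \<open>a : A' \<rightarrow> A\<close> in \<open>N\<close> is regarded as an arrow from \<open>A\<close> to \<open>A'\<close>.\<close>

definition pre_balancing ::
  "('o, 'a, 'k, 'z) tcat_scheme \<Rightarrow> ('p, 'b, 'k, 'o, 'a, 'y) rmod_scheme \<Rightarrow> ('q, 'c, 'x) cat_scheme
     \<Rightarrow> ('p \<times> 'p, 'b \<times> 'b, 'q, 'c) fctr \<Rightarrow> ('o \<Rightarrow> 'p \<Rightarrow> 'p \<Rightarrow> 'c) \<Rightarrow> bool" where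
  "pre_balancing C N B S \<gamma> \<longleftrightarrow>
     (\<forall>X \<in> Obj C. \<forall>A \<in> Obj N. \<forall>A' \<in> Obj N.
        \<gamma> X A A' \<in> hom B (fob S (A \<lhd>\<^bsub>N\<^esub> X, A')) (fob S (A, A' \<lhd>\<^bsub>N\<^esub> Dur C X)) \<and> iso_arrow B (\<gamma> X A A'))
     \<and> (\<forall>f \<in> Arr C. \<forall>a \<in> Arr N. \<forall>b \<in> Arr N.
        \<gamma> (Dom C f) (Dom N a) (Cod N b) \<cdot>\<^bsub>B\<^esub> far S (a \<unlhd>\<^bsub>N\<^esub> f, b)
          = far S (a, b \<unlhd>\<^bsub>N\<^esub> rdual_map C f) \<cdot>\<^bsub>B\<^esub> \<gamma> (Cod C f) (Cod N a) (Dom N b))"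

definition dinatural_to ::
  "('p, 'b, 'y) cat_scheme \<Rightarrow> ('q, 'c, 'x) cat_scheme
     \<Rightarrow> ('p \<times> 'p, 'b \<times> 'b, 'q, 'c) fctr \<Rightarrow> 'q \<Rightarrow> ('p \<Rightarrow> 'c) \<Rightarrow> bool" where
  "dinatural_to N B S Q l \<longleftrightarrow> Q \<in> Obj B
     \<and> (\<forall>A \<in> Obj N. l A \<in> hom B (fob S (A, A)) Q)
     \<and> (\<forall>a \<in> Arr N. l (Dom N a) \<cdot>\<^bsub>B\<^esub> far S (a, Idt N (Dom N a))
                   = l (Cod N a) \<cdot>\<^bsub>B\<^esub> far S (Idt N (Cod N a), a))"

text \<open>The condition on a dinatural transformation imposed by the pre-balancing. The inverse unit
  isomorphism \<open>A \<rightarrow> A \<lhd> 1\<close> precedes \<open>id \<lhd> coev : A \<lhd> 1 \<rightarrow> A \<lhd> (\<^sup>*X \<otimes> X)\<close>.\<close>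

definition balanced_dinatural_to ::
  "('o, 'a, 'k, 'z) tcat_scheme \<Rightarrow> ('p, 'b, 'k, 'o, 'a, 'y) rmod_scheme \<Rightarrow> ('q, 'c, 'x) cat_scheme
     \<Rightarrow> ('p \<times> 'p, 'b \<times> 'b, 'q, 'c) fctr \<Rightarrow> ('o \<Rightarrow> 'p \<Rightarrow> 'p \<Rightarrow> 'c) \<Rightarrow> 'q \<Rightarrow> ('p \<Rightarrow> 'c) \<Rightarrow> bool" where
  "balanced_dinatural_to C N B S \<gamma> Q l \<longleftrightarrow> dinatural_to N B S Q l
     \<and> (\<forall>X \<in> Obj C. \<forall>A \<in> Obj N.
        l A \<cdot>\<^bsub>B\<^esub> far S ((Idt N A \<unlhd>\<^bsub>N\<^esub> Cvr C X) \<cdot>\<^bsub>N\<^esub> cinv N (RMUn N A), Idt N A)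
          = l (A \<lhd>\<^bsub>N\<^esub> Dur C X) \<cdot>\<^bsub>B\<^esub> \<gamma> X (A \<lhd>\<^bsub>N\<^esub> Dur C X) A
              \<cdot>\<^bsub>B\<^esub> far S (cinv N (RMAs N A (Dur C X) X), Idt N A))"

definition module_coend ::
  "('o, 'a, 'k, 'z) tcat_scheme \<Rightarrow> ('p, 'b, 'k, 'o, 'a, 'y) rmod_scheme \<Rightarrow> ('q, 'c, 'x) cat_scheme
     \<Rightarrow> ('p \<times> 'p, 'b \<times> 'b, 'q, 'c) fctr \<Rightarrow> ('o \<Rightarrow> 'p \<Rightarrow> 'p \<Rightarrow> 'c) \<Rightarrow> 'q \<Rightarrow> ('p \<Rightarrow> 'c) \<Rightarrow> bool" where
  "module_coend C N B S \<gamma> Q l \<longleftrightarrow>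
     is_functor (prod_cat (op_cat N) N) B S \<and> pre_balancing C N B S \<gamma>
     \<and> balanced_dinatural_to C N B S \<gamma> Q l
     \<and> (\<forall>R m. balanced_dinatural_to C N B S \<gamma> R m
          \<longrightarrow> (\<exists>!g. g \<in> hom B Q R \<and> (\<forall>A \<in> Obj N. g \<cdot>\<^bsub>B\<^esub> l A = m A)))"


section \<open>Internal Hom\<close>

text \<open>\<open>IhO H A B\<close> is the internal Hom object and \<open>IhT H X A B\<close> the bijection from
  \<open>Hom(X \<rhd> A, B)\<close> to \<open>Hom(X, IhO H A B)\<close>, natural in \<open>X\<close>, that represents \<open>Hom(- \<rhd> A, B)\<close>.\<close>

record ('p, 'b, 'o, 'a) ihom =
  IhO :: "'p \<Rightarrow> 'p \<Rightarrow> 'o"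
  IhT :: "'o \<Rightarrow> 'p \<Rightarrow> 'p \<Rightarrow> 'b \<Rightarrow> 'a"

definition internal_hom ::
  "('o, 'a, 'k, 'z) tcat_scheme \<Rightarrow> ('p, 'b, 'k, 'o, 'a, 'y) lmod_scheme
     \<Rightarrow> ('p, 'b, 'o, 'a) ihom \<Rightarrow> bool" where
  "internal_hom C M H \<longleftrightarrow> (\<forall>A \<in> Obj M. \<forall>B \<in> Obj M. IhO H A B \<in> Obj C
     \<and> (\<forall>X \<in> Obj C. bij_betw (IhT H X A B) (hom M (X \<rhd>\<^bsub>M\<^esub> A) B) (hom C X (IhO H A B)))
     \<and> (\<forall>h \<in> Arr C. \<forall>f \<in> hom M (Cod C h \<rhd>\<^bsub>M\<^esub> A) B.
          IhT H (Dom C h) A B (f \<cdot>\<^bsub>M\<^esub> (h \<unrhd>\<^bsub>M\<^esub> Idt M A)) = IhT H (Cod C h) A B f \<cdot>\<^bsub>C\<^esub> h))"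

definition ih_ev ::
  "('o, 'a, 'k, 'z) tcat_scheme \<Rightarrow> ('p, 'b, 'k, 'o, 'a, 'y) lmod_scheme
     \<Rightarrow> ('p, 'b, 'o, 'a) ihom \<Rightarrow> 'p \<Rightarrow> 'p \<Rightarrow> 'b" where
  "ih_ev C M H A B = inv_into (hom M (IhO H A B \<rhd>\<^bsub>M\<^esub> A) B) (IhT H (IhO H A B) A B) (Idt C (IhO H A B))"

text \<open>For \<open>f : A' \<rightarrow> A\<close> and \<open>g : B \<rightarrow> B'\<close>, the induced arrow \<open>Hom(A, B) \<rightarrow> Hom(A', B')\<close>.\<close>

definition ih_map ::
  "('o, 'a, 'k, 'z) tcat_scheme \<Rightarrow> ('p, 'b, 'k, 'o, 'a, 'y) lmod_scheme
     \<Rightarrow> ('p, 'b, 'o, 'a) ihom \<Rightarrow> 'b \<Rightarrow> 'b \<Rightarrow> 'a" where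
  "ih_map C M H f g = IhT H (IhO H (Cod M f) (Dom M g)) (Dom M f) (Cod M g)
     (g \<cdot>\<^bsub>M\<^esub> ih_ev C M H (Cod M f) (Dom M g) \<cdot>\<^bsub>M\<^esub> (Idt C (IhO H (Cod M f) (Dom M g)) \<unrhd>\<^bsub>M\<^esub> f))"

text \<open>The canonical isomorphism \<open>X \<otimes> Hom(A, B) \<rightarrow> Hom(A, X \<rhd> B)\<close>.\<close>

definition ih_out ::
  "('o, 'a, 'k, 'z) tcat_scheme \<Rightarrow> ('p, 'b, 'k, 'o, 'a, 'y) lmod_scheme
     \<Rightarrow> ('p, 'b, 'o, 'a) ihom \<Rightarrow> 'o \<Rightarrow> 'p \<Rightarrow> 'p \<Rightarrow> 'a" where
  "ih_out C M H X A B = IhT H (X \<otimes>\<^bsub>C\<^esub> IhO H A B) A (X \<rhd>\<^bsub>M\<^esub> B)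
     ((Idt C X \<unrhd>\<^bsub>M\<^esub> ih_ev C M H A B) \<cdot>\<^bsub>M\<^esub> MAs M X (IhO H A B) A)"

text \<open>The canonical isomorphism \<open>Hom(A, B) \<otimes> X\<^sup>* \<rightarrow> Hom(X \<rhd> A, B)\<close>.\<close>

definition ih_in ::
  "('o, 'a, 'k, 'z) tcat_scheme \<Rightarrow> ('p, 'b, 'k, 'o, 'a, 'y) lmod_scheme
     \<Rightarrow> ('p, 'b, 'o, 'a) ihom \<Rightarrow> 'o \<Rightarrow> 'p \<Rightarrow> 'p \<Rightarrow> 'a" where
  "ih_in C M H X A B = IhT H (IhO H A B \<otimes>\<^bsub>C\<^esub> Dul C X) (X \<rhd>\<^bsub>M\<^esub> A) B
     (ih_ev C M H A B
        \<cdot>\<^bsub>M\<^esub> (Idt C (IhO H A B) \<unrhd>\<^bsub>M\<^esub>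
              (MUn M A \<cdot>\<^bsub>M\<^esub> (Ev C X \<unrhd>\<^bsub>M\<^esub> Idt M A) \<cdot>\<^bsub>M\<^esub> cinv M (MAs M (Dul C X) X A)))
        \<cdot>\<^bsub>M\<^esub> MAs M (IhO H A B) (Dul C X) (X \<rhd>\<^bsub>M\<^esub> A))"

text \<open>The resulting isomorphisms
  \<open>Hom(X \<rhd> A, B)\<^sup>* \<rightarrow> (Hom(A, B) \<otimes> X\<^sup>*)\<^sup>* \<rightarrow> X\<^sup>*\<^sup>* \<otimes> Hom(A, B)\<^sup>*\<close> and
  \<open>Hom(A, X \<rhd> B)\<^sup>* \<rightarrow> (X \<otimes> Hom(A, B))\<^sup>* \<rightarrow> Hom(A, B)\<^sup>* \<otimes> X\<^sup>*\<close>.\<close>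

definition ih_in_dual ::
  "('o, 'a, 'k, 'z) tcat_scheme \<Rightarrow> ('p, 'b, 'k, 'o, 'a, 'y) lmod_scheme
     \<Rightarrow> ('p, 'b, 'o, 'a) ihom \<Rightarrow> 'o \<Rightarrow> 'p \<Rightarrow> 'p \<Rightarrow> 'a" where
  "ih_in_dual C M H X A B =
     cinv C (dual_ten C (IhO H A B) (Dul C X)) \<cdot>\<^bsub>C\<^esub> dual_map C (ih_in C M H X A B)"

definition ih_out_dual ::
  "('o, 'a, 'k, 'z) tcat_scheme \<Rightarrow> ('p, 'b, 'k, 'o, 'a, 'y) lmod_scheme
     \<Rightarrow> ('p, 'b, 'o, 'a) ihom \<Rightarrow> 'o \<Rightarrow> 'p \<Rightarrow> 'p \<Rightarrow> 'a" where
  "ih_out_dual C M H X A B =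
     cinv C (dual_ten C X (IhO H A B)) \<cdot>\<^bsub>C\<^esub> dual_map C (ih_out C M H X A B)"


section \<open>Relative Serre functors\<close>

definition serre_iso ::
  "('o, 'a, 'k, 'z) tcat_scheme \<Rightarrow> ('p, 'b, 'k, 'o, 'a, 'y) lmod_scheme
     \<Rightarrow> ('p, 'b, 'o, 'a) ihom \<Rightarrow> ('p, 'b, 'p, 'b) fctr \<Rightarrow> ('p \<Rightarrow> 'p \<Rightarrow> 'a) \<Rightarrow> bool" where
  "serre_iso C M H S \<phi> \<longleftrightarrow>
     (\<forall>A \<in> Obj M. \<forall>B \<in> Obj M.
        \<phi> A B \<in> hom C (Dul C (IhO H A B)) (IhO H B (fob S A)) \<and> iso_arrow C (\<phi> A B))
     \<and> (\<forall>f \<in> Arr M. \<forall>g \<in> Arr M.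
        \<phi> (Cod M f) (Dom M g) \<cdot>\<^bsub>C\<^esub> dual_map C (ih_map C M H f g)
          = ih_map C M H g (far S f) \<cdot>\<^bsub>C\<^esub> \<phi> (Dom M f) (Cod M g))"

definition relative_serre_functor ::
  "('o, 'a, 'k::field, 'z) tcat_scheme \<Rightarrow> ('p, 'b, 'k, 'o, 'a, 'y) lmod_scheme
     \<Rightarrow> ('p, 'b, 'o, 'a) ihom \<Rightarrow> ('p, 'b, 'p, 'b) fctr \<Rightarrow> bool" where
  "relative_serre_functor C M H S \<longleftrightarrow> linear_functor M M S \<and> (\<exists>\<phi>. serre_iso C M H S \<phi>)"

text \<open>The canonical module structure \<open>s X A : S (X \<rhd> A) \<rightarrow> X\<^sup>*\<^sup>* \<rhd> S A\<close> of a relative Serre functor, as a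
  functor from \<open>M\<close> to \<open>bop C M\<close>, is the one induced by
  \<open>Hom(B, S (X \<rhd> A)) \<simeq> Hom(X \<rhd> A, B)\<^sup>* \<simeq> X\<^sup>*\<^sup>* \<otimes> Hom(A, B)\<^sup>* \<simeq> X\<^sup>*\<^sup>* \<otimes> Hom(B, S A) \<simeq> Hom(B, X\<^sup>*\<^sup>* \<rhd> S A)\<close>.
  For this composite to come from an arrow \<open>s X A\<close> for every \<open>B\<close>, the isomorphisms
  \<open>\<phi> A B : Hom(A, B)\<^sup>* \<simeq> Hom(B, S A)\<close> have to be compatible with the action on \<open>B\<close> (an arbitrary
  rescaling of \<open>\<phi>\<close> that is merely natural destroys this); this is \<open>serre_iso_balanced\<close>.\<close>

definition serre_iso_balanced ::
  "('o, 'a, 'k, 'z) tcat_scheme \<Rightarrow> ('p, 'b, 'k, 'o, 'a, 'y) lmod_scheme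
     \<Rightarrow> ('p, 'b, 'o, 'a) ihom \<Rightarrow> ('p, 'b, 'p, 'b) fctr \<Rightarrow> ('p \<Rightarrow> 'p \<Rightarrow> 'a) \<Rightarrow> bool" where
  "serre_iso_balanced C M H S \<phi> \<longleftrightarrow> (\<forall>X \<in> Obj C. \<forall>A \<in> Obj M. \<forall>B \<in> Obj M.
     \<phi> A (X \<rhd>\<^bsub>M\<^esub> B) = ih_in C M H X B (fob S A) \<cdot>\<^bsub>C\<^esub> (\<phi> A B \<boxtimes>\<^bsub>C\<^esub> Idt C (Dul C X)) \<cdot>\<^bsub>C\<^esub> ih_out_dual C M H X A B)"

definition serre_module_structure ::
  "('o, 'a, 'k::field, 'z) tcat_scheme \<Rightarrow> ('p, 'b, 'k, 'o, 'a) lmod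
     \<Rightarrow> ('p, 'b, 'o, 'a) ihom \<Rightarrow> ('p, 'b, 'p, 'b) fctr \<Rightarrow> ('o \<Rightarrow> 'p \<Rightarrow> 'b) \<Rightarrow> bool" where
  "serre_module_structure C M H S s \<longleftrightarrow> module_functor C M (bop C M) S s
     \<and> (\<exists>\<phi>. serre_iso C M H S \<phi> \<and> serre_iso_balanced C M H S \<phi>
        \<and> (\<forall>X \<in> Obj C. \<forall>A \<in> Obj M. \<forall>B \<in> Obj M.
             ih_map C M H (Idt M B) (s X A) \<cdot>\<^bsub>C\<^esub> \<phi> (X \<rhd>\<^bsub>M\<^esub> A) B
               = ih_out C M H (Dul C (Dul C X)) B (fob S A)
                   \<cdot>\<^bsub>C\<^esub> (Idt C (Dul C (Dul C X)) \<boxtimes>\<^bsub>C\<^esub> \<phi> A B) \<cdot>\<^bsub>C\<^esub> ih_in_dual C M H X A B))"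


section \<open>The coend functor\<close>

text \<open>The functor \<open>(U, V) \<mapsto> Hom(A, V)\<^sup>* \<rhd> U\<close> on \<open>(M\<^sup>o\<^sup>p)\<^sup>o\<^sup>p \<times> M\<^sup>o\<^sup>p\<close>. Arrows of the second factor are
  reversed arrows of \<open>M\<close>.\<close>

definition serre_T ::
  "('o, 'a, 'k, 'z) tcat_scheme \<Rightarrow> ('p, 'b, 'k, 'o, 'a, 'y) lmod_scheme
     \<Rightarrow> ('p, 'b, 'o, 'a) ihom \<Rightarrow> 'p \<Rightarrow> ('p \<times> 'p, 'b \<times> 'b, 'p, 'b) fctr" where
  "serre_T C M H A = \<lparr>fob = (\<lambda>(U, V). Dul C (IhO H A V) \<rhd>\<^bsub>M\<^esub> U),
     far = (\<lambda>(u, v). dual_map C (ih_map C M H (Idt M A) v) \<unrhd>\<^bsub>M\<^esub> u)\<rparr>"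

text \<open>Its pre-balancing
  \<open>Hom(A, V)\<^sup>* \<rhd> (X\<^sup>* \<rhd> U) \<rightarrow> (Hom(A, V)\<^sup>* \<otimes> X\<^sup>*) \<rhd> U \<rightarrow> (X \<otimes> Hom(A, V))\<^sup>* \<rhd> U \<rightarrow> Hom(A, X \<rhd> V)\<^sup>* \<rhd> U\<close>,
  followed by \<open>Hom(A, X \<rhd> V)\<^sup>* \<rhd> U \<rightarrow> Hom(A, (\<^sup>*X)\<^sup>* \<rhd> V)\<^sup>* \<rhd> U\<close> given by \<open>X \<simeq> (\<^sup>*X)\<^sup>*\<close>.\<close>

definition serre_gamma ::
  "('o, 'a, 'k, 'z) tcat_scheme \<Rightarrow> ('p, 'b, 'k, 'o, 'a, 'y) lmod_scheme
     \<Rightarrow> ('p, 'b, 'o, 'a) ihom \<Rightarrow> 'p \<Rightarrow> 'o \<Rightarrow> 'p \<Rightarrow> 'p \<Rightarrow> 'b" where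
  "serre_gamma C M H A X U V =
     (dual_map C (ih_map C M H (Idt M A) (cinv C (dual_rdual C X) \<unrhd>\<^bsub>M\<^esub> Idt M V)) \<unrhd>\<^bsub>M\<^esub> Idt M U)
     \<cdot>\<^bsub>M\<^esub> (dual_map C (cinv C (ih_out C M H X A V)) \<unrhd>\<^bsub>M\<^esub> Idt M U)
     \<cdot>\<^bsub>M\<^esub> (dual_ten C X (IhO H A V) \<unrhd>\<^bsub>M\<^esub> Idt M U)
     \<cdot>\<^bsub>M\<^esub> cinv M (MAs M (Dul C (IhO H A V)) (Dul C X) U)"

definition serre_coend ::
  "('o, 'a, 'k, 'z) tcat_scheme \<Rightarrow> ('p, 'b, 'k, 'o, 'a, 'y) lmod_scheme
     \<Rightarrow> ('p, 'b, 'o, 'a) ihom \<Rightarrow> 'p \<Rightarrow> 'p \<Rightarrow> ('p \<Rightarrow> 'b) \<Rightarrow> bool" where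
  "serre_coend C M H A Q l \<longleftrightarrow>
     module_coend C (op_module C M) M (serre_T C M H A) (serre_gamma C M H A) Q l"

text \<open>For a choice of coends \<open>(Q A, l A)\<close>, the functor \<open>A \<mapsto> Q A\<close> and its module structure
  \<open>Q (X \<rhd> A) \<rightarrow> X\<^sup>*\<^sup>* \<rhd> Q A\<close>, both determined by the universal property.\<close>

definition coend_functor ::
  "('o, 'a, 'k, 'z) tcat_scheme \<Rightarrow> ('p, 'b, 'k, 'o, 'a, 'y) lmod_scheme
     \<Rightarrow> ('p, 'b, 'o, 'a) ihom \<Rightarrow> ('p \<Rightarrow> 'p) \<Rightarrow> ('p \<Rightarrow> 'p \<Rightarrow> 'b) \<Rightarrow> ('p, 'b, 'p, 'b) fctr" where
  "coend_functor C M H Q l = \<lparr>fob = Q,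
     far = (\<lambda>f. THE g. g \<in> hom M (Q (Dom M f)) (Q (Cod M f))
        \<and> (\<forall>U \<in> Obj M. g \<cdot>\<^bsub>M\<^esub> l (Dom M f) U
             = l (Cod M f) U \<cdot>\<^bsub>M\<^esub> (dual_map C (ih_map C M H f (Idt M U)) \<unrhd>\<^bsub>M\<^esub> Idt M U)))\<rparr>"

definition coend_module_structure ::
  "('o, 'a, 'k, 'z) tcat_scheme \<Rightarrow> ('p, 'b, 'k, 'o, 'a, 'y) lmod_scheme
     \<Rightarrow> ('p, 'b, 'o, 'a) ihom \<Rightarrow> ('p \<Rightarrow> 'p) \<Rightarrow> ('p \<Rightarrow> 'p \<Rightarrow> 'b) \<Rightarrow> 'o \<Rightarrow> 'p \<Rightarrow> 'b" where
  "coend_module_structure C M H Q l X A =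
     (THE g. g \<in> hom M (Q (X \<rhd>\<^bsub>M\<^esub> A)) (Dul C (Dul C X) \<rhd>\<^bsub>M\<^esub> Q A)
        \<and> (\<forall>U \<in> Obj M. g \<cdot>\<^bsub>M\<^esub> l (X \<rhd>\<^bsub>M\<^esub> A) U
             = (Idt C (Dul C (Dul C X)) \<unrhd>\<^bsub>M\<^esub> l A U)
                 \<cdot>\<^bsub>M\<^esub> MAs M (Dul C (Dul C X)) (Dul C (IhO H A U)) U
                 \<cdot>\<^bsub>M\<^esub> (ih_in_dual C M H X A U \<unrhd>\<^bsub>M\<^esub> Idt M U)))"

end

theory Submission
  imports Defs
begin

text \<open>
  Passing to points (arrows from the unit object), an isomorphism \<open>Hom(A, B)\<^sup>* \<simeq> Hom(B, S A)\<close> natural in \<open>B\<close>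
  says that \<open>S A\<close> represents the functor \<open>B \<mapsto> Hom(Hom(A, B), 1)\<close>. The universal element is a trace
  \<open>t A : Hom(A, S A) \<rightarrow> 1\<close> (locale \<open>trace\<close>, lemma \<open>trace_trace_of\<close>), and two arrows \<open>B \<rightarrow> S A\<close> are equal
  as soon as they induce the same arrow \<open>Hom(A, B) \<rightarrow> Hom(A, S A) \<rightarrow> 1\<close>. This test drives the proof.

  The trace determines arrows \<open>leg A U : Hom(A, U)\<^sup>* \<rhd> U \<rightarrow> S A\<close>: the composite
  \<open>Hom(A, U)\<^sup>* \<otimes> Hom(A, U) \<simeq> Hom(A, Hom(A, U)\<^sup>* \<rhd> U) \<rightarrow> Hom(A, S A) \<rightarrow> 1\<close> has to be the evaluation. Their transposes
  \<open>Hom(A, U)\<^sup>* \<rightarrow> Hom(U, S A)\<close> are invertible, natural, and compatible with the action on \<open>U\<close>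
  (\<open>phi_iso\<close>, \<open>phi_serre_iso\<close>, \<open>phi_balanced\<close>), even when the isomorphisms at the start were merely natural.
  Conversely, a balanced family of isomorphisms is the one made from its trace (\<open>phi_trace_of\<close>).

  The legs are the universal balanced dinatural transformation (\<open>leg_universal\<close>, \<open>leg_coend\<close>). This is a
  form of the co-Yoneda lemma. The trace is a point of \<open>Hom(A, S A)\<^sup>*\<close>, and along this point the leg at \<open>S A\<close> is the
  identity of \<open>S A\<close>; so an arrow \<open>g\<close> out of \<open>S A\<close> is determined by its composite with that leg. For a
  balanced dinatural family \<open>m\<close>, restricting \<open>m (S A)\<close> along the point defines \<open>g\<close>. To find \<open>g\<close> composed with
  \<open>leg A U\<close>, dinaturality along \<open>leg A U\<close> replaces the point by the coevaluation of \<open>Hom(A, U)\<^sup>*\<close>, and the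
  balancing together with a zigzag identity leaves \<open>m U\<close>.

  The isomorphism \<open>twist X A : X\<^sup>*\<^sup>* \<rhd> S A \<rightarrow> S (X \<rhd> A)\<close> is also defined by its trace, and its inverse is the
  module structure of \<open>S\<close>. By \<open>leg_twist\<close> the legs are compatible with it in exactly the way that
  defines the module structure of the coend. Hence the comparison of \<open>S\<close> with any choice of coends, which is
  determined by the legs, carries the functor \<open>S\<close> with its module structure to the coend functor with its module
  structure, and the module functor axioms are transported along it (\<open>transport_module_functor\<close>).

  All coherence computations use actions in place of tensor products. An arrow \<open>D \<otimes> X \<rightarrow> 1\<close> acts as a
  natural transformation \<open>D \<rhd> (X \<rhd> N) \<rightarrow> N\<close>, duality becomes an adjunction between \<open>X\<^sup>* \<rhd> -\<close> and \<open>X \<rhd> -\<close>, and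
  most associativity isomorphisms disappear. Since the tensor category acts on itself faithfully, identities
  between its own arrows are obtained in the same way.
\<close>

section \<open>Arrows and isomorphisms in a category\<close>

lemma homI: "f \<in> Arr C \<Longrightarrow> Dom C f = X \<Longrightarrow> Cod C f = Y \<Longrightarrow> f \<in> hom C X Y"
  by (simp add: hom_def)

context category
begin

lemma dom_obj [simp]: "f \<in> Arr C \<Longrightarrow> Dom C f \<in> Obj C"
  and cod_obj [simp]: "f \<in> Arr C \<Longrightarrow> Cod C f \<in> Obj C"
  using dom_cod by auto

lemma idt_arr [simp]: "X \<in> Obj C \<Longrightarrow> Idt C X \<in> Arr C"
  and idt_dom [simp]: "X \<in> Obj C \<Longrightarrow> Dom C (Idt C X) = X"
  and idt_cod [simp]: "X \<in> Obj C \<Longrightarrow> Cod C (Idt C X) = X"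
  using id_hom by (auto simp: hom_def)

lemma cmp_arr [simp]: "g \<in> Arr C \<Longrightarrow> f \<in> Arr C \<Longrightarrow> Cod C f = Dom C g \<Longrightarrow> g \<cdot> f \<in> Arr C"
  and cmp_dom [simp]: "g \<in> Arr C \<Longrightarrow> f \<in> Arr C \<Longrightarrow> Cod C f = Dom C g \<Longrightarrow> Dom C (g \<cdot> f) = Dom C f"
  and cmp_cod [simp]: "g \<in> Arr C \<Longrightarrow> f \<in> Arr C \<Longrightarrow> Cod C f = Dom C g \<Longrightarrow> Cod C (g \<cdot> f) = Cod C g"
  using cmp_hom[of f "Dom C f" "Cod C f" g "Cod C g"] by (auto simp: hom_def)

lemma idt_right [simp]: "f \<in> Arr C \<Longrightarrow> Dom C f = X \<Longrightarrow> f \<cdot> Idt C X = f"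
  and idt_left [simp]: "f \<in> Arr C \<Longrightarrow> Cod C f = X \<Longrightarrow> Idt C X \<cdot> f = f"
  using cmp_id_right[of f] cmp_id_left[of f] by (auto simp: hom_def)

lemma assoc [simp]:
  "h \<in> Arr C \<Longrightarrow> g \<in> Arr C \<Longrightarrow> f \<in> Arr C \<Longrightarrow> Cod C g = Dom C h \<Longrightarrow> Cod C f = Dom C g
    \<Longrightarrow> (h \<cdot> g) \<cdot> f = h \<cdot> (g \<cdot> f)"
  using cmp_assoc[of f "Dom C f" "Cod C f" g "Cod C g" h "Cod C h"] by (simp add: hom_def)

text \<open>Composites are kept associated to the right. An equation \<open>a \<cdot> b = e\<close> rewrites inside a
  longer composite only in this form.\<close>

lemma reassoc:
  "a \<cdot> b = e \<Longrightarrow> a \<in> Arr C \<Longrightarrow> b \<in> Arr C \<Longrightarrow> Cod C b = Dom C a \<Longrightarrow> x \<in> Arr C \<Longrightarrow> Cod C x = Dom C b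
    \<Longrightarrow> a \<cdot> (b \<cdot> x) = e \<cdot> x"
  using assoc[of a b x] by simp

lemma reassoc3:
  "a \<cdot> (b \<cdot> c) = e \<Longrightarrow> a \<in> Arr C \<Longrightarrow> b \<in> Arr C \<Longrightarrow> c \<in> Arr C \<Longrightarrow> Cod C b = Dom C a
    \<Longrightarrow> Cod C c = Dom C b \<Longrightarrow> x \<in> Arr C \<Longrightarrow> Cod C x = Dom C c
    \<Longrightarrow> a \<cdot> (b \<cdot> (c \<cdot> x)) = e \<cdot> x"
  using assoc[of a "b \<cdot> c" x] by simp

lemma inverse_unique:
  assumes "inverse_arrows C f g" "inverse_arrows C f h"
  shows "g = h"
proof -
  have "g = g \<cdot> (f \<cdot> h)" using assms by (auto simp: inverse_arrows_def hom_def)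
  also have "\<dots> = (g \<cdot> f) \<cdot> h"
    using assms by (intro assoc[symmetric]) (auto simp: inverse_arrows_def hom_def)
  also have "\<dots> = h" using assms by (auto simp: inverse_arrows_def hom_def)
  finally show ?thesis .
qed

lemma cinv_eq: "inverse_arrows C f g \<Longrightarrow> cinv C f = g"
  unfolding cinv_def by (rule the_equality) (auto intro: inverse_unique)

lemma cinv_inverse: "iso_arrow C f \<Longrightarrow> inverse_arrows C f (cinv C f)"
  by (auto simp: iso_arrow_def dest: cinv_eq)

lemma inverse_arrowsI:
  "f \<in> Arr C \<Longrightarrow> g \<in> Arr C \<Longrightarrow> Dom C g = Cod C f \<Longrightarrow> Cod C g = Dom C f
    \<Longrightarrow> g \<cdot> f = Idt C (Dom C f) \<Longrightarrow> f \<cdot> g = Idt C (Cod C f) \<Longrightarrow> inverse_arrows C f g"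
  by (auto simp: inverse_arrows_def hom_def)

lemma isoI:
  "f \<in> Arr C \<Longrightarrow> g \<in> Arr C \<Longrightarrow> Dom C g = Cod C f \<Longrightarrow> Cod C g = Dom C f
    \<Longrightarrow> g \<cdot> f = Idt C (Dom C f) \<Longrightarrow> f \<cdot> g = Idt C (Cod C f) \<Longrightarrow> iso_arrow C f"
  using inverse_arrowsI[of f g] by (auto simp: iso_arrow_def)

lemma iso_arr: "iso_arrow C f \<Longrightarrow> f \<in> Arr C"
  by (auto simp: iso_arrow_def inverse_arrows_def)

lemma cinv_arr [simp]: "iso_arrow C f \<Longrightarrow> cinv C f \<in> Arr C"
  and cinv_dom [simp]: "iso_arrow C f \<Longrightarrow> Dom C (cinv C f) = Cod C f"
  and cinv_cod [simp]: "iso_arrow C f \<Longrightarrow> Cod C (cinv C f) = Dom C f"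
  and cinv_left [simp]: "iso_arrow C f \<Longrightarrow> cinv C f \<cdot> f = Idt C (Dom C f)"
  and cinv_right [simp]: "iso_arrow C f \<Longrightarrow> f \<cdot> cinv C f = Idt C (Cod C f)"
  using cinv_inverse[of f] by (auto simp: inverse_arrows_def hom_def)

lemma cinv_left' [simp]:
  "iso_arrow C f \<Longrightarrow> x \<in> Arr C \<Longrightarrow> Cod C x = Dom C f \<Longrightarrow> cinv C f \<cdot> (f \<cdot> x) = x"
  using assoc[of "cinv C f" f x] by (simp add: iso_arr)

lemma cinv_right' [simp]:
  "iso_arrow C f \<Longrightarrow> x \<in> Arr C \<Longrightarrow> Cod C x = Cod C f \<Longrightarrow> f \<cdot> (cinv C f \<cdot> x) = x"
  using assoc[of f "cinv C f" x] by (simp add: iso_arr)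

lemma iso_idt [simp]: "X \<in> Obj C \<Longrightarrow> iso_arrow C (Idt C X)"
  by (rule isoI[of _ "Idt C X"]) auto

lemma cinv_idt [simp]: "X \<in> Obj C \<Longrightarrow> cinv C (Idt C X) = Idt C X"
  by (rule cinv_eq, rule inverse_arrowsI) auto

lemma iso_cinv [simp]: "iso_arrow C f \<Longrightarrow> iso_arrow C (cinv C f)"
  by (rule isoI[of _ f]) (auto simp: iso_arr)

lemma cinv_cinv [simp]: "iso_arrow C f \<Longrightarrow> cinv C (cinv C f) = f"
  by (rule cinv_eq, rule inverse_arrowsI) (auto simp: iso_arr)

lemma iso_cmp [simp]:
  "iso_arrow C g \<Longrightarrow> iso_arrow C f \<Longrightarrow> Cod C f = Dom C g \<Longrightarrow> iso_arrow C (g \<cdot> f)"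
  by (rule isoI[of _ "cinv C f \<cdot> cinv C g"]) (auto simp: iso_arr)

lemma cinv_cmp:
  "iso_arrow C g \<Longrightarrow> iso_arrow C f \<Longrightarrow> Cod C f = Dom C g \<Longrightarrow> cinv C (g \<cdot> f) = cinv C f \<cdot> cinv C g"
  by (rule cinv_eq, rule inverse_arrowsI) (auto simp: iso_arr)

lemma iso_cancel_left:
  assumes "iso_arrow C f" "f \<cdot> g = f \<cdot> h" "g \<in> Arr C" "h \<in> Arr C" "Cod C g = Dom C f" "Cod C h = Dom C f"
  shows "g = h"
proof -
  have "g = cinv C f \<cdot> (f \<cdot> g)" using assms(1,3,5) by simp
  also have "\<dots> = h" using assms(1,4,6) by (simp add: assms(2))
  finally show ?thesis .
qed

lemma iso_cancel_right:
  assumes "iso_arrow C f" "g \<cdot> f = h \<cdot> f" "g \<in> Arr C" "h \<in> Arr C" "Dom C g = Cod C f" "Dom C h = Cod C f"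
  shows "g = h"
proof -
  have "g = (g \<cdot> f) \<cdot> cinv C f" using assms(1,3,5) by (simp add: iso_arr)
  also have "\<dots> = h" using assms(1,4,6) by (simp add: assms(2) iso_arr)
  finally show ?thesis .
qed

text \<open>Turns the naturality of an isomorphism into the naturality of its inverse.\<close>

lemma inverse_square:
  assumes "j \<cdot> b = a \<cdot> i" "iso_arrow C i" "iso_arrow C j" "a \<in> Arr C" "b \<in> Arr C"
    "Cod C b = Dom C j" "Cod C i = Dom C a" "Dom C b = Dom C i"
  shows "b \<cdot> cinv C i = cinv C j \<cdot> a"
proof -
  have "Cod C a = Cod C j" using assms by (metis cmp_cod iso_arr)
  then have "cinv C j \<cdot> a = cinv C j \<cdot> (a \<cdot> i) \<cdot> cinv C i"
    using assms(2-) by (simp add: iso_arr)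
  also have "\<dots> = b \<cdot> cinv C i"
    using assms(2-) by (simp add: iso_arr flip: assms(1))
  finally show ?thesis by simp
qed

text \<open>The Yoneda criterion for invertibility.\<close>

lemma iso_if_bijective:
  assumes f: "f \<in> hom C X Y"
    and bij: "\<And>Z k. Z \<in> Obj C \<Longrightarrow> k \<in> hom C Z Y \<Longrightarrow> \<exists>!h. h \<in> hom C Z X \<and> f \<cdot> h = k"
  shows "iso_arrow C f"
proof -
  have [simp]: "f \<in> Arr C" "Dom C f = X" "Cod C f = Y" using f by (auto simp: hom_def)
  have [simp]: "X \<in> Obj C" "Y \<in> Obj C" using dom_obj[of f] cod_obj[of f] by simp_all
  obtain g where g: "g \<in> hom C Y X" "f \<cdot> g = Idt C Y"
    using bij[of Y "Idt C Y"] id_hom[of Y] by auto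
  have [simp]: "g \<in> Arr C" "Dom C g = Y" "Cod C g = X" using g by (auto simp: hom_def)
  have "f \<cdot> (g \<cdot> f) = f"
    using reassoc[OF g(2), of f] by simp
  then have "g \<cdot> f = Idt C X"
    using bij[of X f] f by (metis (no_types, lifting) cmp_hom g(1) \<open>X \<in> Obj C\<close> cmp_id_right id_hom)
  then show ?thesis by (intro isoI[of f g]) (auto simp: g)
qed

end

section \<open>Actions of a tensor category\<close>

text \<open>The structure maps of the action are parameters of their own and not fields of a record. In this way the
  tensor product of \<open>C\<close> with its associativity and left unit isomorphisms is literally an action of
  \<open>C\<close> on itself, and the facts about actions become facts about \<open>C\<close>.\<close>

locale action = C: tensor_category C + M: category M
  for C :: "('o, 'a, 'k::field, 'z) tcat_scheme" (structure)
    and M :: "('p, 'b, 'y) cat_scheme" +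
  fixes actO :: "'o \<Rightarrow> 'p \<Rightarrow> 'p"  (infixr "\<odot>" 75)
    and actA :: "'a \<Rightarrow> 'b \<Rightarrow> 'b"  (infixr "\<star>" 75)
    and mas :: "'o \<Rightarrow> 'o \<Rightarrow> 'p \<Rightarrow> 'b"
    and mun :: "'p \<Rightarrow> 'b"
  assumes act_functor: "is_functor (prod_cat C M) M (bifctr actO actA)"
    and mas_iso': "X \<in> Obj C \<Longrightarrow> Y \<in> Obj C \<Longrightarrow> N \<in> Obj M \<Longrightarrow>
          mas X Y N \<in> hom M ((X \<otimes> Y) \<odot> N) (X \<odot> (Y \<odot> N)) \<and> iso_arrow M (mas X Y N)"
    and mas_nat: "f \<in> hom C X X' \<Longrightarrow> g \<in> hom C Y Y' \<Longrightarrow> h \<in> hom M N N' \<Longrightarrow>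
          mas X' Y' N' \<cdot>\<^bsub>M\<^esub> ((f \<boxtimes> g) \<star> h) = (f \<star> (g \<star> h)) \<cdot>\<^bsub>M\<^esub> mas X Y N"
    and mun_iso': "N \<in> Obj M \<Longrightarrow> mun N \<in> hom M (Unt C \<odot> N) N \<and> iso_arrow M (mun N)"
    and mun_nat': "h \<in> hom M N N' \<Longrightarrow> mun N' \<cdot>\<^bsub>M\<^esub> (Idt C (Unt C) \<star> h) = h \<cdot>\<^bsub>M\<^esub> mun N"
    and mod_pentagon: "X \<in> Obj C \<Longrightarrow> Y \<in> Obj C \<Longrightarrow> Z \<in> Obj C \<Longrightarrow> N \<in> Obj M \<Longrightarrow>
          mas X Y (Z \<odot> N) \<cdot>\<^bsub>M\<^esub> mas (X \<otimes> Y) Z N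
            = (Idt C X \<star> mas Y Z N) \<cdot>\<^bsub>M\<^esub> mas X (Y \<otimes> Z) N \<cdot>\<^bsub>M\<^esub> (Asc C X Y Z \<star> Idt M N)"
    and mod_triangle: "X \<in> Obj C \<Longrightarrow> N \<in> Obj M \<Longrightarrow>
          (Idt C X \<star> mun N) \<cdot>\<^bsub>M\<^esub> mas X (Unt C) N = Run C X \<star> Idt M N"

sublocale tensor_category \<subseteq> C: action C C "TenO C" "TenA C" "Asc C" "Lun C"
  by unfold_locales
    (auto simp: ten_functor asc_iso asc_nat lun_iso lun_nat pentagon triangle)

context action
begin

abbreviation cmpM (infixr "\<bullet>" 65) where "g \<bullet> f \<equiv> Cmp M g f"

lemma unt_obj' [simp]: "Unt C \<in> Obj C" by (rule C.unt_obj)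

lemma act_obj [simp]: "X \<in> Obj C \<Longrightarrow> N \<in> Obj M \<Longrightarrow> X \<odot> N \<in> Obj M"
  and act_arr [simp]: "f \<in> Arr C \<Longrightarrow> u \<in> Arr M \<Longrightarrow> f \<star> u \<in> Arr M"
  and act_dom [simp]: "f \<in> Arr C \<Longrightarrow> u \<in> Arr M \<Longrightarrow> Dom M (f \<star> u) = Dom C f \<odot> Dom M u"
  and act_cod [simp]: "f \<in> Arr C \<Longrightarrow> u \<in> Arr M \<Longrightarrow> Cod M (f \<star> u) = Cod C f \<odot> Cod M u"
  and act_idt [simp]: "X \<in> Obj C \<Longrightarrow> N \<in> Obj M \<Longrightarrow> Idt C X \<star> Idt M N = Idt M (X \<odot> N)"
  using act_functor by (auto simp: is_functor_def bifctr_def prod_cat_def hom_def)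

lemma act_cmp:
  "g \<in> Arr C \<Longrightarrow> f \<in> Arr C \<Longrightarrow> Cod C f = Dom C g \<Longrightarrow> v \<in> Arr M \<Longrightarrow> u \<in> Arr M \<Longrightarrow> Cod M u = Dom M v
    \<Longrightarrow> (g \<cdot> f) \<star> (v \<bullet> u) = (g \<star> v) \<bullet> (f \<star> u)"
  using act_functor by (auto simp: is_functor_def bifctr_def prod_cat_def hom_def)

lemma lact_cmp [simp]:
  "X \<in> Obj C \<Longrightarrow> v \<in> Arr M \<Longrightarrow> u \<in> Arr M \<Longrightarrow> Cod M u = Dom M v
    \<Longrightarrow> Idt C X \<star> (v \<bullet> u) = (Idt C X \<star> v) \<bullet> (Idt C X \<star> u)"
  using act_cmp[of "Idt C X" "Idt C X" v u] by simp

lemma ract_cmp [simp]: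
  "N \<in> Obj M \<Longrightarrow> g \<in> Arr C \<Longrightarrow> f \<in> Arr C \<Longrightarrow> Cod C f = Dom C g
    \<Longrightarrow> (g \<cdot> f) \<star> Idt M N = (g \<star> Idt M N) \<bullet> (f \<star> Idt M N)"
  using act_cmp[of g f "Idt M N" "Idt M N"] by simp

lemma act_split:
  "f \<in> Arr C \<Longrightarrow> u \<in> Arr M \<Longrightarrow> f \<star> u = (Idt C (Cod C f) \<star> u) \<bullet> (f \<star> Idt M (Dom M u))"
  using act_cmp[of "Idt C (Cod C f)" f u "Idt M (Dom M u)"] by simp

lemma interchange:
  "f \<in> Arr C \<Longrightarrow> u \<in> Arr M \<Longrightarrow> Dom C f = X \<Longrightarrow> Cod M u = N
    \<Longrightarrow> (f \<star> Idt M N) \<bullet> (Idt C X \<star> u) = (Idt C (Cod C f) \<star> u) \<bullet> (f \<star> Idt M (Dom M u))"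
  using act_cmp[of f "Idt C (Dom C f)" "Idt M (Cod M u)" u]
    act_cmp[of "Idt C (Cod C f)" f u "Idt M (Dom M u)"] by auto

lemma lact_iso [simp]: "X \<in> Obj C \<Longrightarrow> iso_arrow M u \<Longrightarrow> iso_arrow M (Idt C X \<star> u)"
  and cinv_lact: "X \<in> Obj C \<Longrightarrow> iso_arrow M u \<Longrightarrow> cinv M (Idt C X \<star> u) = Idt C X \<star> cinv M u"
proof -
  assume a: "X \<in> Obj C" "iso_arrow M u"
  have "inverse_arrows M (Idt C X \<star> u) (Idt C X \<star> cinv M u)"
    using a by (intro M.inverse_arrowsI) (auto simp: M.iso_arr lact_cmp[symmetric] simp del: lact_cmp)
  then show "iso_arrow M (Idt C X \<star> u)" "cinv M (Idt C X \<star> u) = Idt C X \<star> cinv M u"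
    by (auto simp: iso_arrow_def M.cinv_eq)
qed

lemma ract_iso [simp]: "N \<in> Obj M \<Longrightarrow> iso_arrow C f \<Longrightarrow> iso_arrow M (f \<star> Idt M N)"
  and cinv_ract: "N \<in> Obj M \<Longrightarrow> iso_arrow C f \<Longrightarrow> cinv M (f \<star> Idt M N) = cinv C f \<star> Idt M N"
proof -
  assume a: "N \<in> Obj M" "iso_arrow C f"
  have "inverse_arrows M (f \<star> Idt M N) (cinv C f \<star> Idt M N)"
    using a by (intro M.inverse_arrowsI) (auto simp: C.iso_arr ract_cmp[symmetric] simp del: ract_cmp)
  then show "iso_arrow M (f \<star> Idt M N)" "cinv M (f \<star> Idt M N) = cinv C f \<star> Idt M N"
    by (auto simp: iso_arrow_def M.cinv_eq)
qed

lemma lact_lift: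
  "v \<bullet> u = e \<Longrightarrow> X \<in> Obj C \<Longrightarrow> v \<in> Arr M \<Longrightarrow> u \<in> Arr M \<Longrightarrow> Cod M u = Dom M v
    \<Longrightarrow> (Idt C X \<star> v) \<bullet> (Idt C X \<star> u) = Idt C X \<star> e"
  using lact_cmp[of X v u] by simp

lemma lact_lift3:
  "v \<bullet> u \<bullet> w = e \<Longrightarrow> X \<in> Obj C \<Longrightarrow> v \<in> Arr M \<Longrightarrow> u \<in> Arr M \<Longrightarrow> w \<in> Arr M \<Longrightarrow> Cod M u = Dom M v
    \<Longrightarrow> Cod M w = Dom M u \<Longrightarrow> (Idt C X \<star> v) \<bullet> (Idt C X \<star> u) \<bullet> (Idt C X \<star> w) = Idt C X \<star> e"
  using lact_cmp[of X v "u \<bullet> w"] by simp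

lemma ract_lift:
  "g \<cdot> f = e \<Longrightarrow> N \<in> Obj M \<Longrightarrow> g \<in> Arr C \<Longrightarrow> f \<in> Arr C \<Longrightarrow> Cod C f = Dom C g
    \<Longrightarrow> (g \<star> Idt M N) \<bullet> (f \<star> Idt M N) = e \<star> Idt M N"
  using ract_cmp[of N g f] by simp

lemma lact_cinv [simp]:
  assumes [simp]: "X \<in> Obj C" "iso_arrow M u"
  shows "(Idt C X \<star> u) \<bullet> (Idt C X \<star> cinv M u) = Idt M (X \<odot> Cod M u)"
    and "(Idt C X \<star> cinv M u) \<bullet> (Idt C X \<star> u) = Idt M (X \<odot> Dom M u)"
  by (simp_all add: M.iso_arr flip: lact_cmp)

lemma ract_cinv [simp]:
  assumes [simp]: "N \<in> Obj M" "iso_arrow C f"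
  shows "(f \<star> Idt M N) \<bullet> (cinv C f \<star> Idt M N) = Idt M (Cod C f \<odot> N)"
    and "(cinv C f \<star> Idt M N) \<bullet> (f \<star> Idt M N) = Idt M (Dom C f \<odot> N)"
  by (simp_all add: C.iso_arr flip: ract_cmp)

lemma lact_cinv' [simp]:
  assumes [simp]: "X \<in> Obj C" "iso_arrow M u" "x \<in> Arr M"
  shows "Cod M x = X \<odot> Cod M u \<Longrightarrow> (Idt C X \<star> u) \<bullet> (Idt C X \<star> cinv M u) \<bullet> x = x"
    and "Cod M x = X \<odot> Dom M u \<Longrightarrow> (Idt C X \<star> cinv M u) \<bullet> (Idt C X \<star> u) \<bullet> x = x"
  by (simp_all add: lact_cinv[THEN M.reassoc] M.iso_arr)

lemma ract_cinv' [simp]: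
  assumes [simp]: "N \<in> Obj M" "iso_arrow C f" "x \<in> Arr M"
  shows "Cod M x = Cod C f \<odot> N \<Longrightarrow> (f \<star> Idt M N) \<bullet> (cinv C f \<star> Idt M N) \<bullet> x = x"
    and "Cod M x = Dom C f \<odot> N \<Longrightarrow> (cinv C f \<star> Idt M N) \<bullet> (f \<star> Idt M N) \<bullet> x = x"
  by (simp_all add: ract_cinv[THEN M.reassoc] C.iso_arr)

lemma mas_arr [simp]: "X \<in> Obj C \<Longrightarrow> Y \<in> Obj C \<Longrightarrow> N \<in> Obj M \<Longrightarrow> mas X Y N \<in> Arr M"
  and mas_dom [simp]: "X \<in> Obj C \<Longrightarrow> Y \<in> Obj C \<Longrightarrow> N \<in> Obj M \<Longrightarrow> Dom M (mas X Y N) = (X \<otimes> Y) \<odot> N"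
  and mas_cod [simp]: "X \<in> Obj C \<Longrightarrow> Y \<in> Obj C \<Longrightarrow> N \<in> Obj M \<Longrightarrow> Cod M (mas X Y N) = X \<odot> (Y \<odot> N)"
  and mas_iso [simp]: "X \<in> Obj C \<Longrightarrow> Y \<in> Obj C \<Longrightarrow> N \<in> Obj M \<Longrightarrow> iso_arrow M (mas X Y N)"
  using mas_iso' by (auto simp: hom_def)

lemma mun_arr [simp]: "N \<in> Obj M \<Longrightarrow> mun N \<in> Arr M"
  and mun_dom [simp]: "N \<in> Obj M \<Longrightarrow> Dom M (mun N) = Unt C \<odot> N"
  and mun_cod [simp]: "N \<in> Obj M \<Longrightarrow> Cod M (mun N) = N"
  and mun_iso [simp]: "N \<in> Obj M \<Longrightarrow> iso_arrow M (mun N)"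
  using mun_iso' by (auto simp: hom_def)

end

context tensor_category
begin

lemma run_arr [simp]: "X \<in> Obj C \<Longrightarrow> Run C X \<in> Arr C"
  and run_dom [simp]: "X \<in> Obj C \<Longrightarrow> Dom C (Run C X) = X \<otimes> Unt C"
  and run_cod [simp]: "X \<in> Obj C \<Longrightarrow> Cod C (Run C X) = X"
  and run_iso' [simp]: "X \<in> Obj C \<Longrightarrow> iso_arrow C (Run C X)"
  using run_iso by (auto simp: hom_def)

lemma run_nat': "f \<in> Arr C \<Longrightarrow> Cod C f = Y \<Longrightarrow> Run C Y \<cdot> (f \<boxtimes> Idt C (Unt C)) = f \<cdot> Run C (Dom C f)"
  using run_nat[of f "Dom C f" Y] by (simp add: hom_def)

lemma dul_obj [simp]: "X \<in> Obj C \<Longrightarrow> Dul C X \<in> Obj C"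
  and ev_arr [simp]: "X \<in> Obj C \<Longrightarrow> Ev C X \<in> Arr C"
  and ev_dom [simp]: "X \<in> Obj C \<Longrightarrow> Dom C (Ev C X) = Dul C X \<otimes> X"
  and ev_cod [simp]: "X \<in> Obj C \<Longrightarrow> Cod C (Ev C X) = Unt C"
  and cv_arr [simp]: "X \<in> Obj C \<Longrightarrow> Cv C X \<in> Arr C"
  and cv_dom [simp]: "X \<in> Obj C \<Longrightarrow> Dom C (Cv C X) = Unt C"
  and cv_cod [simp]: "X \<in> Obj C \<Longrightarrow> Cod C (Cv C X) = X \<otimes> Dul C X"
  using left_dual[of X] by (auto simp: dual_pair_def hom_def)

lemma dur_obj [simp]: "X \<in> Obj C \<Longrightarrow> Dur C X \<in> Obj C"
  and evr_arr [simp]: "X \<in> Obj C \<Longrightarrow> Evr C X \<in> Arr C"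
  and evr_dom [simp]: "X \<in> Obj C \<Longrightarrow> Dom C (Evr C X) = X \<otimes> Dur C X"
  and evr_cod [simp]: "X \<in> Obj C \<Longrightarrow> Cod C (Evr C X) = Unt C"
  and cvr_arr [simp]: "X \<in> Obj C \<Longrightarrow> Cvr C X \<in> Arr C"
  and cvr_dom [simp]: "X \<in> Obj C \<Longrightarrow> Dom C (Cvr C X) = Unt C"
  and cvr_cod [simp]: "X \<in> Obj C \<Longrightarrow> Cod C (Cvr C X) = Dur C X \<otimes> X"
  using right_dual[of X] by (auto simp: dual_pair_def hom_def)

text \<open>By this lemma an equation between arrows of \<open>C\<close> can be checked on the regular module, where
  it is enough to let both sides act on the unit object.\<close>

lemma run_faithful:
  assumes "f \<boxtimes> Idt C (Unt C) = g \<boxtimes> Idt C (Unt C)" "f \<in> Arr C" "g \<in> Arr C" "Dom C f = Dom C g" "Cod C f = Cod C g"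
  shows "f = g"
proof -
  have "f \<cdot> Run C (Dom C f) = g \<cdot> Run C (Dom C f)"
    using run_nat'[of f] run_nat'[of g] assms by metis
  then show ?thesis
    using assms by (intro iso_cancel_right[of "Run C (Dom C f)" f g]) auto
qed

end

context action
begin

lemma mas_nat_1:
  "f \<in> Arr C \<Longrightarrow> Cod C f = X' \<Longrightarrow> Y \<in> Obj C \<Longrightarrow> N \<in> Obj M \<Longrightarrow>
   mas X' Y N \<bullet> ((f \<boxtimes> Idt C Y) \<star> Idt M N) = (f \<star> Idt M (Y \<odot> N)) \<bullet> mas (Dom C f) Y N"
  using mas_nat[of f "Dom C f" X' "Idt C Y" Y Y "Idt M N" N N] by (simp add: hom_def)

lemma mas_nat_2:
  "f \<in> Arr C \<Longrightarrow> Cod C f = Y' \<Longrightarrow> X \<in> Obj C \<Longrightarrow> N \<in> Obj M \<Longrightarrow>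
   mas X Y' N \<bullet> ((Idt C X \<boxtimes> f) \<star> Idt M N) = (Idt C X \<star> (f \<star> Idt M N)) \<bullet> mas X (Dom C f) N"
  using mas_nat[of "Idt C X" X X f "Dom C f" Y' "Idt M N" N N] by (simp add: hom_def)

lemma mas_nat_3:
  "u \<in> Arr M \<Longrightarrow> Cod M u = N' \<Longrightarrow> X \<in> Obj C \<Longrightarrow> Y \<in> Obj C \<Longrightarrow>
   mas X Y N' \<bullet> (Idt C (X \<otimes> Y) \<star> u) = (Idt C X \<star> (Idt C Y \<star> u)) \<bullet> mas X Y (Dom M u)"
  using mas_nat[of "Idt C X" X X "Idt C Y" Y Y u "Dom M u" N'] by (simp add: hom_def)

lemma mun_nat: "u \<in> Arr M \<Longrightarrow> Cod M u = N' \<Longrightarrow> mun N' \<bullet> (Idt C (Unt C) \<star> u) = u \<bullet> mun (Dom M u)"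
  using mun_nat'[of u "Dom M u" N'] by (simp add: hom_def)

lemma mun_nat_r: "u \<in> Arr M \<Longrightarrow> Dom M u = N \<Longrightarrow> u \<bullet> mun N = mun (Cod M u) \<bullet> (Idt C (Unt C) \<star> u)"
  using mun_nat'[of u N "Cod M u"] by (simp add: hom_def)

lemma cmas_nat_1:
  "f \<in> Arr C \<Longrightarrow> Dom C f = X \<Longrightarrow> Y \<in> Obj C \<Longrightarrow> N \<in> Obj M \<Longrightarrow>
   ((f \<boxtimes> Idt C Y) \<star> Idt M N) \<bullet> cinv M (mas X Y N) = cinv M (mas (Cod C f) Y N) \<bullet> (f \<star> Idt M (Y \<odot> N))"
  using mas_nat_1[of f "Cod C f" Y N] by (intro M.inverse_square) auto

lemma cmas_nat_2:
  "f \<in> Arr C \<Longrightarrow> Dom C f = Y \<Longrightarrow> X \<in> Obj C \<Longrightarrow> N \<in> Obj M \<Longrightarrow>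
   ((Idt C X \<boxtimes> f) \<star> Idt M N) \<bullet> cinv M (mas X Y N) = cinv M (mas X (Cod C f) N) \<bullet> (Idt C X \<star> (f \<star> Idt M N))"
  using mas_nat_2[of f "Cod C f" X N] by (intro M.inverse_square) auto

lemma cmas_nat_3:
  "u \<in> Arr M \<Longrightarrow> Dom M u = N \<Longrightarrow> X \<in> Obj C \<Longrightarrow> Y \<in> Obj C \<Longrightarrow>
   (Idt C (X \<otimes> Y) \<star> u) \<bullet> cinv M (mas X Y N) = cinv M (mas X Y (Cod M u)) \<bullet> (Idt C X \<star> (Idt C Y \<star> u))"
  using mas_nat_3[of u "Cod M u" X Y] by (intro M.inverse_square) auto

lemma cmun_nat:
  "u \<in> Arr M \<Longrightarrow> Dom M u = N \<Longrightarrow> (Idt C (Unt C) \<star> u) \<bullet> cinv M (mun N) = cinv M (mun (Cod M u)) \<bullet> u"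
  using mun_nat[of u "Cod M u"] by (intro M.inverse_square) auto

lemma unt_faithful:
  assumes "Idt C (Unt C) \<star> u = Idt C (Unt C) \<star> v" "u \<in> Arr M" "v \<in> Arr M" "Dom M u = Dom M v" "Cod M u = Cod M v"
  shows "u = v"
proof -
  have "u \<bullet> mun (Dom M u) = v \<bullet> mun (Dom M u)"
    using mun_nat[of u] mun_nat[of v] assms by metis
  then show ?thesis
    using assms by (intro M.iso_cancel_right[of "mun (Dom M u)" u v]) auto
qed

text \<open>Kelly's argument: it is enough to prove the equation after acting with the unit object, and then it
  follows from the pentagon and two triangles.\<close>

lemma mun_mas:
  assumes [simp]: "X \<in> Obj C" "N \<in> Obj M"
  shows "mun (X \<odot> N) \<bullet> mas (Unt C) X N = Lun C X \<star> Idt M N"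
proof (rule unt_faithful)
  let ?I = "Unt C"
  have "(Idt C ?I \<star> mun (X \<odot> N)) \<bullet> (Idt C ?I \<star> mas ?I X N) \<bullet> mas ?I (?I \<otimes> X) N \<bullet> (Asc C ?I ?I X \<star> Idt M N)
      = (Idt C ?I \<star> mun (X \<odot> N)) \<bullet> mas ?I ?I (X \<odot> N) \<bullet> mas (?I \<otimes> ?I) X N"
    by (simp add: mod_pentagon)
  also have "\<dots> = (Run C ?I \<star> Idt M (X \<odot> N)) \<bullet> mas (?I \<otimes> ?I) X N"
    by (simp add: mod_triangle[THEN M.reassoc])
  also have "\<dots> = mas ?I X N \<bullet> ((Run C ?I \<boxtimes> Idt C X) \<star> Idt M N)"
    by (simp add: mas_nat_1)
  also have "\<dots> = mas ?I X N \<bullet> ((Idt C ?I \<boxtimes> Lun C X) \<star> Idt M N) \<bullet> (Asc C ?I ?I X \<star> Idt M N)"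
    by (simp flip: C.triangle)
  also have "\<dots> = (Idt C ?I \<star> (Lun C X \<star> Idt M N)) \<bullet> mas ?I (?I \<otimes> X) N \<bullet> (Asc C ?I ?I X \<star> Idt M N)"
    by (simp add: mas_nat_2[THEN M.reassoc])
  finally have e: "((Idt C ?I \<star> mun (X \<odot> N)) \<bullet> (Idt C ?I \<star> mas ?I X N)) \<bullet> (mas ?I (?I \<otimes> X) N \<bullet> (Asc C ?I ?I X \<star> Idt M N))
      = (Idt C ?I \<star> (Lun C X \<star> Idt M N)) \<bullet> (mas ?I (?I \<otimes> X) N \<bullet> (Asc C ?I ?I X \<star> Idt M N))"
    by simp
  have "(Idt C ?I \<star> mun (X \<odot> N)) \<bullet> (Idt C ?I \<star> mas ?I X N) = Idt C ?I \<star> (Lun C X \<star> Idt M N)"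
    by (rule M.iso_cancel_right[OF _ e]) auto
  then show "Idt C ?I \<star> (mun (X \<odot> N) \<bullet> mas ?I X N) = Idt C ?I \<star> (Lun C X \<star> Idt M N)"
    by simp
qed auto

end

section \<open>Pairings and their actions\<close>

context action
begin

lemma cmas_nat_1r:
  "f \<in> Arr C \<Longrightarrow> Cod C f = X' \<Longrightarrow> Y \<in> Obj C \<Longrightarrow> N \<in> Obj M \<Longrightarrow>
   cinv M (mas X' Y N) \<bullet> (f \<star> Idt M (Y \<odot> N)) = ((f \<boxtimes> Idt C Y) \<star> Idt M N) \<bullet> cinv M (mas (Dom C f) Y N)"
  using cmas_nat_1[of f "Dom C f" Y N] by simp

lemma cmas_nat_2r:
  "f \<in> Arr C \<Longrightarrow> Cod C f = Y' \<Longrightarrow> X \<in> Obj C \<Longrightarrow> N \<in> Obj M \<Longrightarrow>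
   cinv M (mas X Y' N) \<bullet> (Idt C X \<star> (f \<star> Idt M N)) = ((Idt C X \<boxtimes> f) \<star> Idt M N) \<bullet> cinv M (mas X (Dom C f) N)"
  using cmas_nat_2[of f "Dom C f" X N] by simp

lemma cmas_nat_3r:
  "u \<in> Arr M \<Longrightarrow> Cod M u = N' \<Longrightarrow> X \<in> Obj C \<Longrightarrow> Y \<in> Obj C \<Longrightarrow>
   cinv M (mas X Y N') \<bullet> (Idt C X \<star> (Idt C Y \<star> u)) = (Idt C (X \<otimes> Y) \<star> u) \<bullet> cinv M (mas X Y (Dom M u))"
  using cmas_nat_3[of u "Dom M u" X Y] by simp

lemma mas_nat_1r:
  "f \<in> Arr C \<Longrightarrow> Dom C f = X \<Longrightarrow> Y \<in> Obj C \<Longrightarrow> N \<in> Obj M \<Longrightarrow>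
   (f \<star> Idt M (Y \<odot> N)) \<bullet> mas X Y N = mas (Cod C f) Y N \<bullet> ((f \<boxtimes> Idt C Y) \<star> Idt M N)"
  using mas_nat_1[of f "Cod C f" Y N] by simp

lemma mas_nat_2r:
  "f \<in> Arr C \<Longrightarrow> Dom C f = Y \<Longrightarrow> X \<in> Obj C \<Longrightarrow> N \<in> Obj M \<Longrightarrow>
   (Idt C X \<star> (f \<star> Idt M N)) \<bullet> mas X Y N = mas X (Cod C f) N \<bullet> ((Idt C X \<boxtimes> f) \<star> Idt M N)"
  using mas_nat_2[of f "Cod C f" X N] by simp

lemma mas_nat_3r:
  "u \<in> Arr M \<Longrightarrow> Dom M u = N \<Longrightarrow> X \<in> Obj C \<Longrightarrow> Y \<in> Obj C \<Longrightarrow>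
   (Idt C X \<star> (Idt C Y \<star> u)) \<bullet> mas X Y N = mas X Y (Cod M u) \<bullet> (Idt C (X \<otimes> Y) \<star> u)"
  using mas_nat_3[of u "Cod M u" X Y] by simp

lemma interchange_r:
  "f \<in> Arr C \<Longrightarrow> u \<in> Arr M \<Longrightarrow> Cod C f = X \<Longrightarrow> Dom M u = N
    \<Longrightarrow> (Idt C X \<star> u) \<bullet> (f \<star> Idt M N) = (f \<star> Idt M (Cod M u)) \<bullet> (Idt C (Dom C f) \<star> u)"
  using interchange[of f u "Dom C f" "Cod M u"] by auto

text \<open>The shapes in which the pentagon is met when a pairing or a copairing is followed through a nested
  action.\<close>

lemma pentagon_1:
  assumes [simp]: "X \<in> Obj C" "Y \<in> Obj C" "Z \<in> Obj C" "N \<in> Obj M"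
  shows "(Idt C X \<star> cinv M (mas Y Z N)) \<bullet> mas X Y (Z \<odot> N)
    = mas X (Y \<otimes> Z) N \<bullet> (Asc C X Y Z \<star> Idt M N) \<bullet> cinv M (mas (X \<otimes> Y) Z N)"
proof -
  have "mas X Y (Z \<odot> N) = (Idt C X \<star> mas Y Z N) \<bullet> mas X (Y \<otimes> Z) N \<bullet> (Asc C X Y Z \<star> Idt M N) \<bullet> cinv M (mas (X \<otimes> Y) Z N)"
    by (rule M.iso_cancel_right[of "mas (X \<otimes> Y) Z N"]) (auto simp: mod_pentagon)
  then show ?thesis by (simp flip: cinv_lact)
qed

lemma pentagon_2:
  assumes [simp]: "X \<in> Obj C" "Y \<in> Obj C" "Z \<in> Obj C" "N \<in> Obj M"
  shows "cinv M (mas X Y (Z \<odot> N)) \<bullet> (Idt C X \<star> mas Y Z N)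
    = mas (X \<otimes> Y) Z N \<bullet> (cinv C (Asc C X Y Z) \<star> Idt M N) \<bullet> cinv M (mas X (Y \<otimes> Z) N)"
proof -
  have "Idt C X \<star> mas Y Z N = mas X Y (Z \<odot> N) \<bullet> mas (X \<otimes> Y) Z N \<bullet> (cinv C (Asc C X Y Z) \<star> Idt M N) \<bullet> cinv M (mas X (Y \<otimes> Z) N)"
    by (rule M.iso_cancel_right[of "mas X (Y \<otimes> Z) N \<bullet> (Asc C X Y Z \<star> Idt M N)"])
      (auto simp: mod_pentagon simp flip: cinv_ract)
  then show ?thesis by simp
qed

lemma pentagon_3:
  assumes [simp]: "X \<in> Obj C" "Y \<in> Obj C" "Z \<in> Obj C" "N \<in> Obj M"
  shows "mas (X \<otimes> Y) Z N \<bullet> (cinv C (Asc C X Y Z) \<star> Idt M N)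
    = cinv M (mas X Y (Z \<odot> N)) \<bullet> (Idt C X \<star> mas Y Z N) \<bullet> mas X (Y \<otimes> Z) N"
  by (simp add: pentagon_2[THEN M.reassoc])

lemma triangle_cinv:
  assumes [simp]: "X \<in> Obj C" "N \<in> Obj M"
  shows "mas X (Unt C) N \<bullet> (cinv C (Run C X) \<star> Idt M N) = Idt C X \<star> cinv M (mun N)"
proof -
  have "(Idt C X \<star> mun N) \<bullet> mas X (Unt C) N \<bullet> (cinv C (Run C X) \<star> Idt M N) = Idt M (X \<odot> N)"
    by (simp add: mod_triangle[THEN M.reassoc] flip: cinv_ract)
  then show ?thesis
    by - (rule M.iso_cancel_left[of "Idt C X \<star> mun N"], auto simp flip: cinv_lact)
qed

lemma cmun_mas:
  assumes [simp]: "X \<in> Obj C" "N \<in> Obj M"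
  shows "cinv M (mas (Unt C) X N) \<bullet> cinv M (mun (X \<odot> N)) = cinv C (Lun C X) \<star> Idt M N"
  using M.cinv_cmp[of "mun (X \<odot> N)" "mas (Unt C) X N"] by (simp add: mun_mas cinv_ract)

text \<open>A pairing \<open>p : D \<otimes> X \<rightarrow> 1\<close> acts as a natural transformation from \<open>D
  \<odot> (X \<odot> -)\<close> to the identity, and dually for copairings. On this level the associativity
  isomorphisms between tensor products are no longer visible.\<close>

definition pair :: "'o \<Rightarrow> 'o \<Rightarrow> 'a \<Rightarrow> 'p \<Rightarrow> 'b" where
  "pair D X p N = mun N \<bullet> (p \<star> Idt M N) \<bullet> cinv M (mas D X N)"

definition copair :: "'o \<Rightarrow> 'o \<Rightarrow> 'a \<Rightarrow> 'p \<Rightarrow> 'b" where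
  "copair X D c N = mas X D N \<bullet> (c \<star> Idt M N) \<bullet> cinv M (mun N)"

abbreviation evA :: "'o \<Rightarrow> 'p \<Rightarrow> 'b" where
  "evA X \<equiv> pair (Dul C X) X (Ev C X)"

abbreviation cvA :: "'o \<Rightarrow> 'p \<Rightarrow> 'b" where
  "cvA X \<equiv> copair X (Dul C X) (Cv C X)"

end

context action
begin

context
  fixes D X p
  assumes [simp]: "D \<in> Obj C" "X \<in> Obj C" "p \<in> Arr C" "Dom C p = D \<otimes> X" "Cod C p = Unt C"
begin

lemma pair_arr [simp]: "N \<in> Obj M \<Longrightarrow> pair D X p N \<in> Arr M"
  and pair_dom [simp]: "N \<in> Obj M \<Longrightarrow> Dom M (pair D X p N) = D \<odot> (X \<odot> N)"
  and pair_cod [simp]: "N \<in> Obj M \<Longrightarrow> Cod M (pair D X p N) = N"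
  by (auto simp: pair_def)

lemma pair_nat:
  assumes "u \<in> Arr M" "Cod M u = N'"
  shows "pair D X p N' \<bullet> (Idt C D \<star> (Idt C X \<star> u)) = u \<bullet> pair D X p (Dom M u)"
proof -
  have [simp]: "u \<in> Arr M" "Cod M u = N'" "N' \<in> Obj M" using assms by auto
  show ?thesis
    by (simp add: pair_def cmas_nat_3r interchange[THEN M.reassoc] mun_nat[THEN M.reassoc])
qed

lemma pair_nat_r:
  assumes "u \<in> Arr M" "Dom M u = N"
  shows "u \<bullet> pair D X p N = pair D X p (Cod M u) \<bullet> (Idt C D \<star> (Idt C X \<star> u))"
  using pair_nat[of u "Cod M u"] assms by simp

lemma pair_mas: "N \<in> Obj M \<Longrightarrow> mun N \<bullet> (p \<star> Idt M N) = pair D X p N \<bullet> mas D X N"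
  by (simp add: pair_def)

lemma pair_ract:
  assumes [simp]: "d \<in> Arr C" "Cod C d = D" "N \<in> Obj M"
  shows "pair D X p N \<bullet> (d \<star> Idt M (X \<odot> N)) = pair (Dom C d) X (p \<cdot> (d \<boxtimes> Idt C X)) N"
  by (simp add: pair_def cmas_nat_1r)

lemma pair_lact:
  assumes [simp]: "x \<in> Arr C" "Cod C x = X" "N \<in> Obj M"
  shows "pair D X p N \<bullet> (Idt C D \<star> (x \<star> Idt M N)) = pair D (Dom C x) (p \<cdot> (Idt C D \<boxtimes> x)) N"
  by (simp add: pair_def cmas_nat_2r)

text \<open>The component of a pairing at an object \<open>Y\<close> of the regular module is an arrow of
  \<open>C\<close>. This lemma says how it acts in turn.\<close>

lemma pair_ten:
  assumes [simp]: "Y \<in> Obj C" "N \<in> Obj M"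
  shows "C.C.pair D X p Y \<star> Idt M N
    = pair D X p (Y \<odot> N) \<bullet> (Idt C D \<star> mas X Y N) \<bullet> mas D (X \<otimes> Y) N"
  by (simp add: pair_def C.C.pair_def flip: mun_mas)
    (simp add: mas_nat_1[THEN M.reassoc] pentagon_3)

end

context
  fixes D X c
  assumes [simp]: "D \<in> Obj C" "X \<in> Obj C" "c \<in> Arr C" "Cod C c = X \<otimes> D" "Dom C c = Unt C"
begin

lemma copair_arr [simp]: "N \<in> Obj M \<Longrightarrow> copair X D c N \<in> Arr M"
  and copair_cod [simp]: "N \<in> Obj M \<Longrightarrow> Cod M (copair X D c N) = X \<odot> (D \<odot> N)"
  and copair_dom [simp]: "N \<in> Obj M \<Longrightarrow> Dom M (copair X D c N) = N"
  by (auto simp: copair_def)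

lemma copair_nat:
  assumes "u \<in> Arr M" "Dom M u = N"
  shows "(Idt C X \<star> (Idt C D \<star> u)) \<bullet> copair X D c N = copair X D c (Cod M u) \<bullet> u"
proof -
  have [simp]: "u \<in> Arr M" "Dom M u = N" "N \<in> Obj M" using assms by auto
  show ?thesis
    by (simp add: copair_def mas_nat_3r[THEN M.reassoc] interchange_r[THEN M.reassoc] cmun_nat)
qed

end

text \<open>The arrow on the right is the one in the definition of a dual pair, with an arbitrary \<open>e\<close> in
  the place of the evaluation; for such \<open>e\<close> it is also the definition of \<open>rmate\<close>.\<close>

lemma lact_pair_copair:
  assumes [simp]: "D \<in> Obj C" "X \<in> Obj C" "A \<in> Obj C" "e \<in> Arr C" "Dom C e = D \<otimes> A" "Cod C e = Unt C"
    "c \<in> Arr C" "Cod C c = X \<otimes> D" "Dom C c = Unt C" "N \<in> Obj M"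
  shows "(Idt C X \<star> pair D A e N) \<bullet> copair X D c (A \<odot> N)
    = (Run C X \<cdot> (Idt C X \<boxtimes> e) \<cdot> Asc C X D A \<cdot> (c \<boxtimes> Idt C A) \<cdot> cinv C (Lun C A)) \<star> Idt M N"
  by (simp add: pair_def copair_def pentagon_1[THEN M.reassoc] cmas_nat_1r[THEN M.reassoc]
      mas_nat_2r[THEN M.reassoc] mod_triangle[THEN M.reassoc] cmun_mas)

lemma zigzag_1:
  assumes dp: "dual_pair C D X e c" and [simp]: "N \<in> Obj M"
  shows "(Idt C X \<star> pair D X e N) \<bullet> copair X D c (X \<odot> N) = Idt M (X \<odot> N)"
proof -
  have [simp]: "D \<in> Obj C" "X \<in> Obj C" "e \<in> Arr C" "Dom C e = D \<otimes> X" "Cod C e = Unt C"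
    "c \<in> Arr C" "Cod C c = X \<otimes> D" "Dom C c = Unt C"
    using dp by (auto simp: dual_pair_def hom_def)
  have "(Idt C X \<star> pair D X e N) \<bullet> copair X D c (X \<odot> N)
    = (Run C X \<cdot> (Idt C X \<boxtimes> e) \<cdot> Asc C X D X \<cdot> (c \<boxtimes> Idt C X) \<cdot> cinv C (Lun C X)) \<star> Idt M N"
    by (rule lact_pair_copair) auto
  also have "\<dots> = Idt C X \<star> Idt M N"
    using dp by (simp only: dual_pair_def)
  finally show ?thesis by simp
qed

lemma zigzag_2:
  assumes dp: "dual_pair C D X e c" and [simp]: "N \<in> Obj M"
  shows "pair D X e (D \<odot> N) \<bullet> (Idt C D \<star> copair X D c N) = Idt M (D \<odot> N)"
proof -
  have [simp]: "D \<in> Obj C" "X \<in> Obj C" "e \<in> Arr C" "Dom C e = D \<otimes> X" "Cod C e = Unt C"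
    "c \<in> Arr C" "Cod C c = X \<otimes> D" "Dom C c = Unt C"
    using dp by (auto simp: dual_pair_def hom_def)
  have t: "cinv M (mas D (Unt C) N) \<bullet> (Idt C D \<star> cinv M (mun N)) = cinv C (Run C D) \<star> Idt M N"
    by (simp flip: triangle_cinv)
  have "pair D X e (D \<odot> N) \<bullet> (Idt C D \<star> copair X D c N)
    = (Lun C D \<cdot> (e \<boxtimes> Idt C D) \<cdot> cinv C (Asc C D X D) \<cdot> (Idt C D \<boxtimes> c) \<cdot> cinv C (Run C D)) \<star> Idt M N"
    by (simp add: pair_def copair_def pentagon_2[THEN M.reassoc] cmas_nat_2r[THEN M.reassoc]
        mas_nat_1r[THEN M.reassoc] mun_mas[THEN M.reassoc] t)
  also have "\<dots> = Idt C D \<star> Idt M N"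
    using dp by (simp only: dual_pair_def)
  finally show ?thesis by simp
qed

lemmas zz_1 [simp] = zigzag_1[OF C.left_dual] zigzag_1[OF C.left_dual, THEN M.reassoc]
lemmas zz_2 [simp] = zigzag_2[OF C.left_dual] zigzag_2[OF C.left_dual, THEN M.reassoc]

end

section \<open>Mates\<close>

context tensor_category
begin

lemma lun_unt: "Lun C (Unt C) = Run C (Unt C)"
proof (rule run_faithful)
  let ?I = "Unt C"
  have "Lun C ?I \<cdot> (Idt C ?I \<boxtimes> Lun C ?I) = Lun C ?I \<cdot> Lun C (?I \<otimes> ?I)"
    by (simp add: C.mun_nat)
  then have "Idt C ?I \<boxtimes> Lun C ?I = Lun C (?I \<otimes> ?I)"
    by (intro iso_cancel_left[of "Lun C ?I" "Idt C ?I \<boxtimes> Lun C ?I" "Lun C (?I \<otimes> ?I)"]) auto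
  then show "Lun C ?I \<boxtimes> Idt C ?I = Run C ?I \<boxtimes> Idt C ?I"
    using C.mun_mas[of ?I ?I] triangle[of ?I ?I] by simp
qed auto

text \<open>Transposition along the duality of \<open>X\<close> on the right: arrows \<open>A \<otimes> X
  \<rightarrow> V\<close> correspond to arrows \<open>A \<rightarrow> V \<otimes> X\<^sup>*\<close>. For \<open>V =
  1\<close> this is the mate up to a unit isomorphism.\<close>

definition rtr :: "'o \<Rightarrow> 'o \<Rightarrow> 'a \<Rightarrow> 'a" where
  "rtr A X f = (f \<boxtimes> Idt C (Dul C X)) \<cdot> cinv C (Asc C A X (Dul C X)) \<cdot> (Idt C A \<boxtimes> Cv C X) \<cdot> cinv C (Run C A)"

definition urtr :: "'o \<Rightarrow> 'o \<Rightarrow> 'a \<Rightarrow> 'a" where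
  "urtr V X h = Run C V \<cdot> (Idt C V \<boxtimes> Ev C X) \<cdot> Asc C V (Dul C X) X \<cdot> (h \<boxtimes> Idt C X)"

lemma rtr_arr [simp]:
  assumes "A \<in> Obj C" "X \<in> Obj C" "f \<in> Arr C" "Dom C f = A \<otimes> X"
  shows "rtr A X f \<in> Arr C" "Dom C (rtr A X f) = A" "Cod C (rtr A X f) = Cod C f \<otimes> Dul C X"
  using assms by (auto simp: rtr_def)

lemma urtr_arr [simp]:
  assumes "V \<in> Obj C" "X \<in> Obj C" "h \<in> Arr C" "Cod C h = V \<otimes> Dul C X"
  shows "urtr V X h \<in> Arr C" "Dom C (urtr V X h) = Dom C h \<otimes> X" "Cod C (urtr V X h) = V"
  using assms by (auto simp: urtr_def)

end

context action
begin

lemma rtr_act: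
  assumes [simp]: "A \<in> Obj C" "X \<in> Obj C" "f \<in> Arr C" "Dom C f = A \<otimes> X" "Cod C f = V" "N \<in> Obj M"
  shows "mas V (Dul C X) N \<bullet> (C.rtr A X f \<star> Idt M N)
    = (f \<star> Idt M (Dul C X \<odot> N)) \<bullet> cinv M (mas A X (Dul C X \<odot> N)) \<bullet> (Idt C A \<star> cvA X N)"
proof -
  have [simp]: "V \<in> Obj C" using C.cod_obj[of f] by simp
  show ?thesis
  by (simp add: C.rtr_def mas_nat_1[THEN M.reassoc] pentagon_3[THEN M.reassoc]
      mas_nat_2[THEN M.reassoc] triangle_cinv copair_def)
qed

lemma urtr_act:
  assumes [simp]: "V \<in> Obj C" "X \<in> Obj C" "h \<in> Arr C" "Cod C h = V \<otimes> Dul C X" "N \<in> Obj M"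
  shows "C.urtr V X h \<star> Idt M N
    = (Idt C V \<star> evA X N) \<bullet> mas V (Dul C X) (X \<odot> N) \<bullet> (h \<star> Idt M (X \<odot> N)) \<bullet> mas (Dom C h) X N"
proof -
  have p: "mas V (Dul C X \<otimes> X) N \<bullet> (Asc C V (Dul C X) X \<star> Idt M N)
    = (Idt C V \<star> cinv M (mas (Dul C X) X N)) \<bullet> mas V (Dul C X) (X \<odot> N) \<bullet> mas (V \<otimes> Dul C X) X N"
    by (simp add: pentagon_1[THEN M.reassoc])
  show ?thesis
    by (simp add: C.urtr_def flip: mod_triangle)
      (simp add: mas_nat_2[THEN M.reassoc] p[THEN M.reassoc] mas_nat_1 pair_def)
qed

end

context tensor_category
begin

text \<open>On the regular module this is a zigzag identity applied under \<open>V \<otimes> -\<close>; the same holds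
  for the opposite composite.\<close>

lemma rtr_urtr:
  assumes [simp]: "V \<in> Obj C" "X \<in> Obj C" "h \<in> Arr C" "Cod C h = V \<otimes> Dul C X" "Dom C h = A"
  shows "rtr A X (urtr V X h) = h"
proof (rule run_faithful)
  have [simp]: "A \<in> Obj C" using dom_obj[of h] by simp
  let ?I = "Unt C"
  have "Asc C V (Dul C X) ?I \<cdot> (rtr A X (urtr V X h) \<boxtimes> Idt C ?I) = Asc C V (Dul C X) ?I \<cdot> (h \<boxtimes> Idt C ?I)"
    by (simp add: C.rtr_act C.urtr_act C.interchange[THEN reassoc] C.interchange C.mas_nat_3[THEN reassoc])
      (simp add: C.lact_cmp[symmetric, THEN reassoc] del: C.lact_cmp)
  then show "rtr A X (urtr V X h) \<boxtimes> Idt C ?I = h \<boxtimes> Idt C ?I"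
    by (rule iso_cancel_left[rotated]) auto
qed (use dom_obj[of h] in auto)

lemma urtr_rtr:
  assumes [simp]: "A \<in> Obj C" "X \<in> Obj C" "f \<in> Arr C" "Dom C f = A \<otimes> X" "Cod C f = V"
  shows "urtr V X (rtr A X f) = f"
proof (rule run_faithful)
  have [simp]: "V \<in> Obj C" using cod_obj[of f] by simp
  let ?I = "Unt C"
  show "urtr V X (rtr A X f) \<boxtimes> Idt C ?I = f \<boxtimes> Idt C ?I"
    by (simp add: C.urtr_act C.rtr_act[THEN reassoc] C.interchange_r[THEN reassoc] C.cmas_nat_3[THEN reassoc])
      (simp add: C.lact_cmp[symmetric, THEN reassoc] del: C.lact_cmp)
qed (use cod_obj[of f] in auto)

end

context tensor_category
begin

lemma lmate_rtr: "lmate C A X f = Lun C (Dul C X) \<cdot> rtr A X f"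
  by (simp add: lmate_def rtr_def)

lemma lmate_arr [simp]:
  assumes "A \<in> Obj C" "X \<in> Obj C" "f \<in> Arr C" "Dom C f = A \<otimes> X" "Cod C f = Unt C"
  shows "lmate C A X f \<in> Arr C" "Dom C (lmate C A X f) = A" "Cod C (lmate C A X f) = Dul C X"
  using assms by (auto simp: lmate_rtr)

lemma Ev_urtr:
  assumes [simp]: "X \<in> Obj C" "h \<in> Arr C" "Cod C h = Unt C \<otimes> Dul C X"
  shows "Ev C X \<cdot> ((Lun C (Dul C X) \<cdot> h) \<boxtimes> Idt C X) = urtr (Unt C) X h"
  by (simp flip: C.mun_mas) (simp add: C.mun_nat_r[THEN reassoc] urtr_def lun_unt)

lemma Ev_lmate:
  assumes [simp]: "A \<in> Obj C" "X \<in> Obj C" "f \<in> Arr C" "Dom C f = A \<otimes> X" "Cod C f = Unt C"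
  shows "Ev C X \<cdot> (lmate C A X f \<boxtimes> Idt C X) = f"
  using Ev_urtr[of X "rtr A X f"] by (simp add: lmate_rtr urtr_rtr)

lemma lmate_Ev:
  assumes [simp]: "X \<in> Obj C" "g \<in> Arr C" "Cod C g = Dul C X"
  shows "lmate C (Dom C g) X (Ev C X \<cdot> (g \<boxtimes> Idt C X)) = g"
  using Ev_urtr[of X "cinv C (Lun C (Dul C X)) \<cdot> g"]
  by (simp add: lmate_rtr rtr_urtr del: C.ract_cmp)

text \<open>Arrows into a dual are determined by their evaluation. This reduces identities between canonical morphisms
  of duals to identities between pairings.\<close>

lemma Ev_ext:
  assumes "Ev C X \<cdot> (g \<boxtimes> Idt C X) = Ev C X \<cdot> (h \<boxtimes> Idt C X)"
    and "X \<in> Obj C" "g \<in> Arr C" "Cod C g = Dul C X" "h \<in> Arr C" "Cod C h = Dul C X" "Dom C g = Dom C h"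
  shows "g = h"
  using lmate_Ev[of X g] lmate_Ev[of X h] assms by metis

lemma dual_map_arr [simp]:
  assumes "f \<in> Arr C"
  shows "dual_map C f \<in> Arr C" "Dom C (dual_map C f) = Dul C (Cod C f)" "Cod C (dual_map C f) = Dul C (Dom C f)"
  using assms by (auto simp: dual_map_def)

lemma Ev_dual_map:
  assumes [simp]: "f \<in> Arr C" "Dom C f = X"
  shows "Ev C X \<cdot> (dual_map C f \<boxtimes> Idt C X) = Ev C (Cod C f) \<cdot> (Idt C (Dul C (Cod C f)) \<boxtimes> f)"
proof -
  have [simp]: "X \<in> Obj C" using dom_obj[of f] by simp
  show ?thesis by (simp add: dual_map_def Ev_lmate)
qed

lemma dual_map_idt [simp]: "X \<in> Obj C \<Longrightarrow> dual_map C (Idt C X) = Idt C (Dul C X)"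
  by (rule Ev_ext[of X]) (auto simp: Ev_dual_map)

lemma dual_map_cmp:
  assumes [simp]: "g \<in> Arr C" "f \<in> Arr C" "Cod C f = Dom C g"
  shows "dual_map C (g \<cdot> f) = dual_map C f \<cdot> dual_map C g"
  by (rule Ev_ext[of "Dom C f"])
    (auto simp: Ev_dual_map Ev_dual_map[THEN reassoc] C.interchange_r)

lemma dual_map_iso [simp]: "iso_arrow C f \<Longrightarrow> iso_arrow C (dual_map C f)"
  and cinv_dual_map: "iso_arrow C f \<Longrightarrow> cinv C (dual_map C f) = dual_map C (cinv C f)"
proof -
  assume a: "iso_arrow C f"
  have "inverse_arrows C (dual_map C f) (dual_map C (cinv C f))"
    using a by (intro inverse_arrowsI) (auto simp: iso_arr simp flip: dual_map_cmp)
  then show "iso_arrow C (dual_map C f)" "cinv C (dual_map C f) = dual_map C (cinv C f)"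
    by (auto simp: iso_arrow_def cinv_eq)
qed

text \<open>A pairing that belongs to a duality identifies \<open>D\<close> with the dual of \<open>X\<close>; the
  inverse comes from the copairing. The copairing is given here by its action \<open>k\<close> on the regular module,
  which for a tensor product is much simpler than the arrow \<open>1 \<rightarrow> X \<otimes> D\<close>
  itself.\<close>

lemma lmate_iso:
  assumes [simp]: "D \<in> Obj C" "X \<in> Obj C" "p \<in> Arr C" "Dom C p = D \<otimes> X" "Cod C p = Unt C"
    and k [simp]: "\<And>N. N \<in> Obj C \<Longrightarrow> k N \<in> Arr C" "\<And>N. N \<in> Obj C \<Longrightarrow> Dom C (k N) = N"
      "\<And>N. N \<in> Obj C \<Longrightarrow> Cod C (k N) = X \<otimes> (D \<otimes> N)"
    and nat: "\<And>u. u \<in> Arr C \<Longrightarrow>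
      (Idt C X \<boxtimes> (Idt C D \<boxtimes> u)) \<cdot> k (Dom C u) = k (Cod C u) \<cdot> u"
    and z1: "\<And>N. N \<in> Obj C \<Longrightarrow> (Idt C X \<boxtimes> C.pair D X p N) \<cdot> k (X \<otimes> N) = Idt C (X \<otimes> N)"
    and z2: "\<And>N. N \<in> Obj C \<Longrightarrow> C.pair D X p (D \<otimes> N) \<cdot> (Idt C D \<boxtimes> k N) = Idt C (D \<otimes> N)"
  shows "iso_arrow C (lmate C D X p)"
proof -
  let ?I = "Unt C" and ?q = "lmate C D X p" and ?X = "Dul C X"
  have e: "C.evA X N \<cdot> (?q \<boxtimes> Idt C (X \<otimes> N)) = C.pair D X p N" if [simp]: "N \<in> Obj C" for N
    by (simp add: C.pair_ract Ev_lmate)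
  let ?h = "C.evA X (D \<otimes> ?I) \<cdot> (Idt C ?X \<boxtimes> k ?I)"
  have q: "?q \<boxtimes> Idt C ?I = C.pair D X p (?X \<otimes> ?I) \<cdot> (Idt C D \<boxtimes> C.cvA X ?I)"
  proof -
    have "?q \<boxtimes> Idt C ?I = C.evA X (?X \<otimes> ?I) \<cdot> (Idt C ?X \<boxtimes> C.cvA X ?I) \<cdot> (?q \<boxtimes> Idt C ?I)"
      by simp
    also have "\<dots> = C.evA X (?X \<otimes> ?I) \<cdot> (?q \<boxtimes> Idt C (X \<otimes> (?X \<otimes> ?I))) \<cdot> (Idt C D \<boxtimes> C.cvA X ?I)"
      by (simp add: C.interchange)
    also have "\<dots> = C.pair D X p (?X \<otimes> ?I) \<cdot> (Idt C D \<boxtimes> C.cvA X ?I)"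
      by (simp add: e[THEN reassoc])
    finally show ?thesis .
  qed
  have "?h \<cdot> (?q \<boxtimes> Idt C ?I) = C.evA X (D \<otimes> ?I) \<cdot> (?q \<boxtimes> Idt C (X \<otimes> (D \<otimes> ?I))) \<cdot> (Idt C D \<boxtimes> k ?I)"
    by (simp add: C.interchange)
  also have "\<dots> = Idt C (D \<otimes> ?I)"
    by (simp add: e[THEN reassoc] z2)
  finally have 1: "?h \<cdot> (?q \<boxtimes> Idt C ?I) = Idt C (D \<otimes> ?I)" .
  have "(?q \<boxtimes> Idt C ?I) \<cdot> ?h = C.evA X (?X \<otimes> ?I) \<cdot> (Idt C ?X \<boxtimes> ((Idt C X \<boxtimes> (?q \<boxtimes> Idt C ?I)) \<cdot> k ?I))"
    by (simp add: C.pair_nat_r[THEN reassoc])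
  also have "(Idt C X \<boxtimes> (?q \<boxtimes> Idt C ?I)) \<cdot> k ?I
    = (Idt C X \<boxtimes> C.pair D X p (?X \<otimes> ?I)) \<cdot> (Idt C X \<boxtimes> (Idt C D \<boxtimes> C.cvA X ?I)) \<cdot> k ?I"
    by (simp add: q)
  also have "\<dots> = C.cvA X ?I"
    using nat[of "C.cvA X ?I"] by (simp add: z1[THEN reassoc])
  finally have 2: "(?q \<boxtimes> Idt C ?I) \<cdot> ?h = Idt C (?X \<otimes> ?I)" by simp
  have i: "iso_arrow C (?q \<boxtimes> Idt C ?I)"
    using 1 2 by (intro isoI[of _ ?h]) simp_all
  have "iso_arrow C (Run C ?X \<cdot> (?q \<boxtimes> Idt C ?I) \<cdot> cinv C (Run C D))"
    using i by simp
  then show ?thesis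
    by (simp add: run_nat'[THEN reassoc])
qed

end

context action
begin

lemma evA_lmate:
  assumes [simp]: "A \<in> Obj C" "X \<in> Obj C" "f \<in> Arr C" "Dom C f = A \<otimes> X" "Cod C f = Unt C" "N \<in> Obj M"
  shows "evA X N \<bullet> (lmate C A X f \<star> Idt M (X \<odot> N)) = pair A X f N"
  by (simp add: pair_ract C.Ev_lmate)

lemma evA_dual_map:
  assumes [simp]: "f \<in> Arr C" "Dom C f = X" "N \<in> Obj M"
  shows "evA X N \<bullet> (dual_map C f \<star> Idt M (X \<odot> N)) = evA (Cod C f) N \<bullet> (Idt C (Dul C (Cod C f)) \<star> (f \<star> Idt M N))"
proof -
  have [simp]: "X \<in> Obj C" using C.dom_obj[of f] by simp
  show ?thesis by (simp add: pair_ract pair_lact C.Ev_dual_map)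
qed

end

subsection \<open>The dual of a tensor product\<close>

context tensor_category
begin

text \<open>The nested evaluation whose mate is \<open>dual_ten\<close>.\<close>

definition ten_pairing :: "'o \<Rightarrow> 'o \<Rightarrow> 'a" where
  "ten_pairing X Y = Ev C Y \<cdot> (Idt C (Dul C Y) \<boxtimes> C.evA X Y) \<cdot> Asc C (Dul C Y) (Dul C X) (X \<otimes> Y)"

lemma ten_pairing_arr [simp]:
  assumes "X \<in> Obj C" "Y \<in> Obj C"
  shows "ten_pairing X Y \<in> Arr C" "Dom C (ten_pairing X Y) = (Dul C Y \<otimes> Dul C X) \<otimes> (X \<otimes> Y)"
    "Cod C (ten_pairing X Y) = Unt C"
  using assms by (auto simp: ten_pairing_def)

lemma dual_ten_lmate:
  assumes "X \<in> Obj C" "Y \<in> Obj C"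
  shows "dual_ten C X Y = lmate C (Dul C Y \<otimes> Dul C X) (X \<otimes> Y) (ten_pairing X Y)"
  using assms by (simp add: dual_ten_def ten_pairing_def C.pair_def)

lemma dual_ten_arr [simp]:
  assumes "X \<in> Obj C" "Y \<in> Obj C"
  shows "dual_ten C X Y \<in> Arr C" "Dom C (dual_ten C X Y) = Dul C Y \<otimes> Dul C X"
    "Cod C (dual_ten C X Y) = Dul C (X \<otimes> Y)"
  using assms by (auto simp: dual_ten_lmate)

lemma Ev_dual_ten:
  assumes "X \<in> Obj C" "Y \<in> Obj C"
  shows "Ev C (X \<otimes> Y) \<cdot> (dual_ten C X Y \<boxtimes> Idt C (X \<otimes> Y))
    = Ev C Y \<cdot> (Idt C (Dul C Y) \<boxtimes> C.evA X Y) \<cdot> Asc C (Dul C Y) (Dul C X) (X \<otimes> Y)"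
  using assms by (simp add: dual_ten_lmate Ev_lmate) (simp add: ten_pairing_def)

end

context action
begin

text \<open>As an action, the pairing evaluates \<open>X\<close> inside and then \<open>Y\<close>; all of the
  associativity is collected by the pentagon.\<close>

lemma pair_ten_pairing:
  assumes [simp]: "X \<in> Obj C" "Y \<in> Obj C" "N \<in> Obj M"
  shows "pair (Dul C Y \<otimes> Dul C X) (X \<otimes> Y) (C.ten_pairing X Y) N
    = evA Y N \<bullet> (Idt C (Dul C Y) \<star> evA X (Y \<odot> N)) \<bullet> mas (Dul C Y) (Dul C X) (X \<odot> (Y \<odot> N))
      \<bullet> (Idt C (Dul C Y \<otimes> Dul C X) \<star> mas X Y N)"
proof -
  let ?X = "Dul C X" and ?Y = "Dul C Y"
  have "pair (?Y \<otimes> ?X) (X \<otimes> Y) (C.ten_pairing X Y) N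
    = evA Y N \<bullet> mas ?Y Y N \<bullet> ((Idt C ?Y \<boxtimes> C.C.evA X Y) \<star> Idt M N) \<bullet> (Asc C ?Y ?X (X \<otimes> Y) \<star> Idt M N)
        \<bullet> cinv M (mas (?Y \<otimes> ?X) (X \<otimes> Y) N)"
    by (simp add: pair_def[of "?Y \<otimes> ?X"] C.ten_pairing_def pair_mas[where D = "Dul C Y" and X = Y, THEN M.reassoc])
  also have "\<dots> = evA Y N \<bullet> (Idt C ?Y \<star> (C.C.evA X Y \<star> Idt M N)) \<bullet> mas ?Y (?X \<otimes> (X \<otimes> Y)) N
      \<bullet> (Asc C ?Y ?X (X \<otimes> Y) \<star> Idt M N) \<bullet> cinv M (mas (?Y \<otimes> ?X) (X \<otimes> Y) N)"
    by (simp add: mas_nat_2[THEN M.reassoc])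
  also have "\<dots> = evA Y N \<bullet> (Idt C ?Y \<star> evA X (Y \<odot> N)) \<bullet> (Idt C ?Y \<star> (Idt C ?X \<star> mas X Y N))
      \<bullet> (Idt C ?Y \<star> mas ?X (X \<otimes> Y) N) \<bullet> mas ?Y (?X \<otimes> (X \<otimes> Y)) N
      \<bullet> (Asc C ?Y ?X (X \<otimes> Y) \<star> Idt M N) \<bullet> cinv M (mas (?Y \<otimes> ?X) (X \<otimes> Y) N)"
    by (simp add: pair_ten)
  also have "\<dots> = evA Y N \<bullet> (Idt C ?Y \<star> evA X (Y \<odot> N)) \<bullet> (Idt C ?Y \<star> (Idt C ?X \<star> mas X Y N))
      \<bullet> mas ?Y ?X ((X \<otimes> Y) \<odot> N)"
    by (simp add: mod_pentagon[symmetric, THEN M.reassoc3])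
  also have "\<dots> = evA Y N \<bullet> (Idt C ?Y \<star> evA X (Y \<odot> N)) \<bullet> mas ?Y ?X (X \<odot> (Y \<odot> N))
      \<bullet> (Idt C (?Y \<otimes> ?X) \<star> mas X Y N)"
    by (simp add: mas_nat_3)
  finally show ?thesis .
qed

lemma evA_dual_ten:
  assumes [simp]: "X \<in> Obj C" "Y \<in> Obj C" "N \<in> Obj M"
  shows "evA (X \<otimes> Y) N \<bullet> (dual_ten C X Y \<star> Idt M ((X \<otimes> Y) \<odot> N))
    = evA Y N \<bullet> (Idt C (Dul C Y) \<star> evA X (Y \<odot> N)) \<bullet> mas (Dul C Y) (Dul C X) (X \<odot> (Y \<odot> N))
      \<bullet> (Idt C (Dul C Y \<otimes> Dul C X) \<star> mas X Y N)"
  by (simp add: C.dual_ten_lmate evA_lmate pair_ten_pairing)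

end

context tensor_category
begin

lemma dual_ten_iso [simp]:
  assumes [simp]: "X \<in> Obj C" "Y \<in> Obj C"
  shows "iso_arrow C (dual_ten C X Y)"
proof -
  let ?X = "Dul C X" and ?Y = "Dul C Y"
  let ?k = "\<lambda>N. cinv C (Asc C X Y ((?Y \<otimes> ?X) \<otimes> N)) \<cdot> (Idt C X \<boxtimes> (Idt C Y \<boxtimes> cinv C (Asc C ?Y ?X N)))
      \<cdot> (Idt C X \<boxtimes> C.cvA Y (?X \<otimes> N)) \<cdot> C.cvA X N"
  have "iso_arrow C (lmate C (?Y \<otimes> ?X) (X \<otimes> Y) (ten_pairing X Y))"
  proof (rule lmate_iso[where k = ?k], goal_cases)
    case (9 u)
    then have [simp]: "u \<in> Arr C" by simp
    have "(Idt C (X \<otimes> Y) \<boxtimes> (Idt C (?Y \<otimes> ?X) \<boxtimes> u)) \<cdot> ?k (Dom C u)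
      = cinv C (Asc C X Y ((?Y \<otimes> ?X) \<otimes> Cod C u)) \<cdot> (Idt C X \<boxtimes> (Idt C Y \<boxtimes> ((Idt C (?Y \<otimes> ?X) \<boxtimes> u) \<cdot> cinv C (Asc C ?Y ?X (Dom C u)))))
      \<cdot> (Idt C X \<boxtimes> C.cvA Y (?X \<otimes> Dom C u)) \<cdot> C.cvA X (Dom C u)"
      by (simp add: C.cmas_nat_3[THEN reassoc])
    also have "(Idt C (?Y \<otimes> ?X) \<boxtimes> u) \<cdot> cinv C (Asc C ?Y ?X (Dom C u))
       = cinv C (Asc C ?Y ?X (Cod C u)) \<cdot> (Idt C ?Y \<boxtimes> (Idt C ?X \<boxtimes> u))"
      by (simp add: C.cmas_nat_3)
    also have "cinv C (Asc C X Y ((?Y \<otimes> ?X) \<otimes> Cod C u)) \<cdot> (Idt C X \<boxtimes> (Idt C Y \<boxtimes> \<dots>))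
      \<cdot> (Idt C X \<boxtimes> C.cvA Y (?X \<otimes> Dom C u)) \<cdot> C.cvA X (Dom C u)
     = cinv C (Asc C X Y ((?Y \<otimes> ?X) \<otimes> Cod C u)) \<cdot> (Idt C X \<boxtimes> (Idt C Y \<boxtimes> cinv C (Asc C ?Y ?X (Cod C u))))
      \<cdot> (Idt C X \<boxtimes> ((Idt C Y \<boxtimes> (Idt C ?Y \<boxtimes> (Idt C ?X \<boxtimes> u))) \<cdot> C.cvA Y (?X \<otimes> Dom C u))) \<cdot> C.cvA X (Dom C u)"
      by simp
    also have "(Idt C Y \<boxtimes> (Idt C ?Y \<boxtimes> (Idt C ?X \<boxtimes> u))) \<cdot> C.cvA Y (?X \<otimes> Dom C u) = C.cvA Y (?X \<otimes> Cod C u) \<cdot> (Idt C ?X \<boxtimes> u)"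
      by (simp add: C.copair_nat)
    finally show ?case by (simp add: C.copair_nat)
  next
    case (10 N)
    then have [simp]: "N \<in> Obj C" by simp
    show ?case
      by (simp add: C.pair_ten_pairing C.cmas_nat_3 C.cmas_nat_3[THEN reassoc]
          C.cmas_nat_3[THEN C.lact_lift, THEN C.lact_lift, THEN reassoc]
          C.copair_nat[THEN C.lact_lift, THEN reassoc] C.copair_nat
          C.zz_1(1)[THEN C.lact_lift, THEN reassoc] C.lact_cinv(1)[THEN C.lact_lift, THEN reassoc])
  next
    case (11 N)
    then have [simp]: "N \<in> Obj C" by simp
    show ?case
      by (simp add: C.pair_ten_pairing C.mas_nat_3 C.mas_nat_3[THEN reassoc]
          C.pair_nat[THEN C.lact_lift, THEN reassoc] C.pair_nat C.pair_nat[THEN reassoc]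
          C.zz_2(1)[THEN C.lact_lift, THEN reassoc] C.lact_cinv(1)[THEN C.lact_lift, THEN reassoc])
  qed auto
  then show ?thesis by (simp add: dual_ten_lmate)
qed

lemma dual_unt_arr [simp]:
  "dual_unt C \<in> Arr C" "Dom C (dual_unt C) = Unt C" "Cod C (dual_unt C) = Dul C (Unt C)"
  by (auto simp: dual_unt_def)

lemma Ev_dual_unt: "Ev C (Unt C) \<cdot> (dual_unt C \<boxtimes> Idt C (Unt C)) = Lun C (Unt C)"
  by (simp add: dual_unt_def Ev_lmate)

end

context action
begin

lemma pair_lun:
  assumes [simp]: "N \<in> Obj M"
  shows "pair (Unt C) (Unt C) (Lun C (Unt C)) N = mun N \<bullet> mun (Unt C \<odot> N)"
  by (simp add: pair_def flip: mun_mas)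

lemma evA_dual_unt:
  assumes [simp]: "N \<in> Obj M"
  shows "evA (Unt C) N \<bullet> (dual_unt C \<star> Idt M (Unt C \<odot> N)) = mun N \<bullet> mun (Unt C \<odot> N)"
  by (simp add: dual_unt_def evA_lmate pair_lun)

end

context tensor_category
begin

lemma dual_unt_iso [simp]: "iso_arrow C (dual_unt C)"
proof -
  let ?I = "Unt C"
  let ?k = "\<lambda>N. cinv C (Lun C (?I \<otimes> N)) \<cdot> cinv C (Lun C N)"
  show ?thesis
    unfolding dual_unt_def
    by (rule lmate_iso[where k = ?k])
      (auto simp: C.pair_lun C.cmun_nat C.cmun_nat[THEN reassoc] C.mun_nat C.mun_nat[THEN reassoc])
qed

lemma dual_rdual_arr [simp]:
  assumes "X \<in> Obj C"
  shows "dual_rdual C X \<in> Arr C" "Dom C (dual_rdual C X) = X" "Cod C (dual_rdual C X) = Dul C (Dur C X)"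
  using assms by (auto simp: dual_rdual_def)

lemma Ev_dual_rdual: "X \<in> Obj C \<Longrightarrow> Ev C (Dur C X) \<cdot> (dual_rdual C X \<boxtimes> Idt C (Dur C X)) = Evr C X"
  by (simp add: dual_rdual_def Ev_lmate)

lemma dual_rdual_iso [simp]:
  assumes [simp]: "X \<in> Obj C"
  shows "iso_arrow C (dual_rdual C X)"
  unfolding dual_rdual_def
  by (rule lmate_iso[where k = "C.copair (Dur C X) X (Cvr C X)"])
    (auto simp: C.copair_nat C.zigzag_1[OF right_dual] C.zigzag_2[OF right_dual])

lemma ddual_ten_arr [simp]:
  assumes "X \<in> Obj C" "Y \<in> Obj C"
  shows "ddual_ten C X Y \<in> Arr C" "Dom C (ddual_ten C X Y) = Dul C (Dul C (X \<otimes> Y))"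
    "Cod C (ddual_ten C X Y) = Dul C (Dul C X) \<otimes> Dul C (Dul C Y)"
  using assms by (auto simp: ddual_ten_def)

lemma ddual_unt_arr [simp]:
  "ddual_unt C \<in> Arr C" "Dom C (ddual_unt C) = Dul C (Dul C (Unt C))" "Cod C (ddual_unt C) = Unt C"
  by (auto simp: ddual_unt_def)

end

context tensor_category
begin

lemma rtr_nat:
  assumes [simp]: "A \<in> Obj C" "X \<in> Obj C" "f \<in> Arr C" "Dom C f = A \<otimes> X" "g \<in> Arr C" "Cod C g = A"
  shows "rtr A X f \<cdot> g = rtr (Dom C g) X (f \<cdot> (g \<boxtimes> Idt C X))"
proof -
  have "cinv C (Run C A) \<cdot> g = (g \<boxtimes> Idt C (Unt C)) \<cdot> cinv C (Run C (Dom C g))"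
    by (rule inverse_square[symmetric]) (auto simp: run_nat')
  then show ?thesis
    by (simp add: rtr_def C.interchange_r[THEN reassoc] C.cmas_nat_1r[THEN reassoc])
qed

end

section \<open>Internal Homs\<close>

locale ihom_action = action C M "ActO M" "ActA M" "MAs M" "MUn M"
  for C :: "('o, 'a, 'k::field, 'z) tcat_scheme" (structure)
    and M :: "('p, 'b, 'k, 'o, 'a, 'y) lmod_scheme" +
  fixes H :: "('p, 'b, 'o, 'a) ihom"
  assumes ih: "internal_hom C M H"
begin

abbreviation act_obj_op (infixr "\<odot>" 75) where "X \<odot> N \<equiv> ActO M X N"
abbreviation act_arr_op (infixr "\<star>" 75) where "f \<star> u \<equiv> ActA M f u"
abbreviation "Ih \<equiv> IhO H"
abbreviation "iev \<equiv> ih_ev C M H"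
abbreviation "hm \<equiv> ih_map C M H"
abbreviation "out \<equiv> ih_out C M H"
abbreviation "inn \<equiv> ih_in C M H"
abbreviation "mas \<equiv> MAs M"
abbreviation "mun \<equiv> MUn M"

lemma Ih_obj [simp]: "A \<in> Obj M \<Longrightarrow> B \<in> Obj M \<Longrightarrow> Ih A B \<in> Obj C"
  using ih by (auto simp: internal_hom_def)

lemma IhT_bij:
  "A \<in> Obj M \<Longrightarrow> B \<in> Obj M \<Longrightarrow> X \<in> Obj C
    \<Longrightarrow> bij_betw (IhT H X A B) (hom M (X \<odot> A) B) (hom C X (Ih A B))"
  using ih by (auto simp: internal_hom_def)

lemma IhT_nat:
  "A \<in> Obj M \<Longrightarrow> B \<in> Obj M \<Longrightarrow> h \<in> Arr C \<Longrightarrow> f \<in> hom M (Cod C h \<odot> A) B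
    \<Longrightarrow> IhT H (Dom C h) A B (f \<bullet> (h \<star> Idt M A)) = IhT H (Cod C h) A B f \<cdot> h"
  using ih by (auto simp: internal_hom_def)

lemma IhT_arr [simp]:
  assumes "A \<in> Obj M" "B \<in> Obj M" "X \<in> Obj C" "f \<in> Arr M" "Dom M f = X \<odot> A" "Cod M f = B"
  shows "IhT H X A B f \<in> Arr C" "Dom C (IhT H X A B f) = X" "Cod C (IhT H X A B f) = Ih A B"
  using bij_betwE[OF IhT_bij[OF assms(1-3)]] assms(4-6) by (auto simp: hom_def)

lemma iev_hom:
  assumes "A \<in> Obj M" "B \<in> Obj M"
  shows "iev A B \<in> hom M (Ih A B \<odot> A) B" "IhT H (Ih A B) A B (iev A B) = Idt C (Ih A B)"
proof -
  have b: "Idt C (Ih A B) \<in> IhT H (Ih A B) A B ` hom M (Ih A B \<odot> A) B"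
    using IhT_bij[of A B "Ih A B"] assms by (simp add: bij_betw_def C.id_hom)
  show "iev A B \<in> hom M (Ih A B \<odot> A) B" "IhT H (Ih A B) A B (iev A B) = Idt C (Ih A B)"
    unfolding ih_ev_def using b by (rule inv_into_into, rule f_inv_into_f)
qed

lemma iev_arr [simp]:
  assumes "A \<in> Obj M" "B \<in> Obj M"
  shows "iev A B \<in> Arr M" "Dom M (iev A B) = Ih A B \<odot> A" "Cod M (iev A B) = B"
  using iev_hom[OF assms] by (auto simp: hom_def)

lemma IhT_iev:
  assumes [simp]: "A \<in> Obj M" "B \<in> Obj M" "h \<in> Arr C" "Cod C h = Ih A B"
  shows "IhT H (Dom C h) A B (iev A B \<bullet> (h \<star> Idt M A)) = h"
  using IhT_nat[of A B h "iev A B"] iev_hom[of A B] by simp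

lemma iev_IhT:
  assumes [simp]: "A \<in> Obj M" "B \<in> Obj M" "X \<in> Obj C" "f \<in> Arr M" "Dom M f = X \<odot> A" "Cod M f = B"
  shows "iev A B \<bullet> (IhT H X A B f \<star> Idt M A) = f"
proof (rule inj_onD)
  show "inj_on (IhT H X A B) (hom M (X \<odot> A) B)"
    using IhT_bij by (auto simp: bij_betw_def)
  show "IhT H X A B (iev A B \<bullet> (IhT H X A B f \<star> Idt M A)) = IhT H X A B f"
    using IhT_iev[of A B "IhT H X A B f"] by simp
qed (auto simp: hom_def)

text \<open>Arrows into an internal Hom are equal if their transposes are. The identities below between canonical
  arrows of internal Homs are all reduced to the action in this way.\<close>

lemma Ih_ext:
  assumes "iev A B \<bullet> (h \<star> Idt M A) = iev A B \<bullet> (h' \<star> Idt M A)"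
    and "A \<in> Obj M" "B \<in> Obj M" "h \<in> Arr C" "h' \<in> Arr C" "Cod C h = Ih A B" "Cod C h' = Ih A B" "Dom C h = Dom C h'"
  shows "h = h'"
  using IhT_iev[of A B h] IhT_iev[of A B h'] assms by metis

lemma hm_arr [simp]:
  assumes "f \<in> Arr M" "g \<in> Arr M"
  shows "hm f g \<in> Arr C" "Dom C (hm f g) = Ih (Cod M f) (Dom M g)" "Cod C (hm f g) = Ih (Dom M f) (Cod M g)"
  using assms by (auto simp: ih_map_def)

lemma iev_hm:
  assumes "f \<in> Arr M" "g \<in> Arr M" "Dom M f = A" "Cod M g = B"
  shows "iev A B \<bullet> (hm f g \<star> Idt M A) = g \<bullet> iev (Cod M f) (Dom M g) \<bullet> (Idt C (Ih (Cod M f) (Dom M g)) \<star> f)"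
  using assms by (auto simp: ih_map_def iev_IhT)

lemma iev_hmR:
  assumes "g \<in> Arr M" "Cod M g = B" "A \<in> Obj M"
  shows "iev A B \<bullet> (hm (Idt M A) g \<star> Idt M A) = g \<bullet> iev A (Dom M g)"
  using assms by (simp add: iev_hm)

lemma iev_hmL:
  assumes "f \<in> Arr M" "Dom M f = A" "B \<in> Obj M"
  shows "iev A B \<bullet> (hm f (Idt M B) \<star> Idt M A) = iev (Cod M f) B \<bullet> (Idt C (Ih (Cod M f) B) \<star> f)"
  using assms by (simp add: iev_hm)

lemma hm_idt [simp]: "A \<in> Obj M \<Longrightarrow> B \<in> Obj M \<Longrightarrow> hm (Idt M A) (Idt M B) = Idt C (Ih A B)"
  by (rule Ih_ext[of A B]) (auto simp: iev_hmR)

lemma hmR_cmp [simp]: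
  assumes [simp]: "A \<in> Obj M" "g' \<in> Arr M" "g \<in> Arr M" "Cod M g = Dom M g'"
  shows "hm (Idt M A) (g' \<bullet> g) = hm (Idt M A) g' \<cdot> hm (Idt M A) g"
  by (rule Ih_ext[of A "Cod M g'"]) (auto simp: iev_hmR iev_hmR[THEN M.reassoc])

lemma hmL_cmp [simp]:
  assumes [simp]: "B \<in> Obj M" "f \<in> Arr M" "f' \<in> Arr M" "Cod M f' = Dom M f"
  shows "hm (f \<bullet> f') (Idt M B) = hm f' (Idt M B) \<cdot> hm f (Idt M B)"
  by (rule Ih_ext[of "Dom M f'" B])
    (auto simp: iev_hmL iev_hmL[THEN M.reassoc] interchange_r)

lemma hm_split:
  assumes [simp]: "f \<in> Arr M" "g \<in> Arr M"
  shows "hm f g = hm f (Idt M (Cod M g)) \<cdot> hm (Idt M (Cod M f)) g"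
  by (rule Ih_ext[of "Dom M f" "Cod M g"])
    (auto simp: iev_hm iev_hmR iev_hmL[THEN M.reassoc] interchange_r iev_hmR[THEN M.reassoc])

lemma hm_swap:
  assumes "f \<in> Arr M" "g \<in> Arr M" "Cod M f = A" "Cod M g = B"
  shows "hm f (Idt M B) \<cdot> hm (Idt M A) g = hm (Idt M (Dom M f)) g \<cdot> hm f (Idt M (Dom M g))"
proof -
  have [simp]: "f \<in> Arr M" "g \<in> Arr M" "A \<in> Obj M" "B \<in> Obj M" "Cod M f = A" "Cod M g = B"
    using assms by auto
  show ?thesis
    by (rule Ih_ext[of "Dom M f" B])
      (auto simp: iev_hmL iev_hmR iev_hmL[THEN M.reassoc] interchange_r iev_hmR[THEN M.reassoc])
qed

lemma hmR_iso [simp]: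
  assumes [simp]: "A \<in> Obj M" "iso_arrow M g"
  shows "iso_arrow C (hm (Idt M A) g)" "cinv C (hm (Idt M A) g) = hm (Idt M A) (cinv M g)"
proof -
  have "inverse_arrows C (hm (Idt M A) g) (hm (Idt M A) (cinv M g))"
    by (intro C.inverse_arrowsI) (auto simp: M.iso_arr simp flip: hmR_cmp)
  then show "iso_arrow C (hm (Idt M A) g)" "cinv C (hm (Idt M A) g) = hm (Idt M A) (cinv M g)"
    by (auto simp: iso_arrow_def C.cinv_eq)
qed

subsection \<open>The internal Hom as a module functor of its second argument\<close>

context
  fixes X A B
  assumes [simp]: "X \<in> Obj C" "A \<in> Obj M" "B \<in> Obj M"
begin

lemma out_arr [simp]:
  "out X A B \<in> Arr C" "Dom C (out X A B) = X \<otimes> Ih A B" "Cod C (out X A B) = Ih A (X \<odot> B)"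
  by (auto simp: ih_out_def)

lemma iev_out:
  "iev A (X \<odot> B) \<bullet> (out X A B \<star> Idt M A) = (Idt C X \<star> iev A B) \<bullet> mas X (Ih A B) A"
  by (simp add: ih_out_def iev_IhT)

end

lemma out_nat_B:
  assumes [simp]: "X \<in> Obj C" "A \<in> Obj M" "u \<in> Arr M" "Dom M u = B"
  shows "hm (Idt M A) (Idt C X \<star> u) \<cdot> out X A B = out X A (Cod M u) \<cdot> (Idt C X \<boxtimes> hm (Idt M A) u)"
proof -
  have [simp]: "B \<in> Obj M" using M.dom_obj[of u] by simp
  show ?thesis
    by (rule Ih_ext[of A "X \<odot> Cod M u"])
      (auto simp: iev_hmR[THEN M.reassoc] iev_out iev_out[THEN M.reassoc] mas_nat_2
        iev_hmR[THEN lact_lift, THEN M.reassoc])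
qed

lemma out_nat_X:
  assumes [simp]: "f \<in> Arr C" "Dom C f = X" "A \<in> Obj M" "B \<in> Obj M"
  shows "hm (Idt M A) (f \<star> Idt M B) \<cdot> out X A B = out (Cod C f) A B \<cdot> (f \<boxtimes> Idt C (Ih A B))"
proof -
  have [simp]: "X \<in> Obj C" using C.dom_obj[of f] by simp
  show ?thesis
    by (rule Ih_ext[of A "Cod C f \<odot> B"])
      (auto simp: iev_hmR[THEN M.reassoc] iev_out iev_out[THEN M.reassoc] mas_nat_1 interchange[THEN M.reassoc])
qed

lemma out_nat_X_r:
  assumes "f \<in> Arr C" "Cod C f = X" "A \<in> Obj M" "B \<in> Obj M"
  shows "out X A B \<cdot> (f \<boxtimes> Idt C (Ih A B)) = hm (Idt M A) (f \<star> Idt M B) \<cdot> out (Dom C f) A B"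
  using out_nat_X[of f "Dom C f" A B] assms by simp

lemma out_nat_A:
  assumes [simp]: "f \<in> Arr M" "Cod M f = A" "X \<in> Obj C" "B \<in> Obj M"
  shows "hm f (Idt M (X \<odot> B)) \<cdot> out X A B = out X (Dom M f) B \<cdot> (Idt C X \<boxtimes> hm f (Idt M B))"
proof -
  have [simp]: "A \<in> Obj M" using M.cod_obj[of f] by simp
  show ?thesis
    by (rule Ih_ext[of "Dom M f" "X \<odot> B"])
      (auto simp: iev_hmL[THEN M.reassoc] iev_out iev_out[THEN M.reassoc] mas_nat_2 mas_nat_3 interchange_r
        iev_hmL[THEN lact_lift, THEN M.reassoc])
qed

lemma out_mas:
  assumes [simp]: "X \<in> Obj C" "Y \<in> Obj C" "A \<in> Obj M" "B \<in> Obj M"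
  shows "hm (Idt M A) (mas X Y B) \<cdot> out (X \<otimes> Y) A B
    = out X A (Y \<odot> B) \<cdot> (Idt C X \<boxtimes> out Y A B) \<cdot> Asc C X Y (Ih A B)"
  by (rule Ih_ext[of A "X \<odot> (Y \<odot> B)"])
    (auto simp: iev_hmR[THEN M.reassoc] iev_out iev_out[THEN M.reassoc] mas_nat_3[THEN M.reassoc]
      mod_pentagon mas_nat_2[THEN M.reassoc] iev_out[THEN lact_lift, THEN M.reassoc])

lemma out_mun:
  assumes [simp]: "A \<in> Obj M" "B \<in> Obj M"
  shows "hm (Idt M A) (mun B) \<cdot> out (Unt C) A B = Lun C (Ih A B)"
  by (rule Ih_ext[of A B])
    (auto simp: iev_hmR[THEN M.reassoc] iev_out mun_nat[THEN M.reassoc] mun_mas)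

text \<open>By \<open>out_mas\<close> and \<open>out_mun\<close>, \<open>Hom(A, -)\<close> is a lax module functor to
  the regular module, so it respects the action of a pairing.\<close>

lemma out_pair:
  assumes [simp]: "D \<in> Obj C" "X \<in> Obj C" "p \<in> Arr C" "Dom C p = D \<otimes> X" "Cod C p = Unt C"
    "A \<in> Obj M" "N \<in> Obj M"
  shows "hm (Idt M A) (pair D X p N) \<cdot> out D A (X \<odot> N) \<cdot> (Idt C D \<boxtimes> out X A N) = C.C.pair D X p (Ih A N)"
proof -
  have "out D A (X \<odot> N) \<cdot> (Idt C D \<boxtimes> out X A N)
    = hm (Idt M A) (mas D X N) \<cdot> out (D \<otimes> X) A N \<cdot> cinv C (Asc C D X (Ih A N))"
    by (simp add: out_mas[THEN C.reassoc])
  then have "hm (Idt M A) (pair D X p N) \<cdot> out D A (X \<odot> N) \<cdot> (Idt C D \<boxtimes> out X A N)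
    = hm (Idt M A) (mun N) \<cdot> hm (Idt M A) (p \<star> Idt M N) \<cdot> (hm (Idt M A) (cinv M (mas D X N)) \<cdot> hm (Idt M A) (mas D X N))
      \<cdot> out (D \<otimes> X) A N \<cdot> cinv C (Asc C D X (Ih A N))"
    by (simp add: pair_def)
  also have "hm (Idt M A) (cinv M (mas D X N)) \<cdot> hm (Idt M A) (mas D X N) = Idt C (Ih A ((D \<otimes> X) \<odot> N))"
    by (simp flip: hmR_cmp)
  also have "hm (Idt M A) (mun N) \<cdot> hm (Idt M A) (p \<star> Idt M N) \<cdot> \<dots> \<cdot> out (D \<otimes> X) A N \<cdot> cinv C (Asc C D X (Ih A N))
    = C.C.pair D X p (Ih A N)"
    by (simp add: out_nat_X[THEN C.reassoc] out_mun[THEN C.reassoc] C.C.pair_def)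
  finally show ?thesis .
qed

lemma out_copair:
  assumes [simp]: "D \<in> Obj C" "X \<in> Obj C" "c \<in> Arr C" "Cod C c = X \<otimes> D" "Dom C c = Unt C"
    "A \<in> Obj M" "N \<in> Obj M"
  shows "out X A (D \<odot> N) \<cdot> (Idt C X \<boxtimes> out D A N) \<cdot> C.C.copair X D c (Ih A N) = hm (Idt M A) (copair X D c N)"
proof -
  have m: "out (Unt C) A N \<cdot> cinv C (Lun C (Ih A N)) = hm (Idt M A) (cinv M (mun N))"
    by (rule C.iso_cancel_left[of "hm (Idt M A) (mun N)"]) (auto simp: out_mun[THEN C.reassoc] simp flip: hmR_cmp)
  show ?thesis
    by (simp add: C.C.copair_def out_mas[symmetric, THEN C.reassoc3] out_nat_X_r[THEN C.reassoc] m copair_def)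
qed

text \<open>A lax module functor over a rigid category is strong: the inverse takes \<open>Hom(A, X \<odot> B)\<close>
  to \<open>X \<otimes> (X\<^sup>* \<otimes> Hom(A, X \<odot> B))\<close>, moves \<open>X\<^sup>*\<close> into the
  internal Hom and evaluates there.\<close>

lemma out_iso [simp]:
  assumes [simp]: "X \<in> Obj C" "A \<in> Obj M" "B \<in> Obj M"
  shows "iso_arrow C (out X A B)"
proof (rule C.isoI)
  let ?X = "Dul C X"
  let ?h = "(Idt C X \<boxtimes> (hm (Idt M A) (evA X B) \<cdot> out ?X A (X \<odot> B))) \<cdot> C.C.cvA X (Ih A (X \<odot> B))"
  show "?h \<in> Arr C" "Dom C ?h = Cod C (out X A B)" "Cod C ?h = Dom C (out X A B)"
    by auto
  have "?h \<cdot> out X A B = (Idt C X \<boxtimes> (hm (Idt M A) (evA X B) \<cdot> out ?X A (X \<odot> B) \<cdot> (Idt C ?X \<boxtimes> out X A B)))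
    \<cdot> C.C.cvA X (X \<otimes> Ih A B)"
    by (simp add: C.C.copair_nat)
  also have "\<dots> = Idt C (X \<otimes> Ih A B)"
    by (simp add: out_pair del: C.C.lact_cmp)
  finally show "?h \<cdot> out X A B = Idt C (Dom C (out X A B))" by simp
  have "out X A B \<cdot> ?h = hm (Idt M A) (Idt C X \<star> evA X B) \<cdot> hm (Idt M A) (cvA X (X \<odot> B))"
    by (simp add: out_nat_B[THEN C.reassoc] flip: out_copair)
  also have "\<dots> = Idt C (Ih A (X \<odot> B))"
    by (simp flip: hmR_cmp)
  finally show "out X A B \<cdot> ?h = Idt C (Cod C (out X A B))" by simp
qed auto

subsection \<open>Actions on the first argument\<close>

context
  fixes X A B
  assumes [simp]: "X \<in> Obj C" "A \<in> Obj M" "B \<in> Obj M"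
begin

lemma inn_arr [simp]:
  "inn X A B \<in> Arr C" "Dom C (inn X A B) = Ih A B \<otimes> Dul C X" "Cod C (inn X A B) = Ih (X \<odot> A) B"
  by (auto simp: ih_in_def)

lemma iev_inn:
  "iev (X \<odot> A) B \<bullet> (inn X A B \<star> Idt M (X \<odot> A))
    = iev A B \<bullet> (Idt C (Ih A B) \<star> evA X A) \<bullet> mas (Ih A B) (Dul C X) (X \<odot> A)"
  by (simp add: ih_in_def iev_IhT pair_def)

end

lemma inn_nat_B:
  assumes [simp]: "X \<in> Obj C" "A \<in> Obj M" "u \<in> Arr M" "Dom M u = B"
  shows "hm (Idt M (X \<odot> A)) u \<cdot> inn X A B = inn X A (Cod M u) \<cdot> (hm (Idt M A) u \<boxtimes> Idt C (Dul C X))"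
proof -
  have [simp]: "B \<in> Obj M" using M.dom_obj[of u] by simp
  show ?thesis
    by (rule Ih_ext[of "X \<odot> A" "Cod M u"])
      (auto simp: iev_hmR[THEN M.reassoc] iev_inn iev_inn[THEN M.reassoc] mas_nat_1 interchange_r[THEN M.reassoc])
qed

lemma inn_nat_A:
  assumes [simp]: "X \<in> Obj C" "u \<in> Arr M" "Cod M u = A" "B \<in> Obj M"
  shows "hm (Idt C X \<star> u) (Idt M B) \<cdot> inn X A B = inn X (Dom M u) B \<cdot> (hm u (Idt M B) \<boxtimes> Idt C (Dul C X))"
proof -
  have [simp]: "A \<in> Obj M" using M.cod_obj[of u] by simp
  show ?thesis
    by (rule Ih_ext[of "X \<odot> Dom M u" B])
      (auto simp: iev_hmL[THEN M.reassoc] iev_inn iev_inn[THEN M.reassoc] mas_nat_1 mas_nat_3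
        interchange_r interchange_r[THEN M.reassoc] pair_nat[THEN lact_lift, THEN M.reassoc])
qed

lemma inn_nat_X:
  assumes [simp]: "f \<in> Arr C" "Cod C f = X" "A \<in> Obj M" "B \<in> Obj M"
  shows "hm (f \<star> Idt M A) (Idt M B) \<cdot> inn X A B = inn (Dom C f) A B \<cdot> (Idt C (Ih A B) \<boxtimes> dual_map C f)"
proof -
  have [simp]: "X \<in> Obj C" using C.cod_obj[of f] by simp
  have e: "evA (Dom C f) A \<bullet> (dual_map C f \<star> Idt M (Dom C f \<odot> A)) = evA X A \<bullet> (Idt C (Dul C X) \<star> (f \<star> Idt M A))"
    by (simp add: evA_dual_map)
  show ?thesis
    by (rule Ih_ext[of "Dom C f \<odot> A" B])
      (auto simp: iev_hmL[THEN M.reassoc] iev_inn iev_inn[THEN M.reassoc] mas_nat_2 mas_nat_3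
        interchange_r e[THEN lact_lift, THEN M.reassoc])
qed

lemma inn_out:
  assumes [simp]: "X \<in> Obj C" "Z \<in> Obj C" "A \<in> Obj M" "B \<in> Obj M"
  shows "inn X A (Z \<odot> B) \<cdot> (out Z A B \<boxtimes> Idt C (Dul C X))
    = out Z (X \<odot> A) B \<cdot> (Idt C Z \<boxtimes> inn X A B) \<cdot> Asc C Z (Ih A B) (Dul C X)"
  by (rule Ih_ext[of "X \<odot> A" "Z \<odot> B"])
    (auto simp: iev_inn iev_inn[THEN M.reassoc] iev_out iev_out[THEN M.reassoc] mas_nat_1 mas_nat_2[THEN M.reassoc]
      mas_nat_3[THEN M.reassoc] interchange_r[THEN M.reassoc] mod_pentagon iev_inn[THEN lact_lift, THEN M.reassoc])

text \<open>Moving \<open>X \<otimes> Y\<close> out of the first argument in one step or in two steps; the difference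
  between \<open>(X \<otimes> Y)\<^sup>*\<close> and \<open>Y\<^sup>* \<otimes> X\<^sup>*\<close> is
  \<open>dual_ten\<close>.\<close>

lemma inn_mas:
  assumes [simp]: "X \<in> Obj C" "Y \<in> Obj C" "A \<in> Obj M" "B \<in> Obj M"
  shows "hm (mas X Y A) (Idt M B) \<cdot> inn X (Y \<odot> A) B \<cdot> (inn Y A B \<boxtimes> Idt C (Dul C X))
    = inn (X \<otimes> Y) A B \<cdot> (Idt C (Ih A B) \<boxtimes> dual_ten C X Y) \<cdot> Asc C (Ih A B) (Dul C Y) (Dul C X)"
  by (rule Ih_ext[of "(X \<otimes> Y) \<odot> A" B])
    (auto simp: iev_hmL[THEN M.reassoc] iev_inn iev_inn[THEN M.reassoc] mas_nat_1 mas_nat_1[THEN M.reassoc]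
      mas_nat_2[THEN M.reassoc] mas_nat_3 mas_nat_3[THEN M.reassoc] interchange_r interchange_r[THEN M.reassoc]
      mod_pentagon evA_dual_ten[THEN lact_lift, THEN M.reassoc]
      mas_nat_3[THEN lact_lift, THEN M.reassoc])

lemma inn_mun:
  assumes [simp]: "A \<in> Obj M" "B \<in> Obj M"
  shows "inn (Unt C) A B \<cdot> (Idt C (Ih A B) \<boxtimes> dual_unt C) = hm (mun A) (Idt M B) \<cdot> Run C (Ih A B)"
  by (rule Ih_ext[of "Unt C \<odot> A" B])
    (auto simp: iev_inn[THEN M.reassoc] iev_hmL[THEN M.reassoc] mas_nat_2 interchange_r
      evA_dual_unt[THEN lact_lift, THEN M.reassoc] mod_triangle)

text \<open>The inverse is the transpose of the arrow \<open>Hom(X \<odot> A, B) \<otimes> X \<rightarrow> Hom(A,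
  B)\<close> given by evaluation.\<close>

lemma inn_iso [simp]:
  assumes [simp]: "X \<in> Obj C" "A \<in> Obj M" "B \<in> Obj M"
  shows "iso_arrow C (inn X A B)"
proof (rule C.isoI)
  let ?W = "Ih (X \<odot> A) B" and ?X = "Dul C X"
  define k where "k = IhT H (?W \<otimes> X) A B (iev (X \<odot> A) B \<bullet> mas ?W X A)"
  have [simp]: "k \<in> Arr C" "Dom C k = ?W \<otimes> X" "Cod C k = Ih A B" by (auto simp: k_def)
  have iev_k: "iev A B \<bullet> (k \<star> Idt M A) = iev (X \<odot> A) B \<bullet> mas ?W X A"
    by (simp add: k_def iev_IhT)
  show "C.rtr ?W X k \<in> Arr C" "Dom C (C.rtr ?W X k) = Cod C (inn X A B)" "Cod C (C.rtr ?W X k) = Dom C (inn X A B)"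
    by auto
  have "k \<cdot> (inn X A B \<boxtimes> Idt C X) = C.urtr (Ih A B) X (Idt C (Ih A B \<otimes> ?X))"
    by (rule Ih_ext[of A B])
      (auto simp: iev_k[THEN M.reassoc] mas_nat_1 iev_inn[THEN M.reassoc] urtr_act)
  then show "C.rtr ?W X k \<cdot> inn X A B = Idt C (Dom C (inn X A B))"
    by (simp add: C.rtr_nat C.rtr_urtr)
  show "inn X A B \<cdot> C.rtr ?W X k = Idt C (Cod C (inn X A B))"
    by (rule Ih_ext[of "X \<odot> A" B])
      (auto simp: iev_inn[THEN M.reassoc] rtr_act interchange_r[THEN M.reassoc] cmas_nat_3[THEN M.reassoc]
        iev_k[THEN M.reassoc] zz_1(1)[THEN lact_lift])
qed auto

subsection \<open>Duals of internal Homs\<close>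

abbreviation "od \<equiv> ih_out_dual C M H"
abbreviation "ind \<equiv> ih_in_dual C M H"

context
  fixes X A B
  assumes [simp]: "X \<in> Obj C" "A \<in> Obj M" "B \<in> Obj M"
begin

lemma od_arr [simp]:
  "od X A B \<in> Arr C" "Dom C (od X A B) = Dul C (Ih A (X \<odot> B))" "Cod C (od X A B) = Dul C (Ih A B) \<otimes> Dul C X"
  "iso_arrow C (od X A B)"
  by (auto simp: ih_out_dual_def)

lemma ind_arr [simp]:
  "ind X A B \<in> Arr C" "Dom C (ind X A B) = Dul C (Ih (X \<odot> A) B)"
  "Cod C (ind X A B) = Dul C (Dul C X) \<otimes> Dul C (Ih A B)" "iso_arrow C (ind X A B)"
  by (auto simp: ih_in_dual_def)

text \<open>In \<open>Ev_od\<close> and \<open>Ev_ind\<close> the isomorphism \<open>dual_ten\<close> has been traded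
  for nested evaluations, which are easier to follow through an action.\<close>

lemma Ev_od:
  "Ev C (Ih A (X \<odot> B)) \<cdot> (Idt C (Dul C (Ih A (X \<odot> B))) \<boxtimes> out X A B)
    = Ev C (Ih A B) \<cdot> (Idt C (Dul C (Ih A B)) \<boxtimes> C.C.evA X (Ih A B)) \<cdot> Asc C (Dul C (Ih A B)) (Dul C X) (X \<otimes> Ih A B)
      \<cdot> (od X A B \<boxtimes> Idt C (X \<otimes> Ih A B))"
proof -
  have "dual_ten C X (Ih A B) \<cdot> od X A B = dual_map C (out X A B)"
    by (simp add: ih_out_dual_def)
  note e = this[THEN C.C.ract_lift]
  have "Ev C (Ih A (X \<odot> B)) \<cdot> (Idt C (Dul C (Ih A (X \<odot> B))) \<boxtimes> out X A B)
    = Ev C (X \<otimes> Ih A B) \<cdot> (dual_ten C X (Ih A B) \<boxtimes> Idt C (X \<otimes> Ih A B)) \<cdot> (od X A B \<boxtimes> Idt C (X \<otimes> Ih A B))"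
    by (simp add: e C.Ev_dual_map del: C.C.ract_cmp)
  then show ?thesis by (simp add: C.Ev_dual_ten[THEN C.reassoc])
qed

lemma Ev_ind:
  "Ev C (Ih (X \<odot> A) B) \<cdot> (Idt C (Dul C (Ih (X \<odot> A) B)) \<boxtimes> inn X A B)
    = Ev C (Dul C X) \<cdot> (Idt C (Dul C (Dul C X)) \<boxtimes> C.C.evA (Ih A B) (Dul C X))
      \<cdot> Asc C (Dul C (Dul C X)) (Dul C (Ih A B)) (Ih A B \<otimes> Dul C X) \<cdot> (ind X A B \<boxtimes> Idt C (Ih A B \<otimes> Dul C X))"
proof -
  have "dual_ten C (Ih A B) (Dul C X) \<cdot> ind X A B = dual_map C (inn X A B)"
    by (simp add: ih_in_dual_def)
  note e = this[THEN C.C.ract_lift]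
  have "Ev C (Ih (X \<odot> A) B) \<cdot> (Idt C (Dul C (Ih (X \<odot> A) B)) \<boxtimes> inn X A B)
    = Ev C (Ih A B \<otimes> Dul C X) \<cdot> (dual_ten C (Ih A B) (Dul C X) \<boxtimes> Idt C (Ih A B \<otimes> Dul C X))
      \<cdot> (ind X A B \<boxtimes> Idt C (Ih A B \<otimes> Dul C X))"
    by (simp add: e C.Ev_dual_map del: C.C.ract_cmp)
  then show ?thesis by (simp add: C.Ev_dual_ten[THEN C.reassoc])
qed

end

end

section \<open>Traces\<close>

context ihom_action
begin

text \<open>The point of \<open>Hom(B, N)\<close> that names an arrow \<open>B \<rightarrow> N\<close>.\<close>

definition point :: "'p \<Rightarrow> 'p \<Rightarrow> 'b \<Rightarrow> 'a" where
  "point B N f = IhT H (Unt C) B N (f \<bullet> mun B)"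

lemma point_arr [simp]:
  assumes "f \<in> Arr M" "Dom M f = B" "Cod M f = N"
  shows "point B N f \<in> Arr C" "Dom C (point B N f) = Unt C" "Cod C (point B N f) = Ih B N"
proof -
  have [simp]: "B \<in> Obj M" "N \<in> Obj M" using assms by auto
  show "point B N f \<in> Arr C" "Dom C (point B N f) = Unt C" "Cod C (point B N f) = Ih B N"
    using assms by (auto simp: point_def)
qed

lemma iev_point:
  assumes "f \<in> Arr M" "Dom M f = B" "Cod M f = N"
  shows "iev B N \<bullet> (point B N f \<star> Idt M B) = f \<bullet> mun B"
proof -
  have [simp]: "B \<in> Obj M" "N \<in> Obj M" using assms by auto
  show ?thesis using assms by (simp add: point_def iev_IhT)
qed

lemma point_ex1:
  assumes [simp]: "B \<in> Obj M" "N \<in> Obj M" "h \<in> Arr C" "Dom C h = Unt C" "Cod C h = Ih B N"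
  shows "\<exists>!f. f \<in> hom M B N \<and> point B N f = h"
proof (rule ex1I)
  have "point B N (iev B N \<bullet> (h \<star> Idt M B) \<bullet> cinv M (mun B)) = h"
    by (rule Ih_ext[of B N]) (auto simp: iev_point)
  then show "iev B N \<bullet> (h \<star> Idt M B) \<bullet> cinv M (mun B) \<in> hom M B N \<and>
    point B N (iev B N \<bullet> (h \<star> Idt M B) \<bullet> cinv M (mun B)) = h"
    by (auto intro!: homI)
next
  fix f assume "f \<in> hom M B N \<and> point B N f = h"
  then have f: "f \<in> Arr M" "Dom M f = B" "Cod M f = N" "h = point B N f" by (auto simp: hom_def)
  then show "f = iev B N \<bullet> (h \<star> Idt M B) \<bullet> cinv M (mun B)"
    by (simp add: iev_point[THEN M.reassoc])
qed

lemma hmR_point: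
  assumes [simp]: "f \<in> Arr M" "Dom M f = B" "n \<in> Arr M" "Cod M f = Dom M n" "Dom M n = N"
  shows "hm (Idt M B) n \<cdot> point B N f = point B (Cod M n) (n \<bullet> f)"
proof -
  have [simp]: "B \<in> Obj M" "N \<in> Obj M" using M.dom_obj[of f] M.dom_obj[of n] by simp_all
  show ?thesis
    by (rule Ih_ext[of B "Cod M n"]) (auto simp: iev_hmR[THEN M.reassoc] iev_point)
qed

lemma hmL_point:
  assumes [simp]: "f \<in> Arr M" "Cod M f = N" "u \<in> Arr M" "Cod M u = B" "Dom M f = B"
  shows "hm u (Idt M N) \<cdot> point B N f = point (Dom M u) N (f \<bullet> u)"
proof -
  have [simp]: "B \<in> Obj M" "N \<in> Obj M" using M.cod_obj[of u] M.cod_obj[of f] by simp_all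
  show ?thesis
    by (rule Ih_ext[of "Dom M u" N])
      (auto simp: iev_hmL[THEN M.reassoc] iev_point interchange_r iev_point[THEN M.reassoc] mun_nat)
qed

text \<open>Composing with \<open>n\<close> is, on the points that name arrows, composing with the induced arrow of
  internal Homs; so the Yoneda criterion applies.\<close>

lemma iso_if_hmR_iso:
  assumes [simp]: "n \<in> Arr M" and i: "\<And>B. B \<in> Obj M \<Longrightarrow> iso_arrow C (hm (Idt M B) n)"
  shows "iso_arrow M n"
proof (rule M.iso_if_bijective[of n "Dom M n" "Cod M n"])
  fix Z k assume Z [simp]: "Z \<in> Obj M" and k: "k \<in> hom M Z (Cod M n)"
  have [simp]: "k \<in> Arr M" "Dom M k = Z" "Cod M k = Cod M n" using k by (auto simp: hom_def)
  have [simp]: "iso_arrow C (hm (Idt M Z) n)" by (rule i) simp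
  have e: "n \<bullet> h = k \<longleftrightarrow> point Z (Dom M n) h = cinv C (hm (Idt M Z) n) \<cdot> point Z (Cod M n) k"
    if "h \<in> hom M Z (Dom M n)" for h
  proof -
    have [simp]: "h \<in> Arr M" "Dom M h = Z" "Cod M h = Dom M n" using that by (auto simp: hom_def)
    have "n \<bullet> h = k \<longleftrightarrow> point Z (Cod M n) (n \<bullet> h) = point Z (Cod M n) k"
      using point_ex1[of Z "Cod M n" "point Z (Cod M n) k"] by (auto simp: hom_def)
    also have "\<dots> \<longleftrightarrow> hm (Idt M Z) n \<cdot> point Z (Dom M n) h = point Z (Cod M n) k"
      by (simp add: hmR_point)
    also have "\<dots> \<longleftrightarrow> point Z (Dom M n) h = cinv C (hm (Idt M Z) n) \<cdot> point Z (Cod M n) k"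
      by (rule iffI, drule sym, simp_all)
    finally show ?thesis .
  qed
  show "\<exists>!h. h \<in> hom M Z (Dom M n) \<and> n \<bullet> h = k"
    using point_ex1[of Z "Dom M n" "cinv C (hm (Idt M Z) n) \<cdot> point Z (Cod M n) k"] e by (simp cong: conj_cong)
qed (auto simp: hom_def)

text \<open>The condition \<open>serre_iso_balanced\<close> for arrows \<open>h\<close> and \<open>h'\<close>, in
  terms of their transposes. For the legs of a coend it is the balancing condition in the form of
  \<open>coend_cone\<close>.\<close>

lemma balanced_iff:
  assumes [simp]: "X \<in> Obj C" "A \<in> Obj M" "B \<in> Obj M" "V \<in> Obj M"
    and [simp]: "h \<in> Arr C" "Dom C h = Dul C (Ih A B)" "Cod C h = Ih B V"
    and [simp]: "h' \<in> Arr C" "Dom C h' = Dul C (Ih A (X \<odot> B))" "Cod C h' = Ih (X \<odot> B) V"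
  shows "h' = inn X B V \<cdot> (h \<boxtimes> Idt C (Dul C X)) \<cdot> od X A B \<longleftrightarrow>
    iev (X \<odot> B) V \<bullet> (h' \<star> Idt M (X \<odot> B)) = (iev B V \<bullet> (h \<star> Idt M B)) \<bullet> (Idt C (Dul C (Ih A B)) \<star> evA X B)
      \<bullet> mas (Dul C (Ih A B)) (Dul C X) (X \<odot> B) \<bullet> (od X A B \<star> Idt M (X \<odot> B))"
proof -
  have e: "iev (X \<odot> B) V \<bullet> ((inn X B V \<cdot> (h \<boxtimes> Idt C (Dul C X)) \<cdot> od X A B) \<star> Idt M (X \<odot> B))
    = (iev B V \<bullet> (h \<star> Idt M B)) \<bullet> (Idt C (Dul C (Ih A B)) \<star> evA X B)
      \<bullet> mas (Dul C (Ih A B)) (Dul C X) (X \<odot> B) \<bullet> (od X A B \<star> Idt M (X \<odot> B))"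
    by (simp add: iev_inn[THEN M.reassoc] mas_nat_1[THEN M.reassoc] interchange_r[THEN M.reassoc])
  show ?thesis
  proof
    assume "iev (X \<odot> B) V \<bullet> (h' \<star> Idt M (X \<odot> B)) = (iev B V \<bullet> (h \<star> Idt M B)) \<bullet> (Idt C (Dul C (Ih A B)) \<star> evA X B)
      \<bullet> mas (Dul C (Ih A B)) (Dul C X) (X \<odot> B) \<bullet> (od X A B \<star> Idt M (X \<odot> B))"
    then show "h' = inn X B V \<cdot> (h \<boxtimes> Idt C (Dul C X)) \<cdot> od X A B"
      by (intro Ih_ext[of "X \<odot> B" V h']) (auto simp only: e, auto)
  qed (simp only: e)
qed

text \<open>For \<open>X = Hom(A, B)\<^sup>*\<close> the coevaluation of \<open>X\<close> gives a point of
  \<open>Hom(A, X \<odot> B)\<^sup>*\<close>. As an arrow \<open>Hom(A, X \<odot> B) \<rightarrow> 1\<close> this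
  point is the evaluation, by the zigzag identity of \<open>X\<close>.\<close>

lemma Ev_cinv_od:
  assumes [simp]: "A \<in> Obj M" "B \<in> Obj M"
  defines "W \<equiv> Ih A B"
  defines "X \<equiv> Dul C W"
  defines "W' \<equiv> Ih A (X \<odot> B)"
  shows "Ev C W' \<cdot> (cinv C (od X A B) \<boxtimes> Idt C W') \<cdot> (Cv C X \<boxtimes> Idt C W') = Ev C W \<cdot> cinv C (out X A B) \<cdot> Lun C W'"
proof -
  have [simp]: "W \<in> Obj C" "X \<in> Obj C" "W' \<in> Obj C" by (auto simp: W_def X_def W'_def)
  define ot where "ot = out X A B"
  define d where "d = od X A B"
  have [simp]: "ot \<in> Arr C" "Dom C ot = X \<otimes> W" "Cod C ot = W'" "iso_arrow C ot"
    by (simp_all add: ot_def W_def W'_def)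
  have [simp]: "d \<in> Arr C" "Dom C d = Dul C W'" "Cod C d = X \<otimes> Dul C X" "iso_arrow C d"
    using od_arr[of X A B] by (simp_all add: d_def W'_def flip: W_def X_def)
  have E: "Ev C W' \<cdot> (Idt C (Dul C W') \<boxtimes> ot)
    = Ev C W \<cdot> (Idt C X \<boxtimes> C.C.evA X W) \<cdot> Asc C X (Dul C X) (X \<otimes> W) \<cdot> (d \<boxtimes> Idt C (X \<otimes> W))"
    unfolding W_def X_def W'_def ot_def d_def by (rule Ev_od) auto
  have [simp]: "Dom C (Ev C W) = X \<otimes> W" by (simp add: X_def)
  have "(Ev C W' \<cdot> (cinv C d \<boxtimes> Idt C W') \<cdot> (Cv C X \<boxtimes> Idt C W')) \<cdot> (Idt C (Unt C) \<boxtimes> ot)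
    = Ev C W' \<cdot> (Idt C (Dul C W') \<boxtimes> ot) \<cdot> (cinv C d \<boxtimes> Idt C (X \<otimes> W)) \<cdot> (Cv C X \<boxtimes> Idt C (X \<otimes> W))"
    by (simp add: C.C.interchange C.C.interchange[THEN C.reassoc])
  also have "\<dots> = Ev C W \<cdot> (Idt C X \<boxtimes> C.C.evA X W) \<cdot> C.C.cvA X (X \<otimes> W) \<cdot> Lun C (X \<otimes> W)"
    by (simp add: E[THEN C.reassoc] C.C.copair_def)
  also have "\<dots> = (Ev C W \<cdot> cinv C ot \<cdot> Lun C W') \<cdot> (Idt C (Unt C) \<boxtimes> ot)"
    by (simp add: C.C.mun_nat)
  finally show ?thesis
    unfolding ot_def[symmetric] d_def[symmetric]
    by - (rule C.iso_cancel_right[of "Idt C (Unt C) \<boxtimes> ot"], auto)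
qed

end

locale serre = ihom_action C M H
  for C :: "('o, 'a, 'k::field, 'z) tcat_scheme" (structure)
    and M :: "('p, 'b, 'k, 'o, 'a, 'y) lmod_scheme"
    and H :: "('p, 'b, 'o, 'a) ihom" +
  fixes S :: "('p, 'b, 'p, 'b) fctr"
  assumes S_functor: "is_functor M M S"
begin

abbreviation "S\<^sub>o \<equiv> fob S"
abbreviation "S\<^sub>a \<equiv> far S"

lemma S_obj [simp]: "A \<in> Obj M \<Longrightarrow> S\<^sub>o A \<in> Obj M"
  and S_arr [simp]: "f \<in> Arr M \<Longrightarrow> S\<^sub>a f \<in> Arr M"
  and S_dom [simp]: "f \<in> Arr M \<Longrightarrow> Dom M (S\<^sub>a f) = S\<^sub>o (Dom M f)"
  and S_cod [simp]: "f \<in> Arr M \<Longrightarrow> Cod M (S\<^sub>a f) = S\<^sub>o (Cod M f)"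
  and S_idt [simp]: "A \<in> Obj M \<Longrightarrow> S\<^sub>a (Idt M A) = Idt M (S\<^sub>o A)"
  and S_cmp: "g \<in> Arr M \<Longrightarrow> f \<in> Arr M \<Longrightarrow> Cod M f = Dom M g \<Longrightarrow> S\<^sub>a (g \<bullet> f) = S\<^sub>a g \<bullet> S\<^sub>a f"
  using S_functor by (auto simp: is_functor_def hom_def)

end

text \<open>The data of a trace exhibit \<open>S A\<close> as a representing object of \<open>B \<mapsto> Hom(Hom(A,
  B), 1)\<close>; the last condition says that the representation is natural in \<open>A\<close>.\<close>

locale trace = serre C M H S
  for C :: "('o, 'a, 'k::field, 'z) tcat_scheme" (structure)
    and M :: "('p, 'b, 'k, 'o, 'a, 'y) lmod_scheme"
    and H :: "('p, 'b, 'o, 'a) ihom"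
    and S :: "('p, 'b, 'p, 'b) fctr" +
  fixes t :: "'p \<Rightarrow> 'a"
  assumes t_hom: "A \<in> Obj M \<Longrightarrow> t A \<in> hom C (Ih A (S\<^sub>o A)) (Unt C)"
    and t_bij: "A \<in> Obj M \<Longrightarrow> B \<in> Obj M \<Longrightarrow>
      bij_betw (\<lambda>f. t A \<cdot> hm (Idt M A) f) (hom M B (S\<^sub>o A)) (hom C (Ih A B) (Unt C))"
    and t_nat: "f \<in> Arr M \<Longrightarrow>
      t (Dom M f) \<cdot> hm f (Idt M (S\<^sub>o (Dom M f))) = t (Cod M f) \<cdot> hm (Idt M (Cod M f)) (S\<^sub>a f)"
begin

lemma t_arr [simp]:
  assumes "A \<in> Obj M"
  shows "t A \<in> Arr C" "Dom C (t A) = Ih A (S\<^sub>o A)" "Cod C (t A) = Unt C"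
  using t_hom[OF assms] by (auto simp: hom_def)

lemma t_ext:
  assumes "t A \<cdot> hm (Idt M A) f = t A \<cdot> hm (Idt M A) g" "A \<in> Obj M" "f \<in> Arr M" "g \<in> Arr M"
    "Dom M f = Dom M g" "Cod M f = S\<^sub>o A" "Cod M g = S\<^sub>o A"
  shows "f = g"
proof -
  have "inj_on (\<lambda>f. t A \<cdot> hm (Idt M A) f) (hom M (Dom M g) (S\<^sub>o A))"
    using t_bij[of A "Dom M g"] assms by (auto simp: bij_betw_def)
  then show ?thesis using assms by (auto simp: hom_def dest: inj_onD)
qed

text \<open>The form in which arrows \<open>V \<odot> B \<rightarrow> S A\<close> are compared: by the induced arrows
  \<open>V \<otimes> Hom(A, B) \<rightarrow> 1\<close>. The isomorphism \<open>i\<close> allows for a more convenient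
  form of \<open>Hom(A, B)\<close>.\<close>

lemma t_ext_out:
  assumes "t A \<cdot> hm (Idt M A) f \<cdot> out V A B \<cdot> (Idt C V \<boxtimes> i) = t A \<cdot> hm (Idt M A) g \<cdot> out V A B \<cdot> (Idt C V \<boxtimes> i)"
    and [simp]: "A \<in> Obj M" "B \<in> Obj M" "V \<in> Obj C" "f \<in> Arr M" "g \<in> Arr M" "iso_arrow C i" "Cod C i = Ih A B"
    "Dom M f = V \<odot> B" "Dom M g = V \<odot> B" "Cod M f = S\<^sub>o A" "Cod M g = S\<^sub>o A"
  shows "f = g"
proof (rule t_ext)
  have [simp]: "i \<in> Arr C" by (rule C.iso_arr) simp
  show "t A \<cdot> hm (Idt M A) f = t A \<cdot> hm (Idt M A) g"
    by (rule C.iso_cancel_right[of "out V A B \<cdot> (Idt C V \<boxtimes> i)"]) (use assms(1) in auto)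
qed auto

definition arr_of_trace :: "'p \<Rightarrow> 'p \<Rightarrow> 'a \<Rightarrow> 'b" where
  "arr_of_trace A B k = inv_into (hom M B (S\<^sub>o A)) (\<lambda>f. t A \<cdot> hm (Idt M A) f) k"

lemma arr_of_trace:
  assumes "A \<in> Obj M" "B \<in> Obj M" "k \<in> Arr C" "Dom C k = Ih A B" "Cod C k = Unt C"
  shows "arr_of_trace A B k \<in> Arr M" "Dom M (arr_of_trace A B k) = B" "Cod M (arr_of_trace A B k) = S\<^sub>o A"
    "t A \<cdot> hm (Idt M A) (arr_of_trace A B k) = k"
proof -
  have k: "k \<in> (\<lambda>f. t A \<cdot> hm (Idt M A) f) ` hom M B (S\<^sub>o A)"
    using t_bij[of A B] assms by (auto simp: bij_betw_def hom_def)
  show "arr_of_trace A B k \<in> Arr M" "Dom M (arr_of_trace A B k) = B" "Cod M (arr_of_trace A B k) = S\<^sub>o A"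
    using inv_into_into[OF k] by (auto simp: arr_of_trace_def hom_def)
  show "t A \<cdot> hm (Idt M A) (arr_of_trace A B k) = k"
    unfolding arr_of_trace_def by (rule f_inv_into_f[OF k])
qed

text \<open>The arrow \<open>Hom(A, U)\<^sup>* \<odot> U \<rightarrow> S A\<close> whose trace is the evaluation of
  \<open>Hom(A, U)\<close>.\<close>

definition leg :: "'p \<Rightarrow> 'p \<Rightarrow> 'b" where
  "leg A U = arr_of_trace A (Dul C (Ih A U) \<odot> U) (Ev C (Ih A U) \<cdot> cinv C (out (Dul C (Ih A U)) A U))"

lemma leg_arr [simp]:
  assumes "A \<in> Obj M" "U \<in> Obj M"
  shows "leg A U \<in> Arr M" "Dom M (leg A U) = Dul C (Ih A U) \<odot> U" "Cod M (leg A U) = S\<^sub>o A"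
  using assms by (auto simp: leg_def arr_of_trace)

lemma t_leg_out:
  assumes "A \<in> Obj M" "U \<in> Obj M"
  shows "t A \<cdot> hm (Idt M A) (leg A U) = Ev C (Ih A U) \<cdot> cinv C (out (Dul C (Ih A U)) A U)"
  unfolding leg_def by (rule arr_of_trace) (use assms in auto)

lemma t_leg:
  assumes "A \<in> Obj M" "U \<in> Obj M"
  shows "t A \<cdot> hm (Idt M A) (leg A U) \<cdot> out (Dul C (Ih A U)) A U = Ev C (Ih A U)"
  using assms by (simp add: t_leg_out[THEN C.reassoc])

text \<open>Both sides have the trace \<open>Hom(A, U')\<^sup>* \<otimes> Hom(A', U) \<rightarrow> 1\<close> that
  evaluates after applying \<open>Hom(f, g)\<close>.\<close>

lemma leg_nat:
  assumes [simp]: "f \<in> Arr M" "g \<in> Arr M" "Cod M f = A'" "Dom M g = U"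
  shows "leg A' U \<bullet> (dual_map C (hm f g) \<star> Idt M U)
    = S\<^sub>a f \<bullet> leg (Dom M f) (Cod M g) \<bullet> (Idt C (Dul C (Ih (Dom M f) (Cod M g))) \<star> g)"
proof -
  let ?A = "Dom M f" and ?U = "Cod M g"
  let ?Y = "Dul C (Ih ?A ?U)"
  have [simp]: "A' \<in> Obj M" "U \<in> Obj M" using M.cod_obj[of f] M.dom_obj[of g] by simp_all
  have tn: "t A' \<cdot> hm (Idt M A') (S\<^sub>a f) = t ?A \<cdot> hm f (Idt M (S\<^sub>o ?A))"
    by (simp add: t_nat)
  have hs: "hm f g = hm (Idt M ?A) g \<cdot> hm f (Idt M U)"
    using hm_split[of f g] by (simp add: hm_swap)
  have "t A' \<cdot> hm (Idt M A') (leg A' U \<bullet> (dual_map C (hm f g) \<star> Idt M U)) \<cdot> out ?Y A' U \<cdot> (Idt C ?Y \<boxtimes> Idt C (Ih A' U))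
    = Ev C (Ih ?A ?U) \<cdot> (Idt C ?Y \<boxtimes> hm f g)"
    by (simp add: out_nat_X t_leg[THEN C.reassoc3] C.Ev_dual_map)
  also have "\<dots> = t ?A \<cdot> hm (Idt M ?A) (leg ?A ?U) \<cdot> hm (Idt M ?A) (Idt C ?Y \<star> g) \<cdot> hm f (Idt M (?Y \<odot> U)) \<cdot> out ?Y A' U"
    by (simp add: out_nat_A out_nat_B[THEN C.reassoc] t_leg[THEN C.reassoc3] hs)
  also have "\<dots> = t A' \<cdot> hm (Idt M A') (S\<^sub>a f \<bullet> leg ?A ?U \<bullet> (Idt C ?Y \<star> g)) \<cdot> out ?Y A' U \<cdot> (Idt C ?Y \<boxtimes> Idt C (Ih A' U))"
    by (simp add: tn[THEN C.reassoc] hm_swap[THEN C.reassoc])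
  finally show ?thesis by (rule t_ext_out) auto
qed

text \<open>The trace of either side evaluates \<open>X\<close> inside \<open>Hom(A, X \<odot> B) \<simeq> X \<otimes>
  Hom(A, B)\<close> and then \<open>Hom(A, B)\<close>.\<close>

lemma leg_balanced:
  assumes [simp]: "X \<in> Obj C" "A \<in> Obj M" "B \<in> Obj M"
  shows "leg A (X \<odot> B) = leg A B \<bullet> (Idt C (Dul C (Ih A B)) \<star> evA X B)
      \<bullet> mas (Dul C (Ih A B)) (Dul C X) (X \<odot> B) \<bullet> (od X A B \<star> Idt M (X \<odot> B))"
proof -
  let ?Y = "Dul C (Ih A B)" and ?W = "Ih A (X \<odot> B)"
  have "t A \<cdot> hm (Idt M A) (leg A B \<bullet> (Idt C ?Y \<star> evA X B) \<bullet> mas ?Y (Dul C X) (X \<odot> B) \<bullet> (od X A B \<star> Idt M (X \<odot> B)))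
      \<cdot> out (Dul C ?W) A (X \<odot> B) \<cdot> (Idt C (Dul C ?W) \<boxtimes> out X A B)
    = Ev C (Ih A B) \<cdot> (Idt C ?Y \<boxtimes> hm (Idt M A) (evA X B)) \<cdot> (Idt C ?Y \<boxtimes> out (Dul C X) A (X \<odot> B))
       \<cdot> Asc C ?Y (Dul C X) ?W \<cdot> (od X A B \<boxtimes> Idt C ?W) \<cdot> (Idt C (Dul C ?W) \<boxtimes> out X A B)"
    by (simp add: out_nat_X[THEN C.reassoc] out_mas[THEN C.reassoc] out_nat_B[THEN C.reassoc] t_leg[THEN C.reassoc3])
  also have "\<dots> = Ev C (Ih A B) \<cdot> (Idt C ?Y \<boxtimes> C.C.evA X (Ih A B)) \<cdot> Asc C ?Y (Dul C X) (X \<otimes> Ih A B) \<cdot> (od X A B \<boxtimes> Idt C (X \<otimes> Ih A B))"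
    by (simp add: C.C.interchange C.C.mas_nat_3[THEN C.reassoc] out_pair[THEN C.C.lact_lift3, THEN C.reassoc3])
  also have "\<dots> = t A \<cdot> hm (Idt M A) (leg A (X \<odot> B)) \<cdot> out (Dul C ?W) A (X \<odot> B) \<cdot> (Idt C (Dul C ?W) \<boxtimes> out X A B)"
    by (simp add: t_leg[THEN C.reassoc3] Ev_od)
  finally show ?thesis by (rule t_ext_out[OF sym]) auto
qed

definition \<phi> :: "'p \<Rightarrow> 'p \<Rightarrow> 'a" where
  "\<phi> A U = IhT H (Dul C (Ih A U)) U (S\<^sub>o A) (leg A U)"

lemma phi_arr [simp]:
  assumes "A \<in> Obj M" "U \<in> Obj M"
  shows "\<phi> A U \<in> Arr C" "Dom C (\<phi> A U) = Dul C (Ih A U)" "Cod C (\<phi> A U) = Ih U (S\<^sub>o A)"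
  using assms by (auto simp: \<phi>_def)

lemma iev_phi:
  assumes "A \<in> Obj M" "U \<in> Obj M"
  shows "iev U (S\<^sub>o A) \<bullet> (\<phi> A U \<star> Idt M U) = leg A U"
  using assms by (simp add: \<phi>_def iev_IhT)

lemma t_leg_ract:
  assumes [simp]: "A \<in> Obj M" "U \<in> Obj M" "h \<in> Arr C" "Cod C h = Dul C (Ih A U)" "Dom C h = Z"
  shows "t A \<cdot> hm (Idt M A) (leg A U) \<cdot> hm (Idt M A) (h \<star> Idt M U) \<cdot> out Z A U = Ev C (Ih A U) \<cdot> (h \<boxtimes> Idt C (Ih A U))"
  by (simp add: out_nat_X t_leg[THEN C.reassoc3])

text \<open>Composition with \<open>\<phi> A U\<close> sends an arrow \<open>Z \<rightarrow> Hom(A,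
  U)\<^sup>*\<close>, read as an arrow \<open>Z \<otimes> Hom(A, U) \<rightarrow> 1\<close>, to the arrow \<open>Z
  \<odot> U \<rightarrow> S A\<close> with that trace. So the representing property of the trace gives
  invertibility.\<close>

lemma phi_iso [simp]:
  assumes [simp]: "A \<in> Obj M" "U \<in> Obj M"
  shows "iso_arrow C (\<phi> A U)"
proof (rule C.iso_if_bijective[of _ "Dul C (Ih A U)" "Ih U (S\<^sub>o A)"])
  show "\<phi> A U \<in> hom C (Dul C (Ih A U)) (Ih U (S\<^sub>o A))" by (simp add: hom_def)
  fix Z k assume [simp]: "Z \<in> Obj C" and "k \<in> hom C Z (Ih U (S\<^sub>o A))"
  then have [simp]: "k \<in> Arr C" "Dom C k = Z" "Cod C k = Ih U (S\<^sub>o A)" by (auto simp: hom_def)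
  let ?f = "iev U (S\<^sub>o A) \<bullet> (k \<star> Idt M U)"
  let ?k = "t A \<cdot> hm (Idt M A) ?f \<cdot> out Z A U"
  show "\<exists>!h. h \<in> hom C Z (Dul C (Ih A U)) \<and> \<phi> A U \<cdot> h = k"
  proof (rule ex1I)
    let ?h = "lmate C Z (Ih A U) ?k"
    have "leg A U \<bullet> (?h \<star> Idt M U) = ?f"
      by (rule t_ext_out[of A _ Z U "Idt C (Ih A U)"]) (auto simp: t_leg_ract C.Ev_lmate)
    then have "\<phi> A U \<cdot> ?h = k"
      by - (rule Ih_ext[of U "S\<^sub>o A"], auto simp: iev_phi[THEN M.reassoc])
    then show "?h \<in> hom C Z (Dul C (Ih A U)) \<and> \<phi> A U \<cdot> ?h = k" by (auto simp: hom_def)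
  next
    fix h assume "h \<in> hom C Z (Dul C (Ih A U)) \<and> \<phi> A U \<cdot> h = k"
    then have [simp]: "h \<in> Arr C" "Dom C h = Z" "Cod C h = Dul C (Ih A U)" and k: "k = \<phi> A U \<cdot> h"
      by (auto simp: hom_def)
    have "?k = Ev C (Ih A U) \<cdot> (h \<boxtimes> Idt C (Ih A U))"
      by (simp add: k iev_phi[THEN M.reassoc] t_leg_ract)
    then show "h = lmate C Z (Ih A U) ?k"
      using C.lmate_Ev[of "Ih A U" h] by simp
  qed
qed

lemma phi_serre_iso: "serre_iso C M H S \<phi>"
  unfolding serre_iso_def
proof (intro conjI ballI)
  fix f g assume [simp]: "f \<in> Arr M" "g \<in> Arr M"
  show "\<phi> (Cod M f) (Dom M g) \<cdot> dual_map C (hm f g) = hm g (S\<^sub>a f) \<cdot> \<phi> (Dom M f) (Cod M g)"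
    by (rule Ih_ext[of "Dom M g" "S\<^sub>o (Cod M f)"])
      (auto simp: iev_phi[THEN M.reassoc] iev_hm[THEN M.reassoc] leg_nat interchange_r)
qed (auto intro!: homI)

lemma phi_balanced: "serre_iso_balanced C M H S \<phi>"
  unfolding serre_iso_balanced_def
  by (auto simp: balanced_iff iev_phi leg_balanced)

end

section \<open>The module structure determined by a trace\<close>

context ihom_action
begin

lemma inn_out_r:
  assumes [simp]: "X \<in> Obj C" "Z \<in> Obj C" "A \<in> Obj M" "B \<in> Obj M"
  shows "out Z (X \<odot> A) B \<cdot> (Idt C Z \<boxtimes> inn X A B)
    = inn X A (Z \<odot> B) \<cdot> (out Z A B \<boxtimes> Idt C (Dul C X)) \<cdot> cinv C (Asc C Z (Ih A B) (Dul C X))"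
  by (simp add: inn_out[THEN C.reassoc])

end

context trace
begin

text \<open>The arrow \<open>X\<^sup>*\<^sup>* \<odot> S A \<rightarrow> S (X \<odot> A)\<close> whose trace, on
  \<open>X\<^sup>*\<^sup>* \<otimes> Hom(X \<odot> A, S A) \<simeq> X\<^sup>*\<^sup>* \<otimes> (Hom(A, S A) \<otimes>
  X\<^sup>*)\<close>, applies \<open>t A\<close> inside and then evaluates \<open>X\<^sup>*\<close>.\<close>

definition twist :: "'o \<Rightarrow> 'p \<Rightarrow> 'b" where
  "twist X A = arr_of_trace (X \<odot> A) (Dul C (Dul C X) \<odot> S\<^sub>o A)
    (Ev C (Dul C X) \<cdot> (Idt C (Dul C (Dul C X)) \<boxtimes> (Lun C (Dul C X) \<cdot> (t A \<boxtimes> Idt C (Dul C X)) \<cdot> cinv C (inn X A (S\<^sub>o A))))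
      \<cdot> cinv C (out (Dul C (Dul C X)) (X \<odot> A) (S\<^sub>o A)))"

lemma twist_arr [simp]:
  assumes "X \<in> Obj C" "A \<in> Obj M"
  shows "twist X A \<in> Arr M" "Dom M (twist X A) = Dul C (Dul C X) \<odot> S\<^sub>o A" "Cod M (twist X A) = S\<^sub>o (X \<odot> A)"
  using assms by (auto simp: twist_def arr_of_trace)

lemma t_twist:
  assumes [simp]: "X \<in> Obj C" "A \<in> Obj M"
  shows "t (X \<odot> A) \<cdot> hm (Idt M (X \<odot> A)) (twist X A) \<cdot> out (Dul C (Dul C X)) (X \<odot> A) (S\<^sub>o A) \<cdot> (Idt C (Dul C (Dul C X)) \<boxtimes> inn X A (S\<^sub>o A))
    = Ev C (Dul C X) \<cdot> (Idt C (Dul C (Dul C X)) \<boxtimes> Lun C (Dul C X)) \<cdot> (Idt C (Dul C (Dul C X)) \<boxtimes> (t A \<boxtimes> Idt C (Dul C X)))"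
proof -
  define k where "k = Ev C (Dul C X) \<cdot> (Idt C (Dul C (Dul C X)) \<boxtimes> (Lun C (Dul C X) \<cdot> (t A \<boxtimes> Idt C (Dul C X)) \<cdot> cinv C (inn X A (S\<^sub>o A))))
      \<cdot> cinv C (out (Dul C (Dul C X)) (X \<odot> A) (S\<^sub>o A))"
  have "t (X \<odot> A) \<cdot> hm (Idt M (X \<odot> A)) (twist X A) = k"
    unfolding twist_def k_def[symmetric] by (rule arr_of_trace) (auto simp: k_def)
  from this[THEN C.reassoc] show ?thesis by (simp add: k_def)
qed

lemma t_twist_lift:
  assumes [simp]: "X \<in> Obj C" "A \<in> Obj M" "x \<in> Arr C" "Cod C x = Dul C (Dul C X) \<otimes> (Ih A (S\<^sub>o A) \<otimes> Dul C X)"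
  shows "t (X \<odot> A) \<cdot> hm (Idt M (X \<odot> A)) (twist X A) \<cdot> out (Dul C (Dul C X)) (X \<odot> A) (S\<^sub>o A) \<cdot> (Idt C (Dul C (Dul C X)) \<boxtimes> inn X A (S\<^sub>o A)) \<cdot> x
    = Ev C (Dul C X) \<cdot> (Idt C (Dul C (Dul C X)) \<boxtimes> Lun C (Dul C X)) \<cdot> (Idt C (Dul C (Dul C X)) \<boxtimes> (t A \<boxtimes> Idt C (Dul C X))) \<cdot> x"
proof -
  have "(t (X \<odot> A) \<cdot> hm (Idt M (X \<odot> A)) (twist X A) \<cdot> out (Dul C (Dul C X)) (X \<odot> A) (S\<^sub>o A) \<cdot> (Idt C (Dul C (Dul C X)) \<boxtimes> inn X A (S\<^sub>o A))) \<cdot> x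
    = (Ev C (Dul C X) \<cdot> (Idt C (Dul C (Dul C X)) \<boxtimes> Lun C (Dul C X)) \<cdot> (Idt C (Dul C (Dul C X)) \<boxtimes> (t A \<boxtimes> Idt C (Dul C X)))) \<cdot> x"
    by (simp only: t_twist assms)
  then show ?thesis by simp
qed

text \<open>With \<open>twist\<close> moved to the other side this becomes the equation that defines the module
  structure of the coend. Both sides have the trace that evaluates \<open>Hom(A, B)\<close> inside and
  \<open>X\<^sup>*\<close> outside.\<close>

lemma leg_twist:
  assumes [simp]: "X \<in> Obj C" "A \<in> Obj M" "B \<in> Obj M"
  shows "leg (X \<odot> A) B = twist X A \<bullet> (Idt C (Dul C (Dul C X)) \<star> leg A B) \<bullet> mas (Dul C (Dul C X)) (Dul C (Ih A B)) B \<bullet> (ind X A B \<star> Idt M B)"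
proof -
  let ?X = "Dul C X" and ?V = "Dul C (Dul C X)" and ?W = "Ih A B" and ?W' = "Ih (X \<odot> A) B"
  let ?Y = "Dul C ?W" and ?Y' = "Dul C ?W'" and ?I = "Idt M (X \<odot> A)"
  let ?P = "(hm (Idt M A) (leg A B) \<boxtimes> Idt C ?X) \<cdot> (out ?Y A B \<boxtimes> Idt C ?X) \<cdot> cinv C (Asc C ?Y ?W ?X)"
  have K: "hm ?I (leg A B) \<cdot> out ?Y (X \<odot> A) B \<cdot> (Idt C ?Y \<boxtimes> inn X A B) = inn X A (S\<^sub>o A) \<cdot> ?P"
    by (simp add: inn_out_r inn_nat_B[THEN C.reassoc])
  have "Lun C ?X \<cdot> (t A \<boxtimes> Idt C ?X) \<cdot> ?P = Lun C ?X \<cdot> ((t A \<cdot> hm (Idt M A) (leg A B) \<cdot> out ?Y A B) \<boxtimes> Idt C ?X) \<cdot> cinv C (Asc C ?Y ?W ?X)"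
    by simp
  also have "\<dots> = C.C.evA ?W ?X"
    by (simp only: t_leg assms) (simp add: C.C.pair_def)
  finally have Q: "Lun C ?X \<cdot> (t A \<boxtimes> Idt C ?X) \<cdot> ?P = C.C.evA ?W ?X" .
  let ?rhs = "twist X A \<bullet> (Idt C ?V \<star> leg A B) \<bullet> mas ?V ?Y B \<bullet> (ind X A B \<star> Idt M B)"
  have "t (X \<odot> A) \<cdot> hm ?I ?rhs \<cdot> out ?Y' (X \<odot> A) B \<cdot> (Idt C ?Y' \<boxtimes> inn X A B)
    = t (X \<odot> A) \<cdot> hm ?I (twist X A) \<cdot> out ?V (X \<odot> A) (S\<^sub>o A)
      \<cdot> (Idt C ?V \<boxtimes> (hm ?I (leg A B) \<cdot> out ?Y (X \<odot> A) B \<cdot> (Idt C ?Y \<boxtimes> inn X A B)))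
      \<cdot> Asc C ?V ?Y (?W \<otimes> ?X) \<cdot> (ind X A B \<boxtimes> Idt C (?W \<otimes> ?X))"
    by (simp add: out_nat_X[THEN C.reassoc] out_mas[THEN C.reassoc] out_nat_B[THEN C.reassoc]
        C.C.interchange C.C.mas_nat_3[THEN C.reassoc])
  also have "\<dots> = t (X \<odot> A) \<cdot> hm ?I (twist X A) \<cdot> out ?V (X \<odot> A) (S\<^sub>o A)
      \<cdot> (Idt C ?V \<boxtimes> (inn X A (S\<^sub>o A) \<cdot> ?P)) \<cdot> Asc C ?V ?Y (?W \<otimes> ?X) \<cdot> (ind X A B \<boxtimes> Idt C (?W \<otimes> ?X))"
    by (simp only: K)
  also have "\<dots> = Ev C ?X \<cdot> (Idt C ?V \<boxtimes> (Lun C ?X \<cdot> (t A \<boxtimes> Idt C ?X) \<cdot> ?P)) \<cdot> Asc C ?V ?Y (?W \<otimes> ?X) \<cdot> (ind X A B \<boxtimes> Idt C (?W \<otimes> ?X))"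
    by (simp add: t_twist_lift)
  also have "\<dots> = t (X \<odot> A) \<cdot> hm ?I (leg (X \<odot> A) B) \<cdot> out ?Y' (X \<odot> A) B \<cdot> (Idt C ?Y' \<boxtimes> inn X A B)"
    by (simp add: t_leg[THEN C.reassoc3] Ev_ind Q)
  finally show ?thesis by (rule t_ext_out[OF sym]) auto
qed

lemma phi_twist:
  assumes [simp]: "X \<in> Obj C" "A \<in> Obj M" "B \<in> Obj M"
  shows "\<phi> (X \<odot> A) B = hm (Idt M B) (twist X A) \<cdot> out (Dul C (Dul C X)) B (S\<^sub>o A) \<cdot> (Idt C (Dul C (Dul C X)) \<boxtimes> \<phi> A B) \<cdot> ind X A B"
  by (rule Ih_ext[of B "S\<^sub>o (X \<odot> A)"])
    (auto simp: iev_phi leg_twist iev_hmR[THEN M.reassoc] iev_out[THEN M.reassoc] mas_nat_2[THEN M.reassoc] iev_phi[THEN lact_lift, THEN M.reassoc])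

text \<open>In \<open>phi_twist\<close> every arrow apart from the one induced by \<open>twist X A\<close> is known to
  be invertible.\<close>

lemma twist_iso [simp]:
  assumes [simp]: "X \<in> Obj C" "A \<in> Obj M"
  shows "iso_arrow M (twist X A)"
proof (rule iso_if_hmR_iso)
  fix B assume [simp]: "B \<in> Obj M"
  let ?V = "Dul C (Dul C X)"
  let ?u = "out ?V B (S\<^sub>o A) \<cdot> (Idt C ?V \<boxtimes> \<phi> A B) \<cdot> ind X A B"
  have [simp]: "iso_arrow C ?u" by simp
  have "iso_arrow C (\<phi> (X \<odot> A) B \<cdot> cinv C ?u)" by simp
  also have "\<phi> (X \<odot> A) B \<cdot> cinv C ?u = hm (Idt M B) (twist X A) \<cdot> (?u \<cdot> cinv C ?u)"
    unfolding phi_twist[OF assms \<open>B \<in> Obj M\<close>] by (simp del: C.cinv_right)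
  also have "\<dots> = hm (Idt M B) (twist X A)" by simp
  finally show "iso_arrow C (hm (Idt M B) (twist X A))" .
qed simp

lemma t_nat_r:
  assumes "f \<in> Arr M" "Cod M f = A'"
  shows "t A' \<cdot> hm (Idt M A') (S\<^sub>a f) = t (Dom M f) \<cdot> hm f (Idt M (S\<^sub>o (Dom M f)))"
  using t_nat[of f] assms by simp

lemma twist_nat_A:
  assumes [simp]: "X \<in> Obj C" "u \<in> Arr M" "Dom M u = A"
  shows "S\<^sub>a (Idt C X \<star> u) \<bullet> twist X A = twist X (Cod M u) \<bullet> (Idt C (Dul C (Dul C X)) \<star> S\<^sub>a u)"
proof -
  have [simp]: "A \<in> Obj M" using M.dom_obj[of u] by simp
  show ?thesis
    by (rule t_ext_out[of "X \<odot> Cod M u" _ "Dul C (Dul C X)" "S\<^sub>o A" "inn X (Cod M u) (S\<^sub>o A)"])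
      (auto simp: t_nat_r[THEN C.reassoc] hm_swap[THEN C.reassoc] out_nat_A[THEN C.reassoc] out_nat_B[THEN C.reassoc]
        inn_nat_A[THEN C.C.lact_lift] inn_nat_B[THEN C.C.lact_lift] t_twist_lift
        t_nat_r[THEN C.C.ract_lift, THEN C.C.lact_lift])
qed

lemma twist_nat_X:
  assumes [simp]: "f \<in> Arr C" "A \<in> Obj M" "Dom C f = X"
  shows "S\<^sub>a (f \<star> Idt M A) \<bullet> twist X A = twist (Cod C f) A \<bullet> (dual_map C (dual_map C f) \<star> Idt M (S\<^sub>o A))"
proof -
  have [simp]: "X \<in> Obj C" using C.dom_obj[of f] by simp
  let ?X = "Dul C X" and ?V = "Dul C (Dul C X)" and ?X' = "Dul C (Cod C f)" and ?V' = "Dul C (Dul C (Cod C f))"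
  let ?W = "Ih A (S\<^sub>o A)" and ?I = "Idt M (Cod C f \<odot> A)"
  have "t (Cod C f \<odot> A) \<cdot> hm ?I (S\<^sub>a (f \<star> Idt M A) \<bullet> twist X A) \<cdot> out ?V (Cod C f \<odot> A) (S\<^sub>o A) \<cdot> (Idt C ?V \<boxtimes> inn (Cod C f) A (S\<^sub>o A))
    = Ev C ?X \<cdot> (Idt C ?V \<boxtimes> (Lun C ?X \<cdot> (t A \<boxtimes> Idt C ?X) \<cdot> (Idt C ?W \<boxtimes> dual_map C f)))"
    by (simp add: t_nat_r[THEN C.reassoc] hm_swap[THEN C.reassoc] out_nat_A[THEN C.reassoc]
        inn_nat_X[THEN C.C.lact_lift] t_twist_lift)
  also have "\<dots> = Ev C ?X \<cdot> (Idt C ?V \<boxtimes> dual_map C f) \<cdot> (Idt C ?V \<boxtimes> (Lun C ?X' \<cdot> (t A \<boxtimes> Idt C ?X')))"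
    by (simp add: C.C.interchange C.C.mun_nat[THEN C.reassoc] del: C.C.lact_cmp) simp
  also have "\<dots> = Ev C ?X' \<cdot> (dual_map C (dual_map C f) \<boxtimes> Idt C ?X') \<cdot> (Idt C ?V \<boxtimes> (Lun C ?X' \<cdot> (t A \<boxtimes> Idt C ?X')))"
    by (simp add: C.Ev_dual_map[THEN C.reassoc])
  also have "\<dots> = t (Cod C f \<odot> A) \<cdot> hm ?I (twist (Cod C f) A \<bullet> (dual_map C (dual_map C f) \<star> Idt M (S\<^sub>o A))) \<cdot> out ?V (Cod C f \<odot> A) (S\<^sub>o A) \<cdot> (Idt C ?V \<boxtimes> inn (Cod C f) A (S\<^sub>o A))"
    by (simp add: out_nat_X[THEN C.reassoc] C.C.interchange C.C.interchange[THEN C.reassoc] t_twist_lift)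
  finally show ?thesis by (rule t_ext_out) auto
qed

text \<open>The inner trace \<open>?T\<close> of \<open>Y\<close> is what remains inside on both sides. Outside it,
  one side evaluates \<open>Y\<^sup>* \<otimes> X\<^sup>*\<close> at once and the other first \<open>Y\<^sup>*\<close>
  and then \<open>X\<^sup>*\<close>; these agree by the defining property of \<open>dual_ten\<close>.\<close>

lemma twist_mas:
  assumes [simp]: "X \<in> Obj C" "Y \<in> Obj C" "A \<in> Obj M"
  shows "S\<^sub>a (mas X Y A) \<bullet> twist (X \<otimes> Y) A = twist X (Y \<odot> A) \<bullet> (Idt C (Dul C (Dul C X)) \<star> twist Y A)
    \<bullet> mas (Dul C (Dul C X)) (Dul C (Dul C Y)) (S\<^sub>o A) \<bullet> (ddual_ten C X Y \<star> Idt M (S\<^sub>o A))"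
proof -
  let ?X = "Dul C X" and ?V = "Dul C (Dul C X)" and ?Y = "Dul C Y" and ?V' = "Dul C (Dul C Y)"
  let ?Q = "Dul C (Dul C (X \<otimes> Y))" and ?W = "Ih A (S\<^sub>o A)" and ?N = "X \<odot> (Y \<odot> A)" and ?d = "ddual_ten C X Y"
  let ?J = "inn X (Y \<odot> A) (S\<^sub>o A) \<cdot> (inn Y A (S\<^sub>o A) \<boxtimes> Idt C ?X)"
  let ?T = "Lun C ?Y \<cdot> (t A \<boxtimes> Idt C ?Y)"
  have T: "Lun C (?Y \<otimes> ?X) \<cdot> (t A \<boxtimes> Idt C (?Y \<otimes> ?X)) \<cdot> Asc C ?W ?Y ?X = ?T \<boxtimes> Idt C ?X"
    by (simp add: C.C.mas_nat_1r C.C.mun_mas[THEN C.reassoc])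
  have D: "dual_ten C ?Y ?X \<cdot> ?d = dual_map C (dual_ten C X Y)"
    by (simp add: ddual_ten_def)
  have E: "Ev C (?Y \<otimes> ?X) \<cdot> (dual_map C (dual_ten C X Y) \<boxtimes> Idt C (?Y \<otimes> ?X))
    = Ev C ?X \<cdot> (Idt C ?V \<boxtimes> C.C.evA ?Y ?X) \<cdot> Asc C ?V ?V' (?Y \<otimes> ?X) \<cdot> (?d \<boxtimes> Idt C (?Y \<otimes> ?X))"
    by (simp add: C.Ev_dual_ten[THEN C.reassoc] flip: D)
  have L: "t ?N \<cdot> hm (Idt M ?N) (S\<^sub>a (mas X Y A) \<bullet> twist (X \<otimes> Y) A) \<cdot> out ?Q ?N (S\<^sub>o A) \<cdot> (Idt C ?Q \<boxtimes> ?J)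
    = Ev C (?Y \<otimes> ?X) \<cdot> (dual_map C (dual_ten C X Y) \<boxtimes> Idt C (?Y \<otimes> ?X)) \<cdot> (Idt C ?Q \<boxtimes> (?T \<boxtimes> Idt C ?X))"
  proof -
    have "t ?N \<cdot> hm (Idt M ?N) (S\<^sub>a (mas X Y A) \<bullet> twist (X \<otimes> Y) A) \<cdot> out ?Q ?N (S\<^sub>o A) \<cdot> (Idt C ?Q \<boxtimes> ?J)
      = Ev C (Dul C (X \<otimes> Y)) \<cdot> (Idt C ?Q \<boxtimes> (Lun C (Dul C (X \<otimes> Y)) \<cdot> (t A \<boxtimes> Idt C (Dul C (X \<otimes> Y))) \<cdot> (Idt C ?W \<boxtimes> dual_ten C X Y) \<cdot> Asc C ?W ?Y ?X))"
      by (simp add: t_nat_r[THEN C.reassoc] hm_swap[THEN C.reassoc] out_nat_A[THEN C.reassoc]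
          inn_mas[THEN C.C.lact_lift3] t_twist_lift)
    also have "Lun C (Dul C (X \<otimes> Y)) \<cdot> (t A \<boxtimes> Idt C (Dul C (X \<otimes> Y))) \<cdot> (Idt C ?W \<boxtimes> dual_ten C X Y) \<cdot> Asc C ?W ?Y ?X
      = dual_ten C X Y \<cdot> (Lun C (?Y \<otimes> ?X) \<cdot> (t A \<boxtimes> Idt C (?Y \<otimes> ?X)) \<cdot> Asc C ?W ?Y ?X)"
      by (simp add: C.C.interchange[THEN C.reassoc] C.C.mun_nat[THEN C.reassoc])
    also have "\<dots> = dual_ten C X Y \<cdot> (?T \<boxtimes> Idt C ?X)" by (simp only: T)
    also have "Ev C (Dul C (X \<otimes> Y)) \<cdot> (Idt C ?Q \<boxtimes> \<dots>)
      = Ev C (?Y \<otimes> ?X) \<cdot> (dual_map C (dual_ten C X Y) \<boxtimes> Idt C (?Y \<otimes> ?X)) \<cdot> (Idt C ?Q \<boxtimes> (?T \<boxtimes> Idt C ?X))"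
      by (simp add: C.Ev_dual_map[THEN C.reassoc])
    finally show ?thesis .
  qed
  let ?K = "hm (Idt M (Y \<odot> A)) (twist Y A) \<cdot> out ?V' (Y \<odot> A) (S\<^sub>o A) \<cdot> (Idt C ?V' \<boxtimes> inn Y A (S\<^sub>o A))"
  have K: "hm (Idt M ?N) (twist Y A) \<cdot> out ?V' ?N (S\<^sub>o A) \<cdot> (Idt C ?V' \<boxtimes> ?J)
    = inn X (Y \<odot> A) (S\<^sub>o (Y \<odot> A)) \<cdot> (?K \<boxtimes> Idt C ?X) \<cdot> cinv C (Asc C ?V' (?W \<otimes> ?Y) ?X)"
    by (simp add: inn_out_r[THEN C.reassoc] C.C.cmas_nat_2r inn_nat_B[THEN C.reassoc])
  have "t (Y \<odot> A) \<cdot> ?K = Ev C ?Y \<cdot> (Idt C ?V' \<boxtimes> ?T)"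
    using t_twist[of Y A] by simp
  then have K2: "(t (Y \<odot> A) \<boxtimes> Idt C ?X) \<cdot> (?K \<boxtimes> Idt C ?X) = (Ev C ?Y \<cdot> (Idt C ?V' \<boxtimes> ?T)) \<boxtimes> Idt C ?X"
    by - (rule C.C.ract_lift, auto)
  have e1: "Lun C ?X \<cdot> ((Ev C ?Y \<cdot> (Idt C ?V' \<boxtimes> ?T)) \<boxtimes> Idt C ?X) \<cdot> cinv C (Asc C ?V' (?W \<otimes> ?Y) ?X)
    = C.C.evA ?Y ?X \<cdot> (Idt C ?V' \<boxtimes> (?T \<boxtimes> Idt C ?X))"
    by (simp add: C.C.pair_def C.C.cmas_nat_2 C.C.cmas_nat_2[THEN C.reassoc])
  have R: "t ?N \<cdot> hm (Idt M ?N) (twist X (Y \<odot> A) \<bullet> (Idt C ?V \<star> twist Y A) \<bullet> mas ?V ?V' (S\<^sub>o A) \<bullet> (?d \<star> Idt M (S\<^sub>o A))) \<cdot> out ?Q ?N (S\<^sub>o A) \<cdot> (Idt C ?Q \<boxtimes> ?J)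
    = Ev C ?X \<cdot> (Idt C ?V \<boxtimes> C.C.evA ?Y ?X) \<cdot> Asc C ?V ?V' (?Y \<otimes> ?X) \<cdot> (?d \<boxtimes> Idt C (?Y \<otimes> ?X)) \<cdot> (Idt C ?Q \<boxtimes> (?T \<boxtimes> Idt C ?X))"
  proof -
    have [simp]: "?J \<in> Arr C" "Dom C ?J = (?W \<otimes> ?Y) \<otimes> ?X" "Cod C ?J = Ih ?N (S\<^sub>o A)" by auto
    define J where "J = ?J"
    have J [simp]: "J \<in> Arr C" "Dom C J = (?W \<otimes> ?Y) \<otimes> ?X" "Cod C J = Ih ?N (S\<^sub>o A)" by (auto simp: J_def)
    have "t ?N \<cdot> hm (Idt M ?N) (twist X (Y \<odot> A) \<bullet> (Idt C ?V \<star> twist Y A) \<bullet> mas ?V ?V' (S\<^sub>o A) \<bullet> (?d \<star> Idt M (S\<^sub>o A))) \<cdot> out ?Q ?N (S\<^sub>o A) \<cdot> (Idt C ?Q \<boxtimes> J)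
      = t ?N \<cdot> hm (Idt M ?N) (twist X (Y \<odot> A)) \<cdot> out ?V ?N (S\<^sub>o (Y \<odot> A))
        \<cdot> (Idt C ?V \<boxtimes> (hm (Idt M ?N) (twist Y A) \<cdot> out ?V' ?N (S\<^sub>o A) \<cdot> (Idt C ?V' \<boxtimes> J)))
        \<cdot> Asc C ?V ?V' ((?W \<otimes> ?Y) \<otimes> ?X) \<cdot> (?d \<boxtimes> Idt C ((?W \<otimes> ?Y) \<otimes> ?X))"
      by (simp add: out_nat_X[THEN C.reassoc] out_mas[THEN C.reassoc] out_nat_B[THEN C.reassoc]
          C.C.interchange C.C.mas_nat_3[THEN C.reassoc])
    also have "hm (Idt M ?N) (twist Y A) \<cdot> out ?V' ?N (S\<^sub>o A) \<cdot> (Idt C ?V' \<boxtimes> J)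
      = inn X (Y \<odot> A) (S\<^sub>o (Y \<odot> A)) \<cdot> (?K \<boxtimes> Idt C ?X) \<cdot> cinv C (Asc C ?V' (?W \<otimes> ?Y) ?X)"
      unfolding J_def by (rule K)
    also have "t ?N \<cdot> hm (Idt M ?N) (twist X (Y \<odot> A)) \<cdot> out ?V ?N (S\<^sub>o (Y \<odot> A)) \<cdot> (Idt C ?V \<boxtimes> \<dots>)
        \<cdot> Asc C ?V ?V' ((?W \<otimes> ?Y) \<otimes> ?X) \<cdot> (?d \<boxtimes> Idt C ((?W \<otimes> ?Y) \<otimes> ?X))
      = Ev C ?X \<cdot> (Idt C ?V \<boxtimes> (Lun C ?X \<cdot> ((t (Y \<odot> A) \<boxtimes> Idt C ?X) \<cdot> (?K \<boxtimes> Idt C ?X)) \<cdot> cinv C (Asc C ?V' (?W \<otimes> ?Y) ?X)))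
        \<cdot> Asc C ?V ?V' ((?W \<otimes> ?Y) \<otimes> ?X) \<cdot> (?d \<boxtimes> Idt C ((?W \<otimes> ?Y) \<otimes> ?X))"
      by (simp add: t_twist_lift)
    also have "\<dots> = Ev C ?X \<cdot> (Idt C ?V \<boxtimes> (C.C.evA ?Y ?X \<cdot> (Idt C ?V' \<boxtimes> (?T \<boxtimes> Idt C ?X))))
        \<cdot> Asc C ?V ?V' ((?W \<otimes> ?Y) \<otimes> ?X) \<cdot> (?d \<boxtimes> Idt C ((?W \<otimes> ?Y) \<otimes> ?X))"
      by (simp only: K2 e1)
    also have "\<dots> = Ev C ?X \<cdot> (Idt C ?V \<boxtimes> C.C.evA ?Y ?X) \<cdot> Asc C ?V ?V' (?Y \<otimes> ?X) \<cdot> (?d \<boxtimes> Idt C (?Y \<otimes> ?X)) \<cdot> (Idt C ?Q \<boxtimes> (?T \<boxtimes> Idt C ?X))"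
      by (simp add: C.C.interchange C.C.interchange[THEN C.reassoc] C.C.mas_nat_3 C.C.mas_nat_3[THEN C.reassoc])
    finally show ?thesis by (simp only: J_def)
  qed
  show ?thesis
    by (rule t_ext_out[of ?N _ ?Q "S\<^sub>o A" ?J]) (simp only: L R E[THEN C.reassoc], auto simp: E[THEN C.reassoc])
qed

lemma twist_mun:
  assumes [simp]: "A \<in> Obj M"
  shows "S\<^sub>a (mun A) \<bullet> twist (Unt C) A = mun (S\<^sub>o A) \<bullet> (ddual_unt C \<star> Idt M (S\<^sub>o A))"
proof -
  let ?I = "Unt C" and ?D = "Dul C (Unt C)" and ?Q = "Dul C (Dul C (Unt C))" and ?W = "Ih A (S\<^sub>o A)"
  have D: "dual_unt C \<cdot> ddual_unt C = dual_map C (dual_unt C)"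
    by (simp add: ddual_unt_def)
  have E: "Ev C ?D \<cdot> (Idt C ?Q \<boxtimes> dual_unt C) = Lun C ?I \<cdot> (ddual_unt C \<boxtimes> Idt C ?I)"
    using C.Ev_dual_map[of "dual_unt C" ?I] by (simp add: C.Ev_dual_unt[THEN C.reassoc] flip: D)
  have "t A \<cdot> hm (Idt M A) (S\<^sub>a (mun A) \<bullet> twist ?I A) \<cdot> out ?Q A (S\<^sub>o A) \<cdot> (Idt C ?Q \<boxtimes> Run C ?W)
    = Ev C ?D \<cdot> (Idt C ?Q \<boxtimes> (Lun C ?D \<cdot> (t A \<boxtimes> Idt C ?D) \<cdot> (Idt C ?W \<boxtimes> dual_unt C)))"
    by (simp add: t_nat_r[THEN C.reassoc] hm_swap[THEN C.reassoc] out_nat_A[THEN C.reassoc]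
        inn_mun[symmetric, THEN C.C.lact_lift] t_twist_lift)
  also have "Lun C ?D \<cdot> (t A \<boxtimes> Idt C ?D) \<cdot> (Idt C ?W \<boxtimes> dual_unt C) = dual_unt C \<cdot> t A \<cdot> Run C ?W"
    by (simp add: C.C.interchange C.C.mun_nat[THEN C.reassoc] C.run_nat' C.lun_unt)
  also have "Ev C ?D \<cdot> (Idt C ?Q \<boxtimes> \<dots>) = Lun C ?I \<cdot> (ddual_unt C \<boxtimes> Idt C ?I) \<cdot> (Idt C ?Q \<boxtimes> (t A \<cdot> Run C ?W))"
    by (simp add: E[THEN C.reassoc])
  also have "\<dots> = t A \<cdot> hm (Idt M A) (mun (S\<^sub>o A) \<bullet> (ddual_unt C \<star> Idt M (S\<^sub>o A))) \<cdot> out ?Q A (S\<^sub>o A) \<cdot> (Idt C ?Q \<boxtimes> Run C ?W)"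
    by (simp add: out_nat_X[THEN C.reassoc] out_mun[THEN C.reassoc] C.C.interchange C.C.interchange[THEN C.reassoc] C.C.mun_nat[THEN C.reassoc])
  finally show ?thesis by (rule t_ext_out) auto
qed

section \<open>The universal property\<close>

text \<open>The trace as a point of \<open>Hom(A, S A)\<^sup>*\<close>.\<close>

definition \<tau> :: "'p \<Rightarrow> 'a" where
  "\<tau> A = lmate C (Unt C) (Ih A (S\<^sub>o A)) (t A \<cdot> Lun C (Ih A (S\<^sub>o A)))"

lemma tau_arr [simp]:
  assumes "A \<in> Obj M"
  shows "\<tau> A \<in> Arr C" "Dom C (\<tau> A) = Unt C" "Cod C (\<tau> A) = Dul C (Ih A (S\<^sub>o A))"
  using assms by (auto simp: \<tau>_def)

lemma Ev_tau: "A \<in> Obj M \<Longrightarrow> Ev C (Ih A (S\<^sub>o A)) \<cdot> (\<tau> A \<boxtimes> Idt C (Ih A (S\<^sub>o A))) = t A \<cdot> Lun C (Ih A (S\<^sub>o A))"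
  by (simp add: \<tau>_def C.Ev_lmate)

text \<open>Along the point \<open>\<tau> A\<close> the leg at \<open>S A\<close> is the identity of \<open>S
  A\<close>, up to the unit isomorphism.\<close>

lemma leg_tau:
  assumes [simp]: "A \<in> Obj M"
  shows "leg A (S\<^sub>o A) \<bullet> (\<tau> A \<star> Idt M (S\<^sub>o A)) = mun (S\<^sub>o A)"
  by (rule t_ext_out[of A _ "Unt C" "S\<^sub>o A" "Idt C (Ih A (S\<^sub>o A))"])
    (auto simp: t_leg_ract Ev_tau out_mun)

text \<open>Both points of \<open>Hom(A, Y \<odot> U)\<^sup>*\<close> are the trace of \<open>leg A U\<close>.\<close>

lemma dual_leg_tau:
  assumes [simp]: "A \<in> Obj M" "U \<in> Obj M"
  defines "Y \<equiv> Dul C (Ih A U)"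
  shows "dual_map C (hm (Idt M A) (leg A U)) \<cdot> \<tau> A = cinv C (od Y A U) \<cdot> Cv C Y"
proof -
  let ?W = "Ih A (Y \<odot> U)"
  have [simp]: "Y \<in> Obj C" by (simp add: Y_def)
  have c: "Cod C (Cv C Y) = Dul C (Ih A U) \<otimes> Dul C Y" by (simp add: Y_def)
  have [simp]: "Dom M (leg A U) = Y \<odot> U" "Dom C (Ev C (Ih A U)) = Y \<otimes> Ih A U" by (simp_all add: Y_def)
  have tl: "t A \<cdot> hm (Idt M A) (leg A U) = Ev C (Ih A U) \<cdot> cinv C (out Y A U)"
    unfolding Y_def by (rule t_leg_out) auto
  have "Ev C ?W \<cdot> ((dual_map C (hm (Idt M A) (leg A U)) \<cdot> \<tau> A) \<boxtimes> Idt C ?W) = Ev C ?W \<cdot> ((cinv C (od Y A U) \<cdot> Cv C Y) \<boxtimes> Idt C ?W)"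
  proof -
    have "Ev C ?W \<cdot> ((dual_map C (hm (Idt M A) (leg A U)) \<cdot> \<tau> A) \<boxtimes> Idt C ?W)
      = t A \<cdot> Lun C (Ih A (S\<^sub>o A)) \<cdot> (Idt C (Unt C) \<boxtimes> hm (Idt M A) (leg A U))"
      by (simp add: C.Ev_dual_map[THEN C.reassoc] C.C.interchange_r Ev_tau[THEN C.reassoc])
    also have "\<dots> = Ev C (Ih A U) \<cdot> cinv C (out Y A U) \<cdot> Lun C ?W"
      by (simp add: C.C.mun_nat tl[THEN C.reassoc])
    also have "\<dots> = Ev C ?W \<cdot> (cinv C (od Y A U) \<boxtimes> Idt C ?W) \<cdot> (Cv C Y \<boxtimes> Idt C ?W)"
      using Ev_cinv_od[of A U] by (simp add: Y_def)
    finally show ?thesis by (simp add: c)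
  qed
  then show ?thesis by (rule C.Ev_ext) (auto simp: c)
qed

text \<open>Uniqueness is \<open>leg_tau\<close>. For existence, dinaturality along \<open>leg A U\<close> and
  \<open>dual_leg_tau\<close> bring the coevaluation of \<open>Y = Hom(A, U)\<^sup>*\<close> in front of \<open>m (Y
  \<odot> U)\<close>; the balancing turns \<open>m (Y \<odot> U)\<close> into \<open>m U\<close> preceded by the
  evaluation of \<open>Y\<close>, and a zigzag identity remains.\<close>

lemma leg_universal:
  assumes [simp]: "A \<in> Obj M" and R [simp]: "R \<in> Obj M"
    and m: "\<And>U. U \<in> Obj M \<Longrightarrow> m U \<in> hom M (Dul C (Ih A U) \<odot> U) R"
    and din: "\<And>u. u \<in> Arr M \<Longrightarrow> m (Cod M u) \<bullet> (Idt C (Dul C (Ih A (Cod M u))) \<star> u)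
      = m (Dom M u) \<bullet> (dual_map C (hm (Idt M A) u) \<star> Idt M (Dom M u))"
    and bal: "\<And>X U. X \<in> Obj C \<Longrightarrow> U \<in> Obj M \<Longrightarrow> m (X \<odot> U) = m U \<bullet> (Idt C (Dul C (Ih A U)) \<star> evA X U)
      \<bullet> mas (Dul C (Ih A U)) (Dul C X) (X \<odot> U) \<bullet> (od X A U \<star> Idt M (X \<odot> U))"
  shows "\<exists>!g. g \<in> hom M (S\<^sub>o A) R \<and> (\<forall>U \<in> Obj M. g \<bullet> leg A U = m U)"
proof -
  have [simp]: "m U \<in> Arr M" "Dom M (m U) = Dul C (Ih A U) \<odot> U" "Cod M (m U) = R" if "U \<in> Obj M" for U
    using m[OF that] by (auto simp: hom_def)
  let ?S = "S\<^sub>o A"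
  let ?g = "m ?S \<bullet> (\<tau> A \<star> Idt M ?S) \<bullet> cinv M (mun ?S)"
  show ?thesis
  proof (rule ex1I)
    have "?g \<bullet> leg A U = m U" if [simp]: "U \<in> Obj M" for U
    proof -
      define Y where "Y = Dul C (Ih A U)"
      have [simp]: "Y \<in> Obj C" by (simp add: Y_def)
      have [simp]: "Dom M (leg A U) = Y \<odot> U" "Dom M (m U) = Y \<odot> U" by (simp_all add: Y_def)
      have [simp]: "Cod C (od Y A U) = Y \<otimes> Dul C Y" by (simp add: Y_def)
      have dt: "dual_map C (hm (Idt M A) (leg A U)) \<cdot> \<tau> A = cinv C (od Y A U) \<cdot> Cv C Y"
        unfolding Y_def by (rule dual_leg_tau) auto
      have din': "m ?S \<bullet> (Idt C (Dul C (Ih A ?S)) \<star> leg A U) = m (Y \<odot> U) \<bullet> (dual_map C (hm (Idt M A) (leg A U)) \<star> Idt M (Y \<odot> U))"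
        using din[of "leg A U"] by simp
      have bal': "m (Y \<odot> U) \<bullet> (cinv C (od Y A U) \<star> Idt M (Y \<odot> U)) = m U \<bullet> (Idt C Y \<star> evA Y U) \<bullet> mas Y (Dul C Y) (Y \<odot> U)"
        using bal[of Y U] by (simp flip: Y_def)
      have "?g \<bullet> leg A U = m ?S \<bullet> (Idt C (Dul C (Ih A ?S)) \<star> leg A U) \<bullet> (\<tau> A \<star> Idt M (Y \<odot> U)) \<bullet> cinv M (mun (Y \<odot> U))"
        using cmun_nat[of "leg A U" "Y \<odot> U"]
        by (simp add: interchange_r[THEN M.reassoc])
      also have "\<dots> = m (Y \<odot> U) \<bullet> ((dual_map C (hm (Idt M A) (leg A U)) \<cdot> \<tau> A) \<star> Idt M (Y \<odot> U)) \<bullet> cinv M (mun (Y \<odot> U))"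
        by (simp add: din'[THEN M.reassoc])
      also have "\<dots> = m (Y \<odot> U) \<bullet> (cinv C (od Y A U) \<star> Idt M (Y \<odot> U)) \<bullet> (Cv C Y \<star> Idt M (Y \<odot> U)) \<bullet> cinv M (mun (Y \<odot> U))"
        by (simp add: dt)
      also have "\<dots> = m U \<bullet> (Idt C Y \<star> evA Y U) \<bullet> cvA Y (Y \<odot> U)"
        by (simp add: bal'[THEN M.reassoc] copair_def)
      also have "\<dots> = m U" by simp
      finally show ?thesis .
    qed
    then show "?g \<in> hom M ?S R \<and> (\<forall>U \<in> Obj M. ?g \<bullet> leg A U = m U)"
      by (auto intro!: homI)
  next
    fix g assume g: "g \<in> hom M ?S R \<and> (\<forall>U \<in> Obj M. g \<bullet> leg A U = m U)"
    then have [simp]: "g \<in> Arr M" "Dom M g = ?S" "Cod M g = R" and e: "g \<bullet> leg A ?S = m ?S" by (auto simp: hom_def)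
    have "?g = g \<bullet> (leg A ?S \<bullet> (\<tau> A \<star> Idt M ?S)) \<bullet> cinv M (mun ?S)"
      by (simp flip: e)
    also have "\<dots> = g" by (simp add: leg_tau)
    finally show "g = ?g" by simp
  qed
qed

end

section \<open>Traces from relative Serre functors\<close>

context serre
begin

text \<open>The arrow \<open>Hom(A, S A) \<rightarrow> 1\<close> that corresponds to the identity of \<open>S
  A\<close> under \<open>Hom(S A, S A) \<simeq> Hom(A, S A)\<^sup>*\<close>.\<close>

definition trace_of :: "('p \<Rightarrow> 'p \<Rightarrow> 'a) \<Rightarrow> 'p \<Rightarrow> 'a" where
  "trace_of p A = Ev C (Ih A (S\<^sub>o A)) \<cdot> ((cinv C (p A (S\<^sub>o A)) \<cdot> point (S\<^sub>o A) (S\<^sub>o A) (Idt M (S\<^sub>o A))) \<boxtimes> Idt C (Ih A (S\<^sub>o A)))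
    \<cdot> cinv C (Lun C (Ih A (S\<^sub>o A)))"

context
  fixes p
  assumes p: "serre_iso C M H S p"
begin

lemma p_arr [simp]:
  assumes "A \<in> Obj M" "B \<in> Obj M"
  shows "p A B \<in> Arr C" "Dom C (p A B) = Dul C (Ih A B)" "Cod C (p A B) = Ih B (S\<^sub>o A)" "iso_arrow C (p A B)"
  using p assms by (auto simp: serre_iso_def hom_def)

lemma p_nat:
  "f \<in> Arr M \<Longrightarrow> g \<in> Arr M \<Longrightarrow>
    p (Cod M f) (Dom M g) \<cdot> dual_map C (hm f g) = hm g (S\<^sub>a f) \<cdot> p (Dom M f) (Cod M g)"
  using p by (auto simp: serre_iso_def)

definition dual_point :: "'p \<Rightarrow> 'p \<Rightarrow> 'b \<Rightarrow> 'a" where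
  "dual_point A B f = cinv C (p A B) \<cdot> point B (S\<^sub>o A) f"

lemma dual_point_arr [simp]:
  assumes "A \<in> Obj M" "f \<in> Arr M" "Dom M f = B" "Cod M f = S\<^sub>o A"
  shows "dual_point A B f \<in> Arr C" "Dom C (dual_point A B f) = Unt C" "Cod C (dual_point A B f) = Dul C (Ih A B)"
proof -
  have [simp]: "B \<in> Obj M" using assms by auto
  show "dual_point A B f \<in> Arr C" "Dom C (dual_point A B f) = Unt C" "Cod C (dual_point A B f) = Dul C (Ih A B)"
    using assms by (auto simp: dual_point_def)
qed

lemma dual_hmR_dual_point:
  assumes [simp]: "A \<in> Obj M" "f \<in> Arr M" "Cod M f = S\<^sub>o A" "g \<in> Arr M" "Dom M f = B" "Cod M g = B"
  shows "dual_map C (hm (Idt M A) g) \<cdot> dual_point A B f = dual_point A (Dom M g) (f \<bullet> g)"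
proof -
  have [simp]: "B \<in> Obj M" using M.cod_obj[of g] by simp
  have "dual_map C (hm (Idt M A) g) \<cdot> cinv C (p A B) = cinv C (p A (Dom M g)) \<cdot> hm g (Idt M (S\<^sub>o A))"
    using p_nat[of "Idt M A" g] by (intro C.inverse_square) auto
  from this[THEN C.reassoc] show ?thesis
    by (simp add: dual_point_def hmL_point)
qed

lemma dual_hmL_dual_point:
  assumes [simp]: "f \<in> Arr M" "Cod M f = S\<^sub>o A" "g \<in> Arr M" "Dom M f = B" "Dom M g = A"
  shows "dual_map C (hm g (Idt M B)) \<cdot> dual_point A B f = dual_point (Cod M g) B (S\<^sub>a g \<bullet> f)"
proof -
  have [simp]: "B \<in> Obj M" "A \<in> Obj M" using M.dom_obj[of f] M.dom_obj[of g] by simp_all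
  have "dual_map C (hm g (Idt M B)) \<cdot> cinv C (p A B) = cinv C (p (Cod M g) B) \<cdot> hm (Idt M B) (S\<^sub>a g)"
    using p_nat[of g "Idt M B"] by (intro C.inverse_square) auto
  from this[THEN C.reassoc] show ?thesis
    by (simp add: dual_point_def hmR_point)
qed

lemma trace_of_arr [simp]:
  assumes "A \<in> Obj M"
  shows "trace_of p A \<in> Arr C" "Dom C (trace_of p A) = Ih A (S\<^sub>o A)" "Cod C (trace_of p A) = Unt C"
  using assms by (auto simp: trace_of_def)

lemma trace_of_dual_point: "trace_of p A = Ev C (Ih A (S\<^sub>o A)) \<cdot> (dual_point A (S\<^sub>o A) (Idt M (S\<^sub>o A)) \<boxtimes> Idt C (Ih A (S\<^sub>o A))) \<cdot> cinv C (Lun C (Ih A (S\<^sub>o A)))"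
  by (simp add: trace_of_def dual_point_def)

text \<open>The naturality of \<open>p\<close> in its second argument makes the trace of an arbitrary \<open>f\<close>
  correspond to \<open>f\<close> under \<open>p\<close>, as in the Yoneda lemma.\<close>

lemma trace_of_hm:
  assumes [simp]: "A \<in> Obj M" "f \<in> Arr M" "Dom M f = B" "Cod M f = S\<^sub>o A"
  shows "trace_of p A \<cdot> hm (Idt M A) f = Ev C (Ih A B) \<cdot> (dual_point A B f \<boxtimes> Idt C (Ih A B)) \<cdot> cinv C (Lun C (Ih A B))"
proof -
  have [simp]: "B \<in> Obj M" using M.dom_obj[of f] by simp
  have "cinv C (Lun C (Ih A (S\<^sub>o A))) \<cdot> hm (Idt M A) f = (Idt C (Unt C) \<boxtimes> hm (Idt M A) f) \<cdot> cinv C (Lun C (Ih A B))"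
    by (simp add: C.C.cmun_nat)
  then have "trace_of p A \<cdot> hm (Idt M A) f
    = Ev C (Ih A B) \<cdot> ((dual_map C (hm (Idt M A) f) \<cdot> dual_point A (S\<^sub>o A) (Idt M (S\<^sub>o A))) \<boxtimes> Idt C (Ih A B)) \<cdot> cinv C (Lun C (Ih A B))"
    by (simp add: trace_of_dual_point C.C.interchange[THEN C.reassoc] C.Ev_dual_map[THEN C.reassoc])
  then show ?thesis by (simp add: dual_hmR_dual_point)
qed

lemma trace_trace_of: "trace C M H S (trace_of p)"
proof unfold_locales
  fix A B assume [simp]: "A \<in> Obj M" "B \<in> Obj M"
  show "trace_of p A \<in> hom C (Ih A (S\<^sub>o A)) (Unt C)" by (simp add: hom_def)
  show "bij_betw (\<lambda>f. trace_of p A \<cdot> hm (Idt M A) f) (hom M B (S\<^sub>o A)) (hom C (Ih A B) (Unt C))"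
    unfolding bij_betw_def
  proof (intro conjI inj_onI subset_antisym subsetI)
    fix f g assume f: "f \<in> hom M B (S\<^sub>o A)" "g \<in> hom M B (S\<^sub>o A)" and e: "trace_of p A \<cdot> hm (Idt M A) f = trace_of p A \<cdot> hm (Idt M A) g"
    then have [simp]: "f \<in> Arr M" "Dom M f = B" "Cod M f = S\<^sub>o A" "g \<in> Arr M" "Dom M g = B" "Cod M g = S\<^sub>o A" by (auto simp: hom_def)
    have "dual_point A B f = dual_point A B g"
    proof (rule C.Ev_ext[of "Ih A B"])
      show "Ev C (Ih A B) \<cdot> (dual_point A B f \<boxtimes> Idt C (Ih A B)) = Ev C (Ih A B) \<cdot> (dual_point A B g \<boxtimes> Idt C (Ih A B))"
        by (rule C.iso_cancel_right[of "cinv C (Lun C (Ih A B))"]) (use e in \<open>auto simp: trace_of_hm\<close>)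
    qed auto
    then have "point B (S\<^sub>o A) f = point B (S\<^sub>o A) g"
      unfolding dual_point_def by (rule C.iso_cancel_left[rotated]) auto
    then show "f = g" using point_ex1[of B "S\<^sub>o A" "point B (S\<^sub>o A) g"] f by auto
  next
    fix k assume "k \<in> hom C (Ih A B) (Unt C)"
    then have [simp]: "k \<in> Arr C" "Dom C k = Ih A B" "Cod C k = Unt C" by (auto simp: hom_def)
    let ?h = "lmate C (Unt C) (Ih A B) (k \<cdot> Lun C (Ih A B))"
    obtain f where f: "f \<in> hom M B (S\<^sub>o A)" "point B (S\<^sub>o A) f = p A B \<cdot> ?h"
      using point_ex1[of B "S\<^sub>o A" "p A B \<cdot> ?h"] by auto
    then have [simp]: "f \<in> Arr M" "Dom M f = B" "Cod M f = S\<^sub>o A" by (auto simp: hom_def)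
    have "dual_point A B f = ?h" by (simp add: dual_point_def f)
    then have "trace_of p A \<cdot> hm (Idt M A) f = k"
      by (simp add: trace_of_hm C.Ev_lmate[THEN C.reassoc])
    then show "k \<in> (\<lambda>f. trace_of p A \<cdot> hm (Idt M A) f) ` hom M B (S\<^sub>o A)"
      using f by auto
  qed (auto simp: hom_def)
next
  fix f assume [simp]: "f \<in> Arr M"
  let ?A = "Dom M f" let ?S = "S\<^sub>o ?A"
  have "cinv C (Lun C (Ih ?A ?S)) \<cdot> hm f (Idt M ?S) = (Idt C (Unt C) \<boxtimes> hm f (Idt M ?S)) \<cdot> cinv C (Lun C (Ih (Cod M f) ?S))"
    by (simp add: C.C.cmun_nat)
  then have "trace_of p ?A \<cdot> hm f (Idt M ?S)
    = Ev C (Ih (Cod M f) ?S) \<cdot> ((dual_map C (hm f (Idt M ?S)) \<cdot> dual_point ?A ?S (Idt M ?S)) \<boxtimes> Idt C (Ih (Cod M f) ?S)) \<cdot> cinv C (Lun C (Ih (Cod M f) ?S))"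
    by (simp add: trace_of_dual_point C.C.interchange[THEN C.reassoc] C.Ev_dual_map[THEN C.reassoc])
  also have "\<dots> = trace_of p (Cod M f) \<cdot> hm (Idt M (Cod M f)) (S\<^sub>a f)"
    by (simp add: dual_hmL_dual_point trace_of_hm)
  finally show "trace_of p ?A \<cdot> hm f (Idt M ?S) = trace_of p (Cod M f) \<cdot> hm (Idt M (Cod M f)) (S\<^sub>a f)" .
qed

text \<open>The balancing of \<open>p\<close> at \<open>Y = Hom(A, U)\<^sup>*\<close> shows that the transpose of
  \<open>p A U\<close> corresponds under \<open>p\<close> to the coevaluation of \<open>Y\<close>, so that its trace
  is the evaluation. This characterises the leg.\<close>

lemma phi_trace_of:
  assumes bal: "serre_iso_balanced C M H S p" and [simp]: "A \<in> Obj M" "U \<in> Obj M"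
  shows "trace.\<phi> C M H S (trace_of p) A U = p A U"
proof -
  interpret t: trace C M H S "trace_of p" by (rule trace_trace_of)
  define Y where "Y = Dul C (Ih A U)"
  have [simp]: "Y \<in> Obj C" by (simp add: Y_def)
  let ?W' = "Ih A (Y \<odot> U)"
  let ?leg = "iev U (S\<^sub>o A) \<bullet> (p A U \<star> Idt M U)"
  have [simp]: "Dom C (p A U) = Y" "Dom M (t.leg A U) = Y \<odot> U" "Cod C (od Y A U) = Y \<otimes> Dul C Y" "Dom C (Ev C (Ih A U)) = Y \<otimes> Ih A U"
    by (simp_all add: Y_def)
  have "inn Y U (S\<^sub>o A) \<cdot> (p A U \<boxtimes> Idt C (Dul C Y)) \<cdot> Cv C Y = point (Y \<odot> U) (S\<^sub>o A) ?leg"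
  proof (rule Ih_ext[of "Y \<odot> U" "S\<^sub>o A"])
    have "iev (Y \<odot> U) (S\<^sub>o A) \<bullet> ((inn Y U (S\<^sub>o A) \<cdot> (p A U \<boxtimes> Idt C (Dul C Y)) \<cdot> Cv C Y) \<star> Idt M (Y \<odot> U))
      = ?leg \<bullet> (Idt C Y \<star> evA Y U) \<bullet> cvA Y (Y \<odot> U) \<bullet> mun (Y \<odot> U)"
      by (simp add: iev_inn[THEN M.reassoc] mas_nat_1[THEN M.reassoc] interchange_r[THEN M.reassoc] copair_def)
    also have "\<dots> = ?leg \<bullet> mun (Y \<odot> U)" by simp
    finally show "iev (Y \<odot> U) (S\<^sub>o A) \<bullet> ((inn Y U (S\<^sub>o A) \<cdot> (p A U \<boxtimes> Idt C (Dul C Y)) \<cdot> Cv C Y) \<star> Idt M (Y \<odot> U))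
      = iev (Y \<odot> U) (S\<^sub>o A) \<bullet> (point (Y \<odot> U) (S\<^sub>o A) ?leg \<star> Idt M (Y \<odot> U))"
      by (simp add: iev_point)
  qed auto
  moreover have "p A (Y \<odot> U) = inn Y U (S\<^sub>o A) \<cdot> (p A U \<boxtimes> Idt C (Dul C Y)) \<cdot> od Y A U"
    using bal by (simp add: serre_iso_balanced_def)
  ultimately have "p A (Y \<odot> U) \<cdot> cinv C (od Y A U) \<cdot> Cv C Y = point (Y \<odot> U) (S\<^sub>o A) ?leg"
    by simp
  then have dual_point: "dual_point A (Y \<odot> U) ?leg = cinv C (od Y A U) \<cdot> Cv C Y"
    by (simp add: dual_point_def flip: \<open>p A (Y \<odot> U) \<cdot> cinv C (od Y A U) \<cdot> Cv C Y = _\<close>)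
  have "trace_of p A \<cdot> hm (Idt M A) ?leg = Ev C ?W' \<cdot> ((cinv C (od Y A U) \<cdot> Cv C Y) \<boxtimes> Idt C ?W') \<cdot> cinv C (Lun C ?W')"
    unfolding dual_point[symmetric] by (rule trace_of_hm) auto
  also have "\<dots> = (Ev C ?W' \<cdot> (cinv C (od Y A U) \<boxtimes> Idt C ?W') \<cdot> (Cv C Y \<boxtimes> Idt C ?W')) \<cdot> cinv C (Lun C ?W')"
    by simp
  also have "Ev C ?W' \<cdot> (cinv C (od Y A U) \<boxtimes> Idt C ?W') \<cdot> (Cv C Y \<boxtimes> Idt C ?W') = Ev C (Ih A U) \<cdot> cinv C (out Y A U) \<cdot> Lun C ?W'"
    unfolding Y_def by (rule Ev_cinv_od) auto
  also have "(Ev C (Ih A U) \<cdot> cinv C (out Y A U) \<cdot> Lun C ?W') \<cdot> cinv C (Lun C ?W') = Ev C (Ih A U) \<cdot> cinv C (out Y A U)"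
    by simp
  also have "\<dots> = trace_of p A \<cdot> hm (Idt M A) (t.leg A U)"
    unfolding Y_def by (rule t.t_leg_out[symmetric]) auto
  finally have "?leg = t.leg A U"
    by (rule t.t_ext) auto
  then show ?thesis
    by - (rule Ih_ext[of U "S\<^sub>o A"], auto simp: t.iev_phi Y_def)
qed

end

end

section \<open>Module coends over the opposite category\<close>

lemma category_op_cat: "category N \<Longrightarrow> category (op_cat N)"
  by (auto simp: category_def op_cat_def hom_def)

lemma category_prod_cat:
  assumes "category N" "category N'"
  shows "category (prod_cat N N')"
  using assms by (auto simp: category_def prod_cat_def hom_def)

lemma (in category) iso_cancel_right_iff:
  "iso_arrow C w \<Longrightarrow> f \<in> Arr C \<Longrightarrow> g \<in> Arr C \<Longrightarrow> Dom C f = Cod C w \<Longrightarrow> Dom C g = Cod C w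
    \<Longrightarrow> f \<cdot> w = g \<cdot> w \<longleftrightarrow> f = g"
  using iso_cancel_right[of w f g] by auto

context tensor_category
begin

lemma pair_inj:
  assumes e: "C.pair D X p (Unt C) = C.pair D X q (Unt C)"
    and [simp]: "D \<in> Obj C" "X \<in> Obj C" "p \<in> Arr C" "Dom C p = D \<otimes> X" "Cod C p = Unt C"
      "q \<in> Arr C" "Dom C q = D \<otimes> X" "Cod C q = Unt C"
  shows "p = q"
proof (rule run_faithful)
  have "(p \<boxtimes> Idt C (Unt C)) \<cdot> cinv C (Asc C D X (Unt C)) = (q \<boxtimes> Idt C (Unt C)) \<cdot> cinv C (Asc C D X (Unt C))"
    by (rule iso_cancel_left[of "Lun C (Unt C)"]) (use e in \<open>auto simp: C.pair_def\<close>)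
  then show "p \<boxtimes> Idt C (Unt C) = q \<boxtimes> Idt C (Unt C)"
    by (simp add: iso_cancel_right_iff)
qed auto

lemma evA_ext:
  assumes e: "C.evA X (Unt C) \<cdot> (g \<boxtimes> Idt C (X \<otimes> Unt C)) = C.evA X (Unt C) \<cdot> (h \<boxtimes> Idt C (X \<otimes> Unt C))"
    and [simp]: "X \<in> Obj C" "g \<in> Arr C" "Cod C g = Dul C X" "h \<in> Arr C" "Cod C h = Dul C X" "Dom C g = Dom C h"
  shows "g = h"
proof (rule Ev_ext)
  show "Ev C X \<cdot> (g \<boxtimes> Idt C X) = Ev C X \<cdot> (h \<boxtimes> Idt C X)"
    by (rule pair_inj[of "Dom C h" X]) (use e in \<open>auto simp: C.pair_ract\<close>)
qed auto

lemma rmate_arr [simp]: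
  assumes "X \<in> Obj C" "A \<in> Obj C" "f \<in> Arr C" "Dom C f = X \<otimes> A" "Cod C f = Unt C"
  shows "rmate C X A f \<in> Arr C" "Dom C (rmate C X A f) = A" "Cod C (rmate C X A f) = Dur C X"
  using assms by (auto simp: rmate_def)

lemma Evr_rmate:
  assumes [simp]: "X \<in> Obj C" "A \<in> Obj C" "f \<in> Arr C" "Dom C f = X \<otimes> A" "Cod C f = Unt C"
  shows "Evr C X \<cdot> (Idt C X \<boxtimes> rmate C X A f) = f"
proof (rule pair_inj[of X A])
  let ?I = "Unt C"
  have r: "rmate C X A f \<boxtimes> Idt C ?I = (Idt C (Dur C X) \<boxtimes> C.pair X A f ?I) \<cdot> C.copair (Dur C X) X (Cvr C X) (A \<otimes> ?I)"
    by (simp add: C.lact_pair_copair) (simp add: rmate_def)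
  have "C.pair X A (Evr C X \<cdot> (Idt C X \<boxtimes> rmate C X A f)) ?I
    = C.pair X (Dur C X) (Evr C X) ?I \<cdot> (Idt C X \<boxtimes> (rmate C X A f \<boxtimes> Idt C ?I))"
    by (simp add: C.pair_lact)
  also have "\<dots> = C.pair X A f ?I"
    by (simp add: r C.pair_nat[THEN reassoc] C.zigzag_2[OF right_dual])
  finally show "C.pair X A (Evr C X \<cdot> (Idt C X \<boxtimes> rmate C X A f)) ?I = C.pair X A f ?I" .
qed auto

lemma rdual_map_arr [simp]:
  assumes "f \<in> Arr C"
  shows "rdual_map C f \<in> Arr C" "Dom C (rdual_map C f) = Dur C (Cod C f)" "Cod C (rdual_map C f) = Dur C (Dom C f)"
  using assms by (auto simp: rdual_map_def)

lemma Evr_rdual_map: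
  assumes [simp]: "f \<in> Arr C" "Dom C f = X"
  shows "Evr C X \<cdot> (Idt C X \<boxtimes> rdual_map C f) = Evr C (Cod C f) \<cdot> (f \<boxtimes> Idt C (Dur C (Cod C f)))"
proof -
  have [simp]: "X \<in> Obj C" using dom_obj[of f] by simp
  show ?thesis by (simp add: rdual_map_def Evr_rmate)
qed

lemma dual_rdual_nat:
  assumes [simp]: "f \<in> Arr C"
  shows "dual_map C (rdual_map C f) \<cdot> dual_rdual C (Dom C f) = dual_rdual C (Cod C f) \<cdot> f"
  by (rule Ev_ext[of "Dur C (Cod C f)"])
    (auto simp: Ev_dual_map[THEN reassoc] C.interchange_r Ev_dual_rdual[THEN reassoc] Evr_rdual_map)

text \<open>The balancing condition of a module coend involves the coevaluation of \<open>\<^sup>*X\<close>, whereas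
  here evaluations are used. This identity relates them; it is the zigzag identity of \<open>\<^sup>*X\<close> seen
  through the duals.\<close>

lemma dual_Cvr:
  assumes [simp]: "X \<in> Obj C"
  shows "dual_map C (Cvr C X) \<cdot> dual_ten C (Dur C X) X \<cdot> (Idt C (Dul C X) \<boxtimes> dual_rdual C X) = dual_unt C \<cdot> Ev C X"
proof (rule evA_ext[of "Unt C"])
  let ?I = "Unt C" and ?Y = "Dur C X" and ?X = "Dul C X"
  let ?N = ?I
  have a: "Asc C ?Y X ?N \<cdot> (Cvr C X \<boxtimes> Idt C ?N) = C.copair ?Y X (Cvr C X) ?N \<cdot> Lun C ?N"
    by (simp add: C.copair_def)
  have b: "C.evA ?Y (X \<otimes> ?N) \<cdot> (dual_rdual C X \<boxtimes> Idt C (?Y \<otimes> (X \<otimes> ?N))) = C.pair X ?Y (Evr C X) (X \<otimes> ?N)"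
    unfolding dual_rdual_def by (rule C.evA_lmate) auto
  have "C.evA ?I ?N \<cdot> ((dual_map C (Cvr C X) \<cdot> dual_ten C ?Y X \<cdot> (Idt C ?X \<boxtimes> dual_rdual C X)) \<boxtimes> Idt C (?I \<otimes> ?N))
    = C.evA (?Y \<otimes> X) ?N \<cdot> (dual_ten C ?Y X \<boxtimes> Idt C ((?Y \<otimes> X) \<otimes> ?N)) \<cdot> (Idt C (?X \<otimes> Dul C ?Y) \<boxtimes> (Cvr C X \<boxtimes> Idt C ?N))
      \<cdot> ((Idt C ?X \<boxtimes> dual_rdual C X) \<boxtimes> Idt C (?I \<otimes> ?N))"
    by (simp add: C.evA_dual_map[THEN reassoc] C.interchange_r[THEN reassoc])
  also have "\<dots> = C.evA X ?N \<cdot> (Idt C ?X \<boxtimes> C.evA ?Y (X \<otimes> ?N)) \<cdot> Asc C ?X (Dul C ?Y) (?Y \<otimes> (X \<otimes> ?N))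
      \<cdot> (Idt C (?X \<otimes> Dul C ?Y) \<boxtimes> (Asc C ?Y X ?N \<cdot> (Cvr C X \<boxtimes> Idt C ?N))) \<cdot> ((Idt C ?X \<boxtimes> dual_rdual C X) \<boxtimes> Idt C (?I \<otimes> ?N))"
    by (simp add: C.evA_dual_ten[THEN reassoc])
  also have "\<dots> = C.evA X ?N \<cdot> (Idt C ?X \<boxtimes> C.evA ?Y (X \<otimes> ?N)) \<cdot> Asc C ?X (Dul C ?Y) (?Y \<otimes> (X \<otimes> ?N))
      \<cdot> ((Idt C ?X \<boxtimes> dual_rdual C X) \<boxtimes> Idt C (?Y \<otimes> (X \<otimes> ?N))) \<cdot> (Idt C (?X \<otimes> X) \<boxtimes> (C.copair ?Y X (Cvr C X) ?N \<cdot> Lun C ?N))"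
    by (simp only: a) (simp add: C.interchange C.interchange[THEN reassoc])
  also have "\<dots> = C.evA X ?N \<cdot> (Idt C ?X \<boxtimes> (C.evA ?Y (X \<otimes> ?N) \<cdot> (dual_rdual C X \<boxtimes> Idt C (?Y \<otimes> (X \<otimes> ?N)))))
      \<cdot> Asc C ?X X (?Y \<otimes> (X \<otimes> ?N)) \<cdot> (Idt C (?X \<otimes> X) \<boxtimes> (C.copair ?Y X (Cvr C X) ?N \<cdot> Lun C ?N))"
    by (simp add: C.mas_nat_2[THEN reassoc])
  also have "\<dots> = C.evA X ?N \<cdot> (Idt C ?X \<boxtimes> C.pair X ?Y (Evr C X) (X \<otimes> ?N)) \<cdot> (Idt C ?X \<boxtimes> (Idt C X \<boxtimes> C.copair ?Y X (Cvr C X) ?N))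
      \<cdot> (Idt C ?X \<boxtimes> (Idt C X \<boxtimes> Lun C ?N)) \<cdot> Asc C ?X X (?I \<otimes> ?N)"
    by (simp only: b) (simp add: C.mas_nat_3 C.mas_nat_3[THEN reassoc])
  also have "\<dots> = C.evA X ?N \<cdot> (Idt C ?X \<boxtimes> (Idt C X \<boxtimes> Lun C ?N)) \<cdot> Asc C ?X X (?I \<otimes> ?N)"
    by (simp add: C.zigzag_2[OF right_dual, THEN C.lact_lift, THEN reassoc])
  also have "\<dots> = Lun C ?N \<cdot> Lun C (?I \<otimes> ?N) \<cdot> (Ev C X \<boxtimes> Idt C (?I \<otimes> ?N))"
    by (simp add: C.pair_nat[THEN reassoc] C.pair_mas[where D = ?X and X = X])
  also have "\<dots> = C.evA ?I ?N \<cdot> ((dual_unt C \<cdot> Ev C X) \<boxtimes> Idt C (?I \<otimes> ?N))"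
    by (simp add: C.evA_dual_unt[THEN reassoc])
  finally show "C.evA ?I ?N \<cdot> ((dual_map C (Cvr C X) \<cdot> dual_ten C ?Y X \<cdot> (Idt C ?X \<boxtimes> dual_rdual C X)) \<boxtimes> Idt C (?I \<otimes> ?N))
    = C.evA ?I ?N \<cdot> ((dual_unt C \<cdot> Ev C X) \<boxtimes> Idt C (?I \<otimes> ?N))" .
qed auto

end

context ihom_action
begin

abbreviation "opM \<equiv> op_module C M"

lemma opM_simps [simp]:
  "Obj opM = Obj M" "Arr opM = Arr M" "Dom opM = Cod M" "Cod opM = Dom M" "Idt opM = Idt M"
  "Cmp opM = (\<lambda>g f. f \<bullet> g)" "RActO opM = (\<lambda>A X. Dul C X \<odot> A)" "RActA opM = (\<lambda>u f. dual_map C f \<star> u)"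
  "RMAs opM = (\<lambda>A X Y. (dual_ten C X Y \<star> Idt M A) \<bullet> cinv M (mas (Dul C Y) (Dul C X) A))"
  "RMUn opM = (\<lambda>A. (dual_unt C \<star> Idt M A) \<bullet> cinv M (mun A))"
  by (simp_all add: op_module_def)

lemma cinv_opM [simp]: "cinv opM = cinv M"
  by (rule ext) (auto simp: cinv_def inverse_arrows_def hom_def intro!: arg_cong[of _ _ The])

lemma category_opM: "category opM"
  using M.category_axioms by (auto simp: category_def hom_def)

lemma serre_T_simps [simp]:
  "fob (serre_T C M H A) (U, V) = Dul C (Ih A V) \<odot> U"
  "far (serre_T C M H A) (u, v) = dual_map C (hm (Idt M A) v) \<star> u"
  by (simp_all add: serre_T_def)

lemma serre_T_functor:
  assumes [simp]: "A \<in> Obj M"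
  shows "is_functor (prod_cat (op_cat opM) opM) M (serre_T C M H A)"
  unfolding is_functor_def
  by (intro conjI category_prod_cat category_op_cat category_opM M.category_axioms)
    (auto simp: prod_cat_def op_cat_def hom_def C.dual_map_cmp act_cmp)

lemma cinv_od:
  assumes "X \<in> Obj C" "A \<in> Obj M" "V \<in> Obj M"
  shows "cinv C (od X A V) = dual_map C (cinv C (out X A V)) \<cdot> dual_ten C X (Ih A V)"
  using assms by (simp add: ih_out_dual_def C.cinv_cmp C.cinv_dual_map)

lemma serre_gamma_eq:
  assumes "X \<in> Obj C" "A \<in> Obj M" "U \<in> Obj M" "V \<in> Obj M"
  shows "serre_gamma C M H A X U V
    = ((dual_map C (hm (Idt M A) (cinv C (dual_rdual C X) \<star> Idt M V)) \<cdot> cinv C (od X A V)) \<star> Idt M U)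
      \<bullet> cinv M (mas (Dul C (Ih A V)) (Dul C X) U)"
  using assms by (simp add: serre_gamma_def cinv_od)

lemma Ev_cinv_od_out:
  assumes [simp]: "X \<in> Obj C" "A \<in> Obj M" "V \<in> Obj M"
  shows "Ev C (Ih A (X \<odot> V)) \<cdot> (cinv C (od X A V) \<boxtimes> Idt C (Ih A (X \<odot> V))) \<cdot> (Idt C (Dul C (Ih A V) \<otimes> Dul C X) \<boxtimes> out X A V)
    = Ev C (Ih A V) \<cdot> (Idt C (Dul C (Ih A V)) \<boxtimes> C.C.evA X (Ih A V)) \<cdot> Asc C (Dul C (Ih A V)) (Dul C X) (X \<otimes> Ih A V)"
  by (simp add: C.C.interchange Ev_od[THEN C.reassoc])

text \<open>Both sides pair with \<open>X \<otimes> Hom(A, V)\<close> by applying \<open>f\<close> and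
  \<open>b\<close> and then evaluating.\<close>

lemma cinv_od_nat:
  assumes [simp]: "f \<in> Arr C" "b \<in> Arr M" "A \<in> Obj M"
  shows "cinv C (od (Dom C f) A (Dom M b)) \<cdot> (dual_map C (hm (Idt M A) b) \<boxtimes> dual_map C f)
    = dual_map C (hm (Idt M A) (f \<star> b)) \<cdot> cinv C (od (Cod C f) A (Cod M b))"
proof -
  let ?X = "Dom C f" and ?X' = "Cod C f" and ?V = "Dom M b" and ?V' = "Cod M b"
  let ?W = "Ih A ?V" and ?W' = "Ih A ?V'" and ?Z = "Ih A (?X \<odot> ?V)" and ?Z' = "Ih A (?X' \<odot> ?V')"
  let ?D = "Dul C ?W' \<otimes> Dul C ?X'" and ?b = "hm (Idt M A) b" and ?fb = "hm (Idt M A) (f \<star> b)"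
  have fb: "?fb \<cdot> out ?X A ?V = out ?X' A ?V' \<cdot> (Idt C ?X' \<boxtimes> ?b) \<cdot> (f \<boxtimes> Idt C ?W)"
    by (subst act_split) (auto simp: out_nat_X out_nat_B[THEN C.reassoc])
  have db: "dual_map C ?b \<boxtimes> dual_map C f = (dual_map C ?b \<boxtimes> Idt C (Dul C ?X)) \<cdot> (Idt C (Dul C ?W') \<boxtimes> dual_map C f)"
    using C.C.act_cmp[of "dual_map C ?b" "Idt C (Dul C ?W')" "Idt C (Dul C ?X)" "dual_map C f"] by simp
  show ?thesis
  proof (rule C.Ev_ext[of ?Z])
    have "(Ev C ?Z \<cdot> ((cinv C (od ?X A ?V) \<cdot> (dual_map C ?b \<boxtimes> dual_map C f)) \<boxtimes> Idt C ?Z)) \<cdot> (Idt C ?D \<boxtimes> out ?X A ?V)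
      = Ev C ?Z \<cdot> (cinv C (od ?X A ?V) \<boxtimes> Idt C ?Z) \<cdot> (Idt C (Dul C ?W \<otimes> Dul C ?X) \<boxtimes> out ?X A ?V) \<cdot> ((dual_map C ?b \<boxtimes> dual_map C f) \<boxtimes> Idt C (?X \<otimes> ?W))"
      by (simp add: C.C.interchange)
    also have "\<dots> = Ev C ?W \<cdot> (Idt C (Dul C ?W) \<boxtimes> C.C.evA ?X ?W) \<cdot> Asc C (Dul C ?W) (Dul C ?X) (?X \<otimes> ?W) \<cdot> ((dual_map C ?b \<boxtimes> dual_map C f) \<boxtimes> Idt C (?X \<otimes> ?W))"
      by (simp add: Ev_cinv_od_out[THEN C.reassoc3])
    also have "\<dots> = Ev C ?W \<cdot> (dual_map C ?b \<boxtimes> Idt C ?W) \<cdot> (Idt C (Dul C ?W') \<boxtimes> (C.C.evA ?X ?W \<cdot> (dual_map C f \<boxtimes> Idt C (?X \<otimes> ?W)))) \<cdot> Asc C (Dul C ?W') (Dul C ?X') (?X \<otimes> ?W)"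
      by (simp add: db C.C.mas_nat_1[THEN C.reassoc] C.C.mas_nat_2 C.C.interchange_r[THEN C.reassoc])
    also have "\<dots> = Ev C ?W' \<cdot> (Idt C (Dul C ?W') \<boxtimes> (?b \<cdot> C.C.evA ?X' ?W \<cdot> (Idt C (Dul C ?X') \<boxtimes> (f \<boxtimes> Idt C ?W)))) \<cdot> Asc C (Dul C ?W') (Dul C ?X') (?X \<otimes> ?W)"
      by (simp only: C.C.evA_dual_map assms refl C.dom_obj M.dom_obj Ih_obj) (simp add: C.Ev_dual_map[THEN C.reassoc])
    also have "?b \<cdot> C.C.evA ?X' ?W \<cdot> (Idt C (Dul C ?X') \<boxtimes> (f \<boxtimes> Idt C ?W))
      = C.C.evA ?X' ?W' \<cdot> (Idt C (Dul C ?X') \<boxtimes> (Idt C ?X' \<boxtimes> ?b)) \<cdot> (Idt C (Dul C ?X') \<boxtimes> (f \<boxtimes> Idt C ?W))"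
      by (simp add: C.C.pair_nat[THEN C.reassoc])
    also have "Ev C ?W' \<cdot> (Idt C (Dul C ?W') \<boxtimes> \<dots>) \<cdot> Asc C (Dul C ?W') (Dul C ?X') (?X \<otimes> ?W)
      = Ev C ?W' \<cdot> (Idt C (Dul C ?W') \<boxtimes> C.C.evA ?X' ?W') \<cdot> Asc C (Dul C ?W') (Dul C ?X') (?X' \<otimes> ?W') \<cdot> (Idt C ?D \<boxtimes> ((Idt C ?X' \<boxtimes> ?b) \<cdot> (f \<boxtimes> Idt C ?W)))"
      by (simp add: C.C.mas_nat_3 C.C.mas_nat_3[THEN C.reassoc])
    also have "\<dots> = Ev C ?Z' \<cdot> (cinv C (od ?X' A ?V') \<boxtimes> Idt C ?Z') \<cdot> (Idt C ?D \<boxtimes> (out ?X' A ?V' \<cdot> (Idt C ?X' \<boxtimes> ?b) \<cdot> (f \<boxtimes> Idt C ?W)))"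
      by (simp add: Ev_cinv_od_out[THEN C.reassoc3])
    also have "\<dots> = Ev C ?Z' \<cdot> (cinv C (od ?X' A ?V') \<boxtimes> Idt C ?Z') \<cdot> (Idt C ?D \<boxtimes> (?fb \<cdot> out ?X A ?V))"
      by (simp only: fb)
    also have "\<dots> = (Ev C ?Z \<cdot> ((dual_map C ?fb \<cdot> cinv C (od ?X' A ?V')) \<boxtimes> Idt C ?Z)) \<cdot> (Idt C ?D \<boxtimes> out ?X A ?V)"
      by (simp add: C.Ev_dual_map[THEN C.reassoc] C.C.interchange[THEN C.reassoc])
    finally show "Ev C ?Z \<cdot> ((cinv C (od ?X A ?V) \<cdot> (dual_map C ?b \<boxtimes> dual_map C f)) \<boxtimes> Idt C ?Z)
      = Ev C ?Z \<cdot> ((dual_map C ?fb \<cdot> cinv C (od ?X' A ?V')) \<boxtimes> Idt C ?Z)"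
      by (rule C.iso_cancel_right[rotated]) auto
  qed auto
qed

lemma serre_gamma_pre_balancing:
  assumes A [simp]: "A \<in> Obj M"
  shows "pre_balancing C opM M (serre_T C M H A) (serre_gamma C M H A)"
  unfolding pre_balancing_def
proof (intro conjI ballI)
  fix X U V assume "X \<in> Obj C" "U \<in> Obj opM" "V \<in> Obj opM"
  then have [simp]: "X \<in> Obj C" "U \<in> Obj M" "V \<in> Obj M" by simp_all
  show "serre_gamma C M H A X U V \<in> hom M (fob (serre_T C M H A) (U \<lhd>\<^bsub>opM\<^esub> X, V)) (fob (serre_T C M H A) (U, V \<lhd>\<^bsub>opM\<^esub> Dur C X))"
    by (rule homI) (simp_all add: serre_gamma_eq)
  show "iso_arrow M (serre_gamma C M H A X U V)"
    by (simp add: serre_gamma_eq)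
next
  fix f a b assume "f \<in> Arr C" "a \<in> Arr opM" "b \<in> Arr opM"
  then have [simp]: "f \<in> Arr C" "a \<in> Arr M" "b \<in> Arr M" by simp_all
  let ?X = "Dom C f" and ?X' = "Cod C f" and ?V = "Dom M b" and ?V' = "Cod M b"
  let ?D = "dual_map C (rdual_map C f)"
  let ?G = "\<lambda>X V. dual_map C (hm (Idt M A) (cinv C (dual_rdual C X) \<star> Idt M V)) \<cdot> cinv C (od X A V)"
  have d: "f \<cdot> cinv C (dual_rdual C ?X) = cinv C (dual_rdual C ?X') \<cdot> ?D"
    by (rule C.inverse_square) (auto simp: C.dual_rdual_nat)
  have "(f \<star> b) \<bullet> (cinv C (dual_rdual C ?X) \<star> Idt M ?V) = (f \<cdot> cinv C (dual_rdual C ?X)) \<star> b"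
    using act_cmp[of f "cinv C (dual_rdual C ?X)" b "Idt M ?V"] by simp
  also have "\<dots> = (cinv C (dual_rdual C ?X') \<star> Idt M ?V') \<bullet> (?D \<star> b)"
    unfolding d using act_cmp[of "cinv C (dual_rdual C ?X')" ?D "Idt M ?V'" b] by simp
  finally have e: "(f \<star> b) \<bullet> (cinv C (dual_rdual C ?X) \<star> Idt M ?V) = (cinv C (dual_rdual C ?X') \<star> Idt M ?V') \<bullet> (?D \<star> b)" .
  have "?G ?X ?V \<cdot> (dual_map C (hm (Idt M A) b) \<boxtimes> dual_map C f)
    = dual_map C (hm (Idt M A) ((f \<star> b) \<bullet> (cinv C (dual_rdual C ?X) \<star> Idt M ?V))) \<cdot> cinv C (od ?X' A ?V')"
    by (simp add: cinv_od_nat C.dual_map_cmp)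
  also have "\<dots> = dual_map C (hm (Idt M A) (?D \<star> b)) \<cdot> ?G ?X' ?V'"
    by (simp add: e C.dual_map_cmp)
  finally have G: "?G ?X ?V \<cdot> (dual_map C (hm (Idt M A) b) \<boxtimes> dual_map C f) = dual_map C (hm (Idt M A) (?D \<star> b)) \<cdot> ?G ?X' ?V'" .
  have cm: "cinv M (mas (Dul C (Ih A ?V)) (Dul C ?X) (Cod M a)) \<bullet> (dual_map C (hm (Idt M A) b) \<star> (dual_map C f \<star> a))
    = ((dual_map C (hm (Idt M A) b) \<boxtimes> dual_map C f) \<star> a) \<bullet> cinv M (mas (Dul C (Ih A ?V')) (Dul C ?X') (Dom M a))"
    by (rule M.inverse_square[symmetric])
      (auto simp: mas_nat[of "dual_map C (hm (Idt M A) b)" _ _ "dual_map C f" _ _ a] hom_def)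
  have "serre_gamma C M H A ?X (Cod M a) ?V \<bullet> (dual_map C (hm (Idt M A) b) \<star> (dual_map C f \<star> a))
    = (?G ?X ?V \<star> Idt M (Cod M a)) \<bullet> ((dual_map C (hm (Idt M A) b) \<boxtimes> dual_map C f) \<star> a)
      \<bullet> cinv M (mas (Dul C (Ih A ?V')) (Dul C ?X') (Dom M a))"
    by (simp add: serre_gamma_eq cm)
  also have "\<dots> = ((?G ?X ?V \<cdot> (dual_map C (hm (Idt M A) b) \<boxtimes> dual_map C f)) \<star> (Idt M (Cod M a) \<bullet> a)) \<bullet> cinv M (mas (Dul C (Ih A ?V')) (Dul C ?X') (Dom M a))"
    by (subst act_cmp) auto
  also have "\<dots> = ((dual_map C (hm (Idt M A) (?D \<star> b)) \<cdot> ?G ?X' ?V') \<star> (a \<bullet> Idt M (Dom M a))) \<bullet> cinv M (mas (Dul C (Ih A ?V')) (Dul C ?X') (Dom M a))"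
    by (simp only: G) simp
  also have "\<dots> = (dual_map C (hm (Idt M A) (?D \<star> b)) \<star> a) \<bullet> serre_gamma C M H A ?X' (Dom M a) ?V'"
    by (subst act_cmp) (auto simp: serre_gamma_eq)
  finally show "serre_gamma C M H A (Dom C f) (Dom opM a) (Cod opM b) \<bullet> far (serre_T C M H A) (a \<unlhd>\<^bsub>opM\<^esub> f, b)
    = far (serre_T C M H A) (a, b \<unlhd>\<^bsub>opM\<^esub> rdual_map C f) \<bullet> serre_gamma C M H A (Cod C f) (Cod opM a) (Dom opM b)"
    by simp
qed

text \<open>Balanced dinatural transformations without right duals: the balancing is required at \<open>X \<odot>
  U\<close> for all \<open>X\<close> and not only for the duals \<open>(\<^sup>*X)\<^sup>*\<close>.\<close>

definition coend_cone :: "'p \<Rightarrow> 'p \<Rightarrow> ('p \<Rightarrow> 'b) \<Rightarrow> bool" where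
  "coend_cone A R m \<longleftrightarrow> R \<in> Obj M \<and> (\<forall>U \<in> Obj M. m U \<in> hom M (Dul C (Ih A U) \<odot> U) R)
    \<and> (\<forall>u \<in> Arr M. m (Cod M u) \<bullet> (Idt C (Dul C (Ih A (Cod M u))) \<star> u)
      = m (Dom M u) \<bullet> (dual_map C (hm (Idt M A) u) \<star> Idt M (Dom M u)))
    \<and> (\<forall>X \<in> Obj C. \<forall>U \<in> Obj M. m (X \<odot> U) = m U \<bullet> (Idt C (Dul C (Ih A U)) \<star> evA X U)
      \<bullet> mas (Dul C (Ih A U)) (Dul C X) (X \<odot> U) \<bullet> (od X A U \<star> Idt M (X \<odot> U)))"

text \<open>Dinaturality along the isomorphism \<open>X \<simeq> (\<^sup>*X)\<^sup>*\<close> moves the condition from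
  \<open>(\<^sup>*X)\<^sup>* \<odot> U\<close> to \<open>X \<odot> U\<close>. The two sides are then compared after
  composing with the isomorphism \<open>?w\<close> that takes \<open>X\<^sup>* \<odot> (X \<odot> U)\<close> to
  \<open>(\<^sup>*X \<otimes> X)\<^sup>* \<odot> U\<close>.\<close>

lemma balanced_dinatural_iff:
  assumes A [simp]: "A \<in> Obj M"
  shows "balanced_dinatural_to C opM M (serre_T C M H A) (serre_gamma C M H A) R m \<longleftrightarrow> coend_cone A R m"
proof -
  have d: "dinatural_to opM M (serre_T C M H A) R m \<longleftrightarrow> R \<in> Obj M \<and> (\<forall>U \<in> Obj M. m U \<in> hom M (Dul C (Ih A U) \<odot> U) R)
    \<and> (\<forall>u \<in> Arr M. m (Cod M u) \<bullet> (Idt C (Dul C (Ih A (Cod M u))) \<star> u)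
      = m (Dom M u) \<bullet> (dual_map C (hm (Idt M A) u) \<star> Idt M (Dom M u)))"
    by (auto simp: dinatural_to_def)
  have b: "m U \<bullet> far (serre_T C M H A) ((Idt opM U \<unlhd>\<^bsub>opM\<^esub> Cvr C X) \<cdot>\<^bsub>opM\<^esub> cinv opM (RMUn opM U), Idt opM U)
          = m (U \<lhd>\<^bsub>opM\<^esub> Dur C X) \<bullet> serre_gamma C M H A X (U \<lhd>\<^bsub>opM\<^esub> Dur C X) U
              \<bullet> far (serre_T C M H A) (cinv opM (RMAs opM U (Dur C X) X), Idt opM U)
     \<longleftrightarrow> m (X \<odot> U) = m U \<bullet> (Idt C (Dul C (Ih A U)) \<star> evA X U)
      \<bullet> mas (Dul C (Ih A U)) (Dul C X) (X \<odot> U) \<bullet> (od X A U \<star> Idt M (X \<odot> U))" (is "?l1 = ?l2 \<longleftrightarrow> ?G")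
    if din: "dinatural_to opM M (serre_T C M H A) R m" and [simp]: "X \<in> Obj C" "U \<in> Obj M" for X U
  proof -
    have [simp]: "m U \<in> Arr M" "Dom M (m U) = Dul C (Ih A U) \<odot> U" "Cod M (m U) = R" if "U \<in> Obj M" for U
      using din that by (auto simp: d hom_def)
    let ?Y = "Dul C (Ih A U)" and ?X = "Dul C X" and ?Z = "Dul C (Dur C X) \<odot> U"
    let ?dr = "dual_rdual C X" let ?a = "?dr \<star> Idt M U" let ?Y' = "Dul C (Ih A (X \<odot> U))"
    have ca: "cinv M ?a = cinv C ?dr \<star> Idt M U" by (simp add: cinv_ract)
    let ?w = "Idt C ?Y \<star> ((dual_ten C (Dur C X) X \<star> Idt M U) \<bullet> cinv M (mas ?X (Dul C (Dur C X)) U) \<bullet> (Idt C ?X \<star> ?a))"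
    have [simp]: "iso_arrow M ?w" by simp
    have i1: "mun U \<bullet> cinv M (dual_unt C \<star> Idt M U) \<bullet> (dual_map C (Cvr C X) \<star> Idt M U) \<bullet> (dual_ten C (Dur C X) X \<star> Idt M U)
        \<bullet> cinv M (mas ?X (Dul C (Dur C X)) U) \<bullet> (Idt C ?X \<star> ?a) = evA X U"
    proof -
      have "(dual_map C (Cvr C X) \<star> Idt M U) \<bullet> (dual_ten C (Dur C X) X \<star> Idt M U)
        \<bullet> cinv M (mas ?X (Dul C (Dur C X)) U) \<bullet> (Idt C ?X \<star> ?a)
       = ((dual_map C (Cvr C X) \<cdot> dual_ten C (Dur C X) X \<cdot> (Idt C ?X \<boxtimes> ?dr)) \<star> Idt M U) \<bullet> cinv M (mas ?X X U)"
        by (simp add: cmas_nat_2r)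
      also have "\<dots> = (dual_unt C \<star> Idt M U) \<bullet> (Ev C X \<star> Idt M U) \<bullet> cinv M (mas ?X X U)"
        by (simp only: C.dual_Cvr \<open>X \<in> Obj C\<close>) simp
      finally show ?thesis by (simp add: pair_def)
    qed
    have "?l1 \<bullet> ?w = m U \<bullet> (Idt C ?Y \<star> (mun U \<bullet> cinv M (dual_unt C \<star> Idt M U) \<bullet> (dual_map C (Cvr C X) \<star> Idt M U) \<bullet> (dual_ten C (Dur C X) X \<star> Idt M U)
        \<bullet> cinv M (mas ?X (Dul C (Dur C X)) U) \<bullet> (Idt C ?X \<star> ?a)))"
      by (simp add: M.cinv_cmp del: cinv_ract)
    then have w1: "?l1 \<bullet> ?w = m U \<bullet> (Idt C ?Y \<star> evA X U)" by (simp only: i1)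
    have dn: "m ?Z \<bullet> (dual_map C (hm (Idt M A) (cinv M ?a)) \<star> Idt M ?Z) = m (X \<odot> U) \<bullet> (Idt C ?Y' \<star> cinv M ?a)"
      using din[unfolded d] by (auto dest!: bspec[of _ _ "cinv M ?a"])
    have "?l2 \<bullet> ?w = m ?Z \<bullet> (dual_map C (hm (Idt M A) (cinv M ?a)) \<star> Idt M ?Z) \<bullet> (cinv C (od X A U) \<star> Idt M ?Z) \<bullet> cinv M (mas ?Y ?X ?Z)
        \<bullet> (Idt C ?Y \<star> (Idt C ?X \<star> ?a))"
      by (simp add: serre_gamma_eq ca M.cinv_cmp)
    also have "\<dots> = m (X \<odot> U) \<bullet> (Idt C ?Y' \<star> cinv M ?a) \<bullet> (cinv C (od X A U) \<star> Idt M ?Z) \<bullet> cinv M (mas ?Y ?X ?Z)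
        \<bullet> (Idt C ?Y \<star> (Idt C ?X \<star> ?a))"
      by (simp add: dn[THEN M.reassoc])
    also have "\<dots> = m (X \<odot> U) \<bullet> (cinv C (od X A U) \<star> Idt M (X \<odot> U)) \<bullet> cinv M (mas ?Y ?X (X \<odot> U))"
      by (simp add: cmas_nat_3r interchange[THEN M.reassoc])
    finally have w2: "?l2 \<bullet> ?w = m (X \<odot> U) \<bullet> (cinv C (od X A U) \<star> Idt M (X \<odot> U)) \<bullet> cinv M (mas ?Y ?X (X \<odot> U))" .
    let ?v = "mas ?Y ?X (X \<odot> U) \<bullet> (od X A U \<star> Idt M (X \<odot> U))"
    have [simp]: "iso_arrow M ?v" by simp
    have "?l1 = ?l2 \<longleftrightarrow> ?l1 \<bullet> ?w = ?l2 \<bullet> ?w"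
      by (rule M.iso_cancel_right_iff[symmetric]) (auto simp: serre_gamma_eq)
    also have "\<dots> \<longleftrightarrow> (?l1 \<bullet> ?w) \<bullet> ?v = (?l2 \<bullet> ?w) \<bullet> ?v"
      unfolding w1 w2 by (rule M.iso_cancel_right_iff[symmetric]) auto
    also have "\<dots> \<longleftrightarrow> m U \<bullet> (Idt C ?Y \<star> evA X U) \<bullet> ?v = m (X \<odot> U)"
      unfolding w1 w2 by (simp flip: cinv_ract)
    finally show ?thesis by (auto simp: eq_commute)
  qed
  have "balanced_dinatural_to C opM M (serre_T C M H A) (serre_gamma C M H A) R m \<longleftrightarrow>
    dinatural_to opM M (serre_T C M H A) R m \<and> (\<forall>X \<in> Obj C. \<forall>U \<in> Obj M. m (X \<odot> U) = m U \<bullet> (Idt C (Dul C (Ih A U)) \<star> evA X U)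
      \<bullet> mas (Dul C (Ih A U)) (Dul C X) (X \<odot> U) \<bullet> (od X A U \<star> Idt M (X \<odot> U)))"
    unfolding balanced_dinatural_to_def opM_simps(1) using b by blast
  then show ?thesis
    by (simp only: d coend_cone_def conj_assoc)
qed

lemma serre_coend_iff:
  assumes "A \<in> Obj M"
  shows "serre_coend C M H A Q m \<longleftrightarrow> coend_cone A Q m
    \<and> (\<forall>R n. coend_cone A R n \<longrightarrow> (\<exists>!g. g \<in> hom M Q R \<and> (\<forall>U \<in> Obj M. g \<bullet> m U = n U)))"
  using assms
  by (simp add: serre_coend_def module_coend_def serre_T_functor serre_gamma_pre_balancing balanced_dinatural_iff)

end

context trace
begin

lemma leg_coend: "A \<in> Obj M \<Longrightarrow> serre_coend C M H A (S\<^sub>o A) (leg A)"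
proof -
  assume [simp]: "A \<in> Obj M"
  have "coend_cone A (S\<^sub>o A) (leg A)"
    unfolding coend_cone_def
  proof (intro conjI ballI)
    fix u assume [simp]: "u \<in> Arr M"
    show "leg A (Cod M u) \<bullet> (Idt C (Dul C (Ih A (Cod M u))) \<star> u) = leg A (Dom M u) \<bullet> (dual_map C (hm (Idt M A) u) \<star> Idt M (Dom M u))"
      using leg_nat[of "Idt M A" u] by simp
  qed (auto intro!: homI leg_balanced)
  then show ?thesis
    unfolding serre_coend_iff[OF \<open>A \<in> Obj M\<close>]
    by (intro conjI allI impI) (assumption, rule leg_universal, auto simp: coend_cone_def)
qed

text \<open>The legs are jointly epic, because the leg at \<open>S A\<close> is split by \<open>\<tau>
  A\<close>.\<close>

lemma leg_epi:
  assumes "\<And>U. U \<in> Obj M \<Longrightarrow> g \<bullet> leg A U = g' \<bullet> leg A U"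
    and [simp]: "A \<in> Obj M" "g \<in> Arr M" "g' \<in> Arr M" "Dom M g = S\<^sub>o A" "Dom M g' = S\<^sub>o A"
  shows "g = g'"
proof -
  have "g \<bullet> (leg A (S\<^sub>o A) \<bullet> (\<tau> A \<star> Idt M (S\<^sub>o A))) = g' \<bullet> (leg A (S\<^sub>o A) \<bullet> (\<tau> A \<star> Idt M (S\<^sub>o A)))"
    using M.reassoc[OF assms(1)[of "S\<^sub>o A"], of "\<tau> A \<star> Idt M (S\<^sub>o A)"] by simp
  then show ?thesis
    by (simp add: leg_tau M.iso_cancel_right_iff)
qed

lemma twist_nat:
  assumes [simp]: "f \<in> Arr C" "u \<in> Arr M"
  shows "S\<^sub>a (f \<star> u) \<bullet> twist (Dom C f) (Dom M u) = twist (Cod C f) (Cod M u) \<bullet> (dual_map C (dual_map C f) \<star> S\<^sub>a u)"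
proof -
  have 1: "f \<star> u = (Idt C (Cod C f) \<star> u) \<bullet> (f \<star> Idt M (Dom M u))" by (rule act_split) auto
  have 2: "dual_map C (dual_map C f) \<star> S\<^sub>a u
    = (Idt C (Dul C (Dul C (Cod C f))) \<star> S\<^sub>a u) \<bullet> (dual_map C (dual_map C f) \<star> Idt M (S\<^sub>o (Dom M u)))"
    using act_split[of "dual_map C (dual_map C f)" "S\<^sub>a u"] by simp
  show ?thesis
    unfolding 1 2 by (simp add: S_cmp twist_nat_X twist_nat_A[THEN M.reassoc])
qed

end

section \<open>Module functors into the twisted module category\<close>

lemma bop_simps [simp]:
  "Obj (bop C M) = Obj M" "Arr (bop C M) = Arr M" "Dom (bop C M) = Dom M" "Cod (bop C M) = Cod M"
  "Idt (bop C M) = Idt M" "Cmp (bop C M) = Cmp M" "Add (bop C M) = Add M" "Zer (bop C M) = Zer M"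
  "Scl (bop C M) = Scl M" "hom (bop C M) = hom M" "iso_arrow (bop C M) = iso_arrow M"
  "ActO (bop C M) X N = Dul C (Dul C X) \<rhd>\<^bsub>M\<^esub> N"
  "ActA (bop C M) f u = dual_map C (dual_map C f) \<unrhd>\<^bsub>M\<^esub> u"
  "MAs (bop C M) X Y N = MAs M (Dul C (Dul C X)) (Dul C (Dul C Y)) N \<cdot>\<^bsub>M\<^esub> (ddual_ten C X Y \<unrhd>\<^bsub>M\<^esub> Idt M N)"
  "MUn (bop C M) N = MUn M N \<cdot>\<^bsub>M\<^esub> (ddual_unt C \<unrhd>\<^bsub>M\<^esub> Idt M N)"
  by (auto simp: bop_def hom_def iso_arrow_def inverse_arrows_def fun_eq_iff)

lemma linear_category_bop [simp]: "linear_category (bop C M) \<longleftrightarrow> linear_category M"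
  by (simp add: linear_category_def linear_category_axioms_def category_def)

lemma linear_functor_bop [simp]: "linear_functor M (bop C M) F \<longleftrightarrow> linear_functor M M F"
  by (simp add: linear_functor_def is_functor_def category_def)

lemma action_if_left_module_category:
  assumes "left_module_category C M"
  shows "action C M (ActO M) (ActA M) (MAs M) (MUn M)"
proof -
  interpret left_module_category C M by fact
  show ?thesis
    by unfold_locales (auto simp: act_functor mas_iso mas_nat mun_iso mun_nat mod_pentagon mod_triangle)
qed

text \<open>Each axiom is the corresponding property of \<open>twist\<close>, inverted.\<close>

lemma serre_module_structure_trace:
  fixes C :: "('o, 'a, 'k::field) tcat" and M :: "('p, 'b, 'k, 'o, 'a) lmod"
  assumes "trace C M H S t" and lin: "linear_functor M M S"
  shows "serre_module_structure C M H S (\<lambda>X A. cinv M (trace.twist C M H S t X A))"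
proof -
  interpret trace C M H S t by fact
  have hex: "mas (Dul C (Dul C X)) (Dul C (Dul C Y)) (S\<^sub>o A) \<bullet> (ddual_ten C X Y \<star> Idt M (S\<^sub>o A)) \<bullet> cinv M (twist (X \<otimes>\<^bsub>C\<^esub> Y) A)
    = (Idt C (Dul C (Dul C X)) \<star> cinv M (twist Y A)) \<bullet> cinv M (twist X (Y \<odot> A)) \<bullet> S\<^sub>a (mas X Y A)"
    if [simp]: "X \<in> Obj C" "Y \<in> Obj C" "A \<in> Obj M" for X Y A
  proof -
    have "(mas (Dul C (Dul C X)) (Dul C (Dul C Y)) (S\<^sub>o A) \<bullet> (ddual_ten C X Y \<star> Idt M (S\<^sub>o A))) \<bullet> cinv M (twist (X \<otimes>\<^bsub>C\<^esub> Y) A)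
      = cinv M (twist X (Y \<odot> A) \<bullet> (Idt C (Dul C (Dul C X)) \<star> twist Y A)) \<bullet> S\<^sub>a (mas X Y A)"
      by (rule M.inverse_square) (auto simp: twist_mas)
    then show ?thesis by (simp add: M.cinv_cmp cinv_lact)
  qed
  have unit: "mun (S\<^sub>o A) \<bullet> (ddual_unt C \<star> Idt M (S\<^sub>o A)) \<bullet> cinv M (twist (Unt C) A) = S\<^sub>a (mun A)"
    if [simp]: "A \<in> Obj M" for A
    by (simp add: twist_mun[symmetric, THEN M.reassoc])
  have nat: "cinv M (twist (Cod C f) (Cod M u)) \<bullet> S\<^sub>a (f \<star> u)
    = (dual_map C (dual_map C f) \<star> S\<^sub>a u) \<bullet> cinv M (twist (Dom C f) (Dom M u))"
    if [simp]: "f \<in> Arr C" "u \<in> Arr M" for f u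
    by (rule M.inverse_square[symmetric]) (auto simp: twist_nat)
  have "module_functor C M (bop C M) S (\<lambda>X A. cinv M (twist X A))"
    unfolding module_functor_def using lin by (auto intro!: homI simp: nat hex unit)
  moreover have "hm (Idt M B) (cinv M (twist X A)) \<cdot>\<^bsub>C\<^esub> \<phi> (X \<odot> A) B
    = out (Dul C (Dul C X)) B (S\<^sub>o A) \<cdot>\<^bsub>C\<^esub> (Idt C (Dul C (Dul C X)) \<boxtimes>\<^bsub>C\<^esub> \<phi> A B) \<cdot>\<^bsub>C\<^esub> ind X A B"
    if [simp]: "X \<in> Obj C" "A \<in> Obj M" "B \<in> Obj M" for X A B
    by (simp add: phi_twist flip: hmR_iso(2))
  ultimately show ?thesis
    unfolding serre_module_structure_def using phi_serre_iso phi_balanced by blast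
qed

text \<open>A module functor structure can be moved along a family of isomorphisms \<open>\<eta> A : F A \<rightarrow>
  G A\<close>, provided that \<open>G\<close> on arrows and the structure \<open>u\<close> are conjugate to those of
  \<open>F\<close>.\<close>

lemma transport_module_functor:
  fixes C :: "('o, 'a, 'k::field) tcat" and M :: "('p, 'b, 'k, 'o, 'a) lmod"
  assumes M: "left_module_category C M"
    and F: "module_functor C M (bop C M) F s"
    and e: "\<And>A. A \<in> Obj M \<Longrightarrow> \<eta> A \<in> hom M (fob F A) (fob G A) \<and> iso_arrow M (\<eta> A)"
    and G: "\<And>f. f \<in> Arr M \<Longrightarrow> far G f = \<eta> (Cod M f) \<cdot>\<^bsub>M\<^esub> far F f \<cdot>\<^bsub>M\<^esub> cinv M (\<eta> (Dom M f))"
    and u: "\<And>X A. X \<in> Obj C \<Longrightarrow> A \<in> Obj M \<Longrightarrow>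
      u X A = (Idt C (Dul C (Dul C X)) \<unrhd>\<^bsub>M\<^esub> \<eta> A) \<cdot>\<^bsub>M\<^esub> s X A \<cdot>\<^bsub>M\<^esub> cinv M (\<eta> (X \<rhd>\<^bsub>M\<^esub> A))"
  shows "module_nat_iso C M (bop C M) F s G u \<eta>"
proof -
  interpret action C M "ActO M" "ActA M" "MAs M" "MUn M"
    by (rule action_if_left_module_category) fact
  interpret L: linear_category M
    using F by (simp add: module_functor_def linear_functor_def)
  have lin: "linear_functor M M F" using F by (simp add: module_functor_def)
  then have Fo [simp]: "A \<in> Obj M \<Longrightarrow> fob F A \<in> Obj M" for A by (simp add: linear_functor_def is_functor_def)
  have Fa [simp]: "f \<in> Arr M \<Longrightarrow> far F f \<in> Arr M" "f \<in> Arr M \<Longrightarrow> Dom M (far F f) = fob F (Dom M f)"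
    "f \<in> Arr M \<Longrightarrow> Cod M (far F f) = fob F (Cod M f)" "A \<in> Obj M \<Longrightarrow> far F (Idt M A) = Idt M (fob F A)" for f A
    using lin by (auto simp: linear_functor_def is_functor_def hom_def)
  have Fc: "f \<in> Arr M \<Longrightarrow> g \<in> Arr M \<Longrightarrow> Cod M f = Dom M g \<Longrightarrow> far F (g \<bullet> f) = far F g \<bullet> far F f" for f g
    using lin by (auto simp: linear_functor_def is_functor_def)
  have [simp]: "\<eta> A \<in> Arr M" "Dom M (\<eta> A) = fob F A" "Cod M (\<eta> A) = fob G A" "iso_arrow M (\<eta> A)" if "A \<in> Obj M" for A
    using e[OF that] by (auto simp: hom_def)
  have Go [simp]: "fob G A \<in> Obj M" if "A \<in> Obj M" for A
    using M.cod_obj[of "\<eta> A"] that by simp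
  have s [simp]: "s X A \<in> Arr M" "Dom M (s X A) = fob F (ActO M X A)" "Cod M (s X A) = ActO M (Dul C (Dul C X)) (fob F A)"
    "iso_arrow M (s X A)" if "X \<in> Obj C" "A \<in> Obj M" for X A
    using F that by (auto simp: module_functor_def hom_def)
  have sn: "s (Cod C f) (Cod M v) \<bullet> far F (ActA M f v) = ActA M (dual_map C (dual_map C f)) (far F v) \<bullet> s (Dom C f) (Dom M v)"
    if "f \<in> Arr C" "v \<in> Arr M" for f v
    using F that by (auto simp: module_functor_def)
  have sm: "MAs M (Dul C (Dul C X)) (Dul C (Dul C Y)) (fob F A) \<bullet> ActA M (ddual_ten C X Y) (Idt M (fob F A)) \<bullet> s (X \<otimes>\<^bsub>C\<^esub> Y) A
    = ActA M (Idt C (Dul C (Dul C X))) (s Y A) \<bullet> s X (ActO M Y A) \<bullet> far F (MAs M X Y A)"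
    if "X \<in> Obj C" "Y \<in> Obj C" "A \<in> Obj M" for X Y A
    using F that by (auto simp: module_functor_def)
  have su: "MUn M (fob F A) \<bullet> ActA M (ddual_unt C) (Idt M (fob F A)) \<bullet> s (Unt C) A = far F (MUn M A)"
    if "A \<in> Obj M" for A
    using F that by (auto simp: module_functor_def)
  have "is_functor M M G"
    unfolding is_functor_def by (auto simp: G Fc M.category_axioms intro!: homI)
  moreover have "far G (Add M f g) = Add M (far G f) (far G g)" if f: "f \<in> hom M A B" "g \<in> hom M A B" for f g A B
  proof -
    have [simp]: "A \<in> Obj M" "B \<in> Obj M" using f M.dom_obj[of f] M.cod_obj[of f] by (auto simp: hom_def)
    have F2: "far F f \<in> hom M (fob F A) (fob F B)" "far F g \<in> hom M (fob F A) (fob F B)"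
      using f by (auto simp: hom_def)
    have c: "cinv M (\<eta> A) \<in> hom M (fob G A) (fob F A)" and b: "\<eta> B \<in> hom M (fob F B) (fob G B)"
      by (auto intro!: homI)
    have a: "Add M f g \<in> hom M A B" using f by (rule L.add_hom)
    have "far F (Add M f g) = Add M (far F f) (far F g)"
      using lin f by (auto simp: linear_functor_def)
    then have "far G (Add M f g) = \<eta> B \<bullet> Add M (far F f) (far F g) \<bullet> cinv M (\<eta> A)"
      using a by (simp add: G hom_def)
    also have "\<dots> = Add M (\<eta> B \<bullet> far F f \<bullet> cinv M (\<eta> A)) (\<eta> B \<bullet> far F g \<bullet> cinv M (\<eta> A))"
      using L.cmp_add_left[OF c F2] L.cmp_add_right[OF M.cmp_hom[OF c F2(1)] M.cmp_hom[OF c F2(2)] b] by simp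
    finally show ?thesis using f by (simp add: G hom_def)
  qed
  moreover have "far G (Scl M k f) = Scl M k (far G f)" if [simp]: "f \<in> Arr M" for f k
  proof -
    let ?A = "Dom M f" and ?B = "Cod M f"
    have F2: "far F f \<in> hom M (fob F ?A) (fob F ?B)" by (auto simp: hom_def)
    have c: "cinv M (\<eta> ?A) \<in> hom M (fob G ?A) (fob F ?A)" and b: "\<eta> ?B \<in> hom M (fob F ?B) (fob G ?B)"
      by (auto intro!: homI)
    have a: "Scl M k f \<in> hom M ?A ?B" by (rule L.scl_hom) (simp add: hom_def)
    have "far F (Scl M k f) = Scl M k (far F f)"
      using lin by (auto simp: linear_functor_def)
    then have "far G (Scl M k f) = \<eta> ?B \<bullet> Scl M k (far F f) \<bullet> cinv M (\<eta> ?A)"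
      using a by (simp add: G hom_def)
    also have "\<dots> = Scl M k (\<eta> ?B \<bullet> far F f \<bullet> cinv M (\<eta> ?A))"
      using L.cmp_scl_left[OF c F2] L.cmp_scl_right[OF M.cmp_hom[OF c F2] b] by simp
    finally show ?thesis by (simp add: G)
  qed
  ultimately have lG: "linear_functor M M G"
    using lin by (auto simp: linear_functor_def)
  have nat: "u (Cod C f) (Cod M v) \<bullet> far G (ActA M f v) = ActA M (dual_map C (dual_map C f)) (far G v) \<bullet> u (Dom C f) (Dom M v)"
    if [simp]: "f \<in> Arr C" "v \<in> Arr M" for f v
  proof -
    let ?V = "Dul C (Dul C (Cod C f))" and ?f = "dual_map C (dual_map C f)"
    have 1: "ActA M ?f (far F v) = ActA M (Idt C ?V) (far F v) \<bullet> ActA M ?f (Idt M (fob F (Dom M v)))"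
      using act_split[of ?f "far F v"] by simp
    have 2: "ActA M ?f (far G v) = ActA M (Idt C ?V) (far G v) \<bullet> ActA M ?f (Idt M (fob G (Dom M v)))"
      using act_split[of ?f "far G v"] by (simp add: G)
    have "u (Cod C f) (Cod M v) \<bullet> far G (ActA M f v)
      = ActA M (Idt C ?V) (\<eta> (Cod M v)) \<bullet> (s (Cod C f) (Cod M v) \<bullet> far F (ActA M f v)) \<bullet> cinv M (\<eta> (ActO M (Dom C f) (Dom M v)))"
      by (simp add: u G)
    also have "\<dots> = ActA M (Idt C ?V) (\<eta> (Cod M v)) \<bullet> (ActA M (Idt C ?V) (far F v) \<bullet> ActA M ?f (Idt M (fob F (Dom M v))) \<bullet> s (Dom C f) (Dom M v))
      \<bullet> cinv M (\<eta> (ActO M (Dom C f) (Dom M v)))"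
      unfolding sn[OF that] 1 by simp
    also have "\<dots> = ActA M ?f (far G v) \<bullet> u (Dom C f) (Dom M v)"
      unfolding 2 by (simp add: u G interchange[THEN M.reassoc])
    finally show ?thesis .
  qed
  have hex: "(MAs M (Dul C (Dul C X)) (Dul C (Dul C Y)) (fob G A) \<bullet> ActA M (ddual_ten C X Y) (Idt M (fob G A))) \<bullet> u (X \<otimes>\<^bsub>C\<^esub> Y) A
    = ActA M (Idt C (Dul C (Dul C X))) (u Y A) \<bullet> u X (ActO M Y A) \<bullet> far G (MAs M X Y A)"
    if [simp]: "X \<in> Obj C" "Y \<in> Obj C" "A \<in> Obj M" for X Y A
  proof -
    let ?V = "Dul C (Dul C X)" and ?V' = "Dul C (Dul C Y)"
    have "(MAs M ?V ?V' (fob G A) \<bullet> ActA M (ddual_ten C X Y) (Idt M (fob G A))) \<bullet> u (X \<otimes>\<^bsub>C\<^esub> Y) A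
      = ActA M (Idt C ?V) (ActA M (Idt C ?V') (\<eta> A)) \<bullet> (MAs M ?V ?V' (fob F A) \<bullet> ActA M (ddual_ten C X Y) (Idt M (fob F A)) \<bullet> s (X \<otimes>\<^bsub>C\<^esub> Y) A)
        \<bullet> cinv M (\<eta> (ActO M (X \<otimes>\<^bsub>C\<^esub> Y) A))"
      by (simp add: u interchange[THEN M.reassoc] mas_nat_3[THEN M.reassoc])
    also have "\<dots> = ActA M (Idt C ?V) (u Y A) \<bullet> u X (ActO M Y A) \<bullet> far G (MAs M X Y A)"
      unfolding sm[OF that] by (simp add: u G)
    finally show ?thesis .
  qed
  have unit: "(MUn M (fob G A) \<bullet> ActA M (ddual_unt C) (Idt M (fob G A))) \<bullet> u (Unt C) A = far G (MUn M A)"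
    if [simp]: "A \<in> Obj M" for A
  proof -
    have "(MUn M (fob G A) \<bullet> ActA M (ddual_unt C) (Idt M (fob G A))) \<bullet> u (Unt C) A
      = \<eta> A \<bullet> (MUn M (fob F A) \<bullet> ActA M (ddual_unt C) (Idt M (fob F A)) \<bullet> s (Unt C) A) \<bullet> cinv M (\<eta> (ActO M (Unt C) A))"
      by (simp add: u interchange[THEN M.reassoc] mun_nat[THEN M.reassoc])
    also have "\<dots> = far G (MUn M A)"
      unfolding su[OF that] by (simp add: G)
    finally show ?thesis .
  qed
  have "module_functor C M (bop C M) G u"
    unfolding module_functor_def
  proof (intro conjI ballI)
    fix X A assume [simp]: "X \<in> Obj C" "A \<in> Obj M"
    show "u X A \<in> hom (bop C M) (fob G (ActO M X A)) (ActO (bop C M) X (fob G A))" "iso_arrow (bop C M) (u X A)"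
      by (auto simp: u intro!: homI)
  qed (simp_all add: lG nat hex unit del: M.assoc)
  then show ?thesis
    unfolding module_nat_iso_def nat_iso_def using F by (auto simp: u G intro!: homI)
qed

section \<open>Relative Serre functors as module coends\<close>

theorem theorem4p11:
  fixes C :: "('o, 'a, 'k::field) tcat"
    and M :: "('p, 'b, 'k, 'o, 'a) lmod"
    and H :: "('p, 'b, 'o, 'a) ihom"
    and S :: "('p, 'b, 'p, 'b) fctr"
  assumes "tensor_category C"
    and "left_module_category C M"
    and "exact_module_category C M"
    and "indecomposable_module_category C M"
    and "internal_hom C M H"
    and "relative_serre_functor C M H S"
  shows "(\<exists>s. serre_module_structure C M H S s)
    \<and> (\<exists>Q l. \<forall>A \<in> Obj M. serre_coend C M H A (Q A) (l A))
    \<and> (\<forall>s Q l. serre_module_structure C M H S s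
          \<and> (\<forall>A \<in> Obj M. serre_coend C M H A (Q A) (l A))
        \<longrightarrow> (\<exists>\<eta>. module_nat_iso C M (bop C M) S s
              (coend_functor C M H Q l) (coend_module_structure C M H Q l) \<eta>))"
proof -
  interpret action C M "ActO M" "ActA M" "MAs M" "MUn M"
    by (rule action_if_left_module_category) fact
  have lin: "linear_functor M M S"
    using assms(6) by (simp add: relative_serre_functor_def)
  interpret serre C M H S
    using assms(5) lin by unfold_locales (auto simp: linear_functor_def)
  obtain p where p: "serre_iso C M H S p"
    using assms(6) by (auto simp: relative_serre_functor_def)
  have "\<exists>s. serre_module_structure C M H S s"
    using serre_module_structure_trace[OF trace_trace_of[OF p] lin] by blast
  moreover have "\<exists>Q l. \<forall>A \<in> Obj M. serre_coend C M H A (Q A) (l A)"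
    using trace.leg_coend[OF trace_trace_of[OF p]] by blast
  moreover have "\<exists>\<eta>. module_nat_iso C M (bop C M) S s (coend_functor C M H Q m) (coend_module_structure C M H Q m) \<eta>"
    if s: "serre_module_structure C M H S s" and Q: "\<forall>A \<in> Obj M. serre_coend C M H A (Q A) (m A)" for s Q m
  proof -
    obtain p where p: "serre_iso C M H S p" and bal: "serre_iso_balanced C M H S p"
      and sp: "\<And>X A B. X \<in> Obj C \<Longrightarrow> A \<in> Obj M \<Longrightarrow> B \<in> Obj M \<Longrightarrow>
        hm (Idt M B) (s X A) \<cdot>\<^bsub>C\<^esub> p (X \<odot> A) B
        = out (Dul C (Dul C X)) B (S\<^sub>o A) \<cdot>\<^bsub>C\<^esub> (Idt C (Dul C (Dul C X)) \<boxtimes>\<^bsub>C\<^esub> p A B) \<cdot>\<^bsub>C\<^esub> ind X A B"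
      using s unfolding serre_module_structure_def by blast
    interpret t: trace C M H S "trace_of p" by (rule trace_trace_of[OF p])
    have ph: "t.\<phi> A U = p A U" if "A \<in> Obj M" "U \<in> Obj M" for A U
      using phi_trace_of[OF p bal that] .
    have F: "module_functor C M (bop C M) S s" using s by (simp add: serre_module_structure_def)
    then have [simp]: "s X A \<in> Arr M" "Dom M (s X A) = S\<^sub>o (X \<odot> A)" "Cod M (s X A) = Dul C (Dul C X) \<odot> S\<^sub>o A"
      if "X \<in> Obj C" "A \<in> Obj M" for X A
      using that by (auto simp: module_functor_def hom_def)
    \<comment> \<open>The compatibility of \<open>s\<close> with \<open>p\<close>, transposed to the legs.\<close>
    have sl: "s X A \<bullet> t.leg (X \<odot> A) U = (Idt C (Dul C (Dul C X)) \<star> t.leg A U)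
        \<bullet> mas (Dul C (Dul C X)) (Dul C (Ih A U)) U \<bullet> (ind X A U \<star> Idt M U)"
      if [simp]: "X \<in> Obj C" "A \<in> Obj M" "U \<in> Obj M" for X A U
    proof -
      let ?V = "Dul C (Dul C X)"
      have "s X A \<bullet> t.leg (X \<odot> A) U = iev U (?V \<odot> S\<^sub>o A) \<bullet> ((hm (Idt M U) (s X A) \<cdot>\<^bsub>C\<^esub> t.\<phi> (X \<odot> A) U) \<star> Idt M U)"
        by (simp add: iev_hmR[THEN M.reassoc] t.iev_phi)
      also have "\<dots> = iev U (?V \<odot> S\<^sub>o A) \<bullet> ((out ?V U (S\<^sub>o A) \<cdot>\<^bsub>C\<^esub> (Idt C ?V \<boxtimes>\<^bsub>C\<^esub> t.\<phi> A U) \<cdot>\<^bsub>C\<^esub> ind X A U) \<star> Idt M U)"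
        by (simp only: sp ph act_obj that)
      also have "\<dots> = (Idt C ?V \<star> t.leg A U) \<bullet> mas ?V (Dul C (Ih A U)) U \<bullet> (ind X A U \<star> Idt M U)"
        by (simp add: iev_out[THEN M.reassoc] mas_nat_2[THEN M.reassoc] t.iev_phi[THEN lact_lift, THEN M.reassoc])
      finally show ?thesis .
    qed
    have m [simp]: "m A U \<in> Arr M" "Dom M (m A U) = Dul C (Ih A U) \<odot> U" "Cod M (m A U) = Q A" "Q A \<in> Obj M"
      if "A \<in> Obj M" "U \<in> Obj M" for A U
      using Q that by (auto simp: serre_coend_iff coend_cone_def hom_def)
    \<comment> \<open>Two universal families are compared by an isomorphism that respects their legs.\<close>
    have "\<exists>e. e \<in> hom M (S\<^sub>o A) (Q A) \<and> iso_arrow M e \<and> (\<forall>U \<in> Obj M. e \<bullet> t.leg A U = m A U)" if [simp]: "A \<in> Obj M" for A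
    proof -
      have l: "coend_cone A (S\<^sub>o A) (t.leg A)"
        and lu: "\<And>R n. coend_cone A R n \<Longrightarrow> \<exists>!g. g \<in> hom M (S\<^sub>o A) R \<and> (\<forall>U \<in> Obj M. g \<bullet> t.leg A U = n U)"
        using t.leg_coend[of A] by (simp_all add: serre_coend_iff)
      have c: "coend_cone A (Q A) (m A)"
        and mu: "\<And>R n. coend_cone A R n \<Longrightarrow> \<exists>!g. g \<in> hom M (Q A) R \<and> (\<forall>U \<in> Obj M. g \<bullet> m A U = n U)"
        using Q by (simp_all add: serre_coend_iff)
      obtain e where e: "e \<in> hom M (S\<^sub>o A) (Q A)" "\<forall>U \<in> Obj M. e \<bullet> t.leg A U = m A U" using lu[OF c] by blast
      obtain d where d: "d \<in> hom M (Q A) (S\<^sub>o A)" "\<forall>U \<in> Obj M. d \<bullet> m A U = t.leg A U" using mu[OF l] by blast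
      have [simp]: "e \<in> Arr M" "Dom M e = S\<^sub>o A" "Cod M e = Q A" "d \<in> Arr M" "Dom M d = Q A" "Cod M d = S\<^sub>o A"
        using e d by (auto simp: hom_def)
      have [simp]: "Q A \<in> Obj M" using M.dom_obj[of d] by simp
      have "d \<bullet> e = Idt M (S\<^sub>o A)"
        by (rule t.leg_epi[of _ A]) (auto simp: e d)
      moreover have "e \<bullet> d = Idt M (Q A)"
      proof -
        have "e \<bullet> d \<in> hom M (Q A) (Q A) \<and> (\<forall>U \<in> Obj M. (e \<bullet> d) \<bullet> m A U = m A U)"
          "Idt M (Q A) \<in> hom M (Q A) (Q A) \<and> (\<forall>U \<in> Obj M. Idt M (Q A) \<bullet> m A U = m A U)"
          by (auto simp: e d intro!: homI)
        then show ?thesis using mu[OF c] by blast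
      qed
      ultimately have "iso_arrow M e" by (intro M.isoI[of e d]) auto
      with e show ?thesis by blast
    qed
    then obtain \<eta> where eta: "\<And>A. A \<in> Obj M \<Longrightarrow> \<eta> A \<in> hom M (S\<^sub>o A) (Q A)" "\<And>A. A \<in> Obj M \<Longrightarrow> iso_arrow M (\<eta> A)"
      and el: "\<And>A U. A \<in> Obj M \<Longrightarrow> U \<in> Obj M \<Longrightarrow> \<eta> A \<bullet> t.leg A U = m A U"
      by metis
    have [simp]: "\<eta> A \<in> Arr M" "Dom M (\<eta> A) = S\<^sub>o A" "Cod M (\<eta> A) = Q A" "iso_arrow M (\<eta> A)" if "A \<in> Obj M" for A
      using eta[OF that] by (auto simp: hom_def)
    have [simp]: "Q A \<in> Obj M" if "A \<in> Obj M" for A using M.cod_obj[of "\<eta> A"] that by simp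
    have m_epi: "g = g'" if e: "\<And>U. U \<in> Obj M \<Longrightarrow> g \<bullet> m A U = g' \<bullet> m A U"
      and [simp]: "A \<in> Obj M" "g \<in> hom M (Q A) R" "g' \<in> hom M (Q A) R" for g g' A R
    proof -
      have [simp]: "g \<in> Arr M" "Dom M g = Q A" "g' \<in> Arr M" "Dom M g' = Q A"
        using that by (auto simp: hom_def)
      have "g \<bullet> \<eta> A = g' \<bullet> \<eta> A"
        by (rule t.leg_epi[of _ A]) (auto simp: el e)
      then show ?thesis by (simp add: M.iso_cancel_right_iff)
    qed
    have cm: "cinv M (\<eta> A) \<bullet> m A U = t.leg A U" if [simp]: "A \<in> Obj M" "U \<in> Obj M" for A U
      by (simp flip: el)
    have "module_nat_iso C M (bop C M) S s (coend_functor C M H Q m) (coend_module_structure C M H Q m) \<eta>"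
    proof (rule transport_module_functor[OF assms(2) F])
      fix A assume "A \<in> Obj M"
      then show "\<eta> A \<in> hom M (S\<^sub>o A) (fob (coend_functor C M H Q m) A) \<and> iso_arrow M (\<eta> A)"
        by (simp add: coend_functor_def eta)
    next
      fix f assume [simp]: "f \<in> Arr M"
      let ?g = "\<eta> (Cod M f) \<bullet> S\<^sub>a f \<bullet> cinv M (\<eta> (Dom M f))"
      have g: "?g \<in> hom M (Q (Dom M f)) (Q (Cod M f))" by (auto intro!: homI)
      have gm: "?g \<bullet> m (Dom M f) U = m (Cod M f) U \<bullet> (dual_map C (hm f (Idt M U)) \<star> Idt M U)" if [simp]: "U \<in> Obj M" for U
      proof -
        have "?g \<bullet> m (Dom M f) U = \<eta> (Cod M f) \<bullet> S\<^sub>a f \<bullet> t.leg (Dom M f) U" by (simp add: cm)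
        also have "\<dots> = \<eta> (Cod M f) \<bullet> t.leg (Cod M f) U \<bullet> (dual_map C (hm f (Idt M U)) \<star> Idt M U)"
          using t.leg_nat[of f "Idt M U"] by simp
        finally show ?thesis by (simp add: el[THEN M.reassoc])
      qed
      \<comment> \<open>The definite description is satisfied by the conjugate of the value of \<open>S\<close>, and
      the legs \<open>m\<close> are jointly epic.\<close>
      show "far (coend_functor C M H Q m) f = ?g"
        unfolding coend_functor_def fctr.simps
      proof (rule the_equality)
        show "?g \<in> hom M (Q (Dom M f)) (Q (Cod M f)) \<and> (\<forall>U \<in> Obj M. ?g \<bullet> m (Dom M f) U
          = m (Cod M f) U \<bullet> (dual_map C (hm f (Idt M U)) \<star> Idt M U))"
          using g gm by blast
        fix h assume h: "h \<in> hom M (Q (Dom M f)) (Q (Cod M f)) \<and> (\<forall>U \<in> Obj M. h \<bullet> m (Dom M f) U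
          = m (Cod M f) U \<bullet> (dual_map C (hm f (Idt M U)) \<star> Idt M U))"
        show "h = ?g"
        proof (rule m_epi)
          show "h \<bullet> m (Dom M f) U = ?g \<bullet> m (Dom M f) U" if "U \<in> Obj M" for U
            unfolding gm[OF that] using h that by blast
        qed (use h g in simp_all)
      qed
    next
      fix X A assume [simp]: "X \<in> Obj C" "A \<in> Obj M"
      let ?V = "Dul C (Dul C X)"
      let ?g = "(Idt C ?V \<star> \<eta> A) \<bullet> s X A \<bullet> cinv M (\<eta> (X \<odot> A))"
      have g: "?g \<in> hom M (Q (X \<odot> A)) (?V \<odot> Q A)" by (auto intro!: homI)
      have gm: "?g \<bullet> m (X \<odot> A) U = (Idt C ?V \<star> m A U) \<bullet> mas ?V (Dul C (Ih A U)) U \<bullet> (ind X A U \<star> Idt M U)"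
        if [simp]: "U \<in> Obj M" for U
        by (simp add: cm sl el[THEN lact_lift, THEN M.reassoc])
      show "coend_module_structure C M H Q m X A = ?g"
        unfolding coend_module_structure_def
      proof (rule the_equality)
        show "?g \<in> hom M (Q (X \<odot> A)) (?V \<odot> Q A) \<and> (\<forall>U \<in> Obj M. ?g \<bullet> m (X \<odot> A) U
          = (Idt C ?V \<star> m A U) \<bullet> mas ?V (Dul C (Ih A U)) U \<bullet> (ind X A U \<star> Idt M U))"
          using g gm by blast
        fix h assume h: "h \<in> hom M (Q (X \<odot> A)) (?V \<odot> Q A) \<and> (\<forall>U \<in> Obj M. h \<bullet> m (X \<odot> A) U
          = (Idt C ?V \<star> m A U) \<bullet> mas ?V (Dul C (Ih A U)) U \<bullet> (ind X A U \<star> Idt M U))"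
        show "h = ?g"
        proof (rule m_epi)
          show "h \<bullet> m (X \<odot> A) U = ?g \<bullet> m (X \<odot> A) U" if "U \<in> Obj M" for U
            unfolding gm[OF that] using h that by blast
        qed (use h g in simp_all)
      qed
    qed
    then show ?thesis by blast
  qed
  ultimately show ?thesis by blast
qed

end
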